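(* Let $X\in\{B,C,D\}$ and let $\lambda$ be an integral weight of the simple Lie algebra of type $X_n$. Then applying the H-algorithm of type $X$ to the domino type partition $\mathbf p=p(\lambda^-)$ of $2n$ always produces a special partition $\mathbf p^s$ of type $X$.
   Context: $\lambda=(\lambda_1,\dots,\lambda_n)$ in standard coordinates; integral means all $\langle\lambda,\alpha^\vee\rangle\in\mathbb Z$. $\lambda^-=(\lambda_1,\dots,\lambda_n,-\lambda_n,\dots,-\lambda_1)$, and $p(\lambda^-)$ is the shape of the Robinson–Schensted insertion tableau of $\lambda^-$ (row insertion; an inserted entry bumps the leftmost strictly bigger entry of the row into the next row, or is appended if there is none). A domino type partition of $2n$ is a partition equal to the shape of the insertion tableau of ${}^-w=(-w(n),\dots,-w(1),w(1),\dots,w(n))$ for some signed permutation $w$ of $\{\pm1,\dots,\pm n\}$; $p(\lambda^-)$ is of this kind. Special partitions. Type $B$: partitions of $2n+1$ whose even parts have even multiplicity; type $C$ (resp. $D$): partitions of $2n$ whose odd (resp. even) parts have even multiplicity. A type $X$ partition is special if its nilpotent orbit is special in Lusztig's sense, equivalently if its symbol is special; explicitly, its transpose is of type $B$ for $X=B$, of type $C$ for $X=C$, and of type $C$ for $X=D$. Symbols: $B$-symbols are arrays $\binom{\lambda_1<\dots<\lambda_{m+1}}{\mu_1<\dots<\mu_m}$ modulo shift (add 1 to all entries and prepend $0$ to both rows), special if $\lambda_1\le\mu_1\le\lambda_2\le\dots\le\mu_m\le\lambda_{m+1}$; $D$-symbols are arrays $\binom{\lambda_1<\dots<\lambda_m}{\mu_1<\dots<\mu_m}$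 modulo shift and exchange of rows, special if $\lambda_1\le\mu_1\le\dots\le\lambda_m\le\mu_m$ up to exchange of rows. A domino type partition $\mathbf p=[p_1,p_2,\dots]$ (extended by zeros, $p_{2m+2}=0$) has the $B$-symbol with $\{2\lambda_i,2\mu_j+1\}=\{p_k+2m+1-k\}_{1\le k\le2m+1}$ and the $D$-symbol $\binom{\lambda_1,\ \lambda_2,\dots,\lambda_{m+1}}{0,\mu_1+1,\dots,\mu_m+1}$. A type $X$ partition $[d_1,\dots,d_k]$ has symbol given by $\{2\lambda_i+1,2\mu_j\}=\{d_l+k-l\}$ for $X=B$ ($k$ odd), $\{2\lambda_i,2\mu_j+1\}=\{d_l+k-l\}$ for $X=C$ ($k$ made odd by appending $0$), $\{2\lambda_i+1,2\mu_j\}=\{d_l+k-l\}$ for $X=D$ ($k$ even). $\mathbf p^s$ denotes the type $X$ special partition whose symbol is the unique special symbol having the same multiset of entries as the symbol ($B$-symbol for $X=B,C$; $D$-symbol for $X=D$) of $\mathbf p$. H-algorithms. The box $(k,l)$ (row $k$, column $l$) of a Young diagram is even (E) if $k+l$ is even and odd (O) otherwise; $P^{\mathrm{ev}}$, $P^{\mathrm{odd}}$ are the sets of even and odd boxes of the diagram $P$ of $\mathbf p$, with the rows of $P$ remembered. "Put a box on the end of a row" means in the position immediately to the right of the last remaining box of that row (in the first column if none remains). "Fill the holes" means pass to the smallest Young diagram containing all the boxes. Types $C$ and $B$: (1) form $P^{\mathrm{odd}}$; (2) label the rows from the top by $1,2,3,\dots$, skipping every pair of consecutive rows $i,i+1$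 of equal length in $P$ whose last boxes are E (row $i$) and O (row $i+1$), i.e. for which in $P^{\mathrm{odd}}$ the last box of row $i+1$ is one column to the right of that of row $i$; (3) for type $C$: keep odd labeled rows unchanged and put an E on the end of each even labeled row; for type $B$: keep even labeled rows unchanged and put an E on the end of each odd labeled row; (4) fill the holes; for type $B$, if the result has only $2n$ boxes, add one box below the last row in the first column. Type $D$: (1) form $P^{\mathrm{ev}}$; (2) label the rows from the top, skipping every pair of consecutive rows $i,i+1$ of equal length in $P$ whose last boxes are O (row $i$) and E (row $i+1$); (3) keep odd labeled rows unchanged and put an O on the end of each even labeled row; (4) fill the holes; if the result has only $2n-1$ boxes, add one box below the last row in the first column. *)

theory Defs
  imports Complex_Main "HOL-Library.Multiset"
begin

section \<open>Root systems and integral weights\<close>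

datatype cartan_type = TypeB | TypeC | TypeD

text \<open>The ranks for which the algebras \<open>so(2n+1)\<close>, \<open>sp(2n)\<close>, \<open>so(2n)\<close> are simple.\<close>

definition simple_rank :: "cartan_type \<Rightarrow> nat \<Rightarrow> bool" where
  "simple_rank X n \<longleftrightarrow> (case X of TypeD \<Rightarrow> 3 \<le> n | _ \<Rightarrow> 1 \<le> n)"

text \<open>Vectors in standard coordinates are functions on \<open>nat\<close> of which only the coordinates
  \<open>1, \<dots>, n\<close> matter.\<close>

definition std_vec :: "nat \<Rightarrow> nat \<Rightarrow> int" where
  "std_vec i = (\<lambda>k. if k = i then 1 else 0)"

definition roots :: "cartan_type \<Rightarrow> nat \<Rightarrow> (nat \<Rightarrow> int) set" where
  "roots X n =
     {(\<lambda>k. s * std_vec i k + t * std_vec j k) | i j s t.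
        1 \<le> i \<and> i < j \<and> j \<le> n \<and> s \<in> {1, -1} \<and> t \<in> {1, -1}} \<union>
     (case X of
        TypeB \<Rightarrow> {(\<lambda>k. s * std_vec i k) | i s. 1 \<le> i \<and> i \<le> n \<and> s \<in> {1, -1}}
      | TypeC \<Rightarrow> {(\<lambda>k. 2 * s * std_vec i k) | i s. 1 \<le> i \<and> i \<le> n \<and> s \<in> {1, -1}}
      | TypeD \<Rightarrow> {})"

text \<open>\<open>\<langle>\<lambda>, \<alpha>\<^sup>\<or>\<rangle> = 2 (\<lambda>, \<alpha>) / (\<alpha>, \<alpha>)\<close>\<close>

definition coroot_pairing :: "nat \<Rightarrow> (nat \<Rightarrow> complex) \<Rightarrow> (nat \<Rightarrow> int) \<Rightarrow> complex" where
  "coroot_pairing n lam \<alpha> =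
     2 * (\<Sum>i=1..n. lam i * of_int (\<alpha> i)) / (\<Sum>i=1..n. of_int (\<alpha> i * \<alpha> i))"

definition integral_weight :: "cartan_type \<Rightarrow> nat \<Rightarrow> (nat \<Rightarrow> complex) \<Rightarrow> bool" where
  "integral_weight X n lam \<longleftrightarrow> (\<forall>\<alpha>\<in>roots X n. coroot_pairing n lam \<alpha> \<in> \<int>)"


section \<open>Robinson--Schensted insertion\<close>

text \<open>Insertion into a row returns the new row and the bumped entry, if any; a tableau is the list
  of its rows.\<close>

fun row_insert :: "'a::linorder \<Rightarrow> 'a list \<Rightarrow> 'a list \<times> 'a option" where
  "row_insert x [] = ([x], None)"
| "row_insert x (y # ys) =
     (if x < y then (x # ys, Some y)
      else (let (zs, b) = row_insert x ys in (y # zs, b)))"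

fun tableau_insert :: "'a::linorder \<Rightarrow> 'a list list \<Rightarrow> 'a list list" where
  "tableau_insert x [] = [[x]]"
| "tableau_insert x (r # rs) =
     (case row_insert x r of
        (r', None) \<Rightarrow> r' # rs
      | (r', Some y) \<Rightarrow> r' # tableau_insert y rs)"

definition insertion_tableau :: "'a::linorder list \<Rightarrow> 'a list list" where
  "insertion_tableau w = fold tableau_insert w []"

definition rs_shape :: "'a::linorder list \<Rightarrow> nat list" where
  "rs_shape w = map length (insertion_tableau w)"

text \<open>The real part only serves to obtain linearly ordered entries: the coordinates of an integral
  weight are real, see \<open>integral_weight_real\<close>.\<close>

definition lambda_minus :: "nat \<Rightarrow> (nat \<Rightarrow> complex) \<Rightarrow> real list" where
  "lambda_minus n lam =
     map (\<lambda>i. Re (lam i)) [1..<n+1] @ map (\<lambda>i. - Re (lam i)) (rev [1..<n+1])"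

definition signed_permutation :: "nat \<Rightarrow> (int \<Rightarrow> int) \<Rightarrow> bool" where
  "signed_permutation n w \<longleftrightarrow>
     bij_betw w ({- int n..int n} - {0}) ({- int n..int n} - {0}) \<and>
     (\<forall>i\<in>{- int n..int n} - {0}. w (- i) = - w i)"

definition minus_word :: "nat \<Rightarrow> (int \<Rightarrow> int) \<Rightarrow> int list" where
  "minus_word n w = map (\<lambda>i. - w i) (rev [1..int n]) @ map w [1..int n]"

definition domino_type :: "nat \<Rightarrow> nat list \<Rightarrow> bool" where
  "domino_type n p \<longleftrightarrow> (\<exists>w. signed_permutation n w \<and> p = rs_shape (minus_word n w))"


section \<open>Partitions of type B, C, D and special partitions\<close>

definition is_partition :: "nat \<Rightarrow> nat list \<Rightarrow> bool" where
  "is_partition N d \<longleftrightarrow> sorted_wrt (\<ge>) d \<and> 0 \<notin> set d \<and> sum_list d = N"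

text \<open>Parts are numbered from 1, and a partition is extended by zeros.\<close>

definition part :: "nat list \<Rightarrow> nat \<Rightarrow> nat" where
  "part d k = (if 1 \<le> k \<and> k \<le> length d then d ! (k - 1) else 0)"

definition transpose_partition :: "nat list \<Rightarrow> nat list" where
  "transpose_partition d = map (\<lambda>l. card {k. 1 \<le> k \<and> k \<le> length d \<and> l \<le> part d k}) [1..<part d 1 + 1]"

definition partition_size :: "cartan_type \<Rightarrow> nat \<Rightarrow> nat" where
  "partition_size X n = (case X of TypeB \<Rightarrow> 2 * n + 1 | _ \<Rightarrow> 2 * n)"

definition type_partition :: "cartan_type \<Rightarrow> nat \<Rightarrow> nat list \<Rightarrow> bool" where
  "type_partition X n d \<longleftrightarrow>
     is_partition (partition_size X n) d \<and>
     (\<forall>a. (case X of TypeC \<Rightarrow> odd a | _ \<Rightarrow> even a) \<longrightarrow> even (count_list d a))"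

text \<open>The explicit description of the partitions of special nilpotent orbits; note that in type D
  the transpose is required to be of type C.\<close>

definition special_partition :: "cartan_type \<Rightarrow> nat \<Rightarrow> nat list \<Rightarrow> bool" where
  "special_partition X n d \<longleftrightarrow>
     type_partition X n d \<and>
     type_partition (case X of TypeB \<Rightarrow> TypeB | TypeC \<Rightarrow> TypeC | TypeD \<Rightarrow> TypeC) n
       (transpose_partition d)"


section \<open>Symbols\<close>

text \<open>A symbol is given by its upper and lower row. Types B and C use B-symbols, type D uses
  D-symbols.\<close>

type_synonym symbol = "nat list \<times> nat list"

definition is_symbol :: "cartan_type \<Rightarrow> symbol \<Rightarrow> bool" where
  "is_symbol X S \<longleftrightarrow>
     sorted_wrt (<) (fst S) \<and> sorted_wrt (<) (snd S) \<and>
     length (fst S) = (case X of TypeD \<Rightarrow> length (snd S) | _ \<Rightarrow> length (snd S) + 1)"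

definition shift :: "symbol \<Rightarrow> symbol" where
  "shift S = (0 # map Suc (fst S), 0 # map Suc (snd S))"

inductive symbol_equiv :: "cartan_type \<Rightarrow> symbol \<Rightarrow> symbol \<Rightarrow> bool" for X where
  refl: "symbol_equiv X S S"
| sym: "symbol_equiv X S T \<Longrightarrow> symbol_equiv X T S"
| trans: "symbol_equiv X S T \<Longrightarrow> symbol_equiv X T U \<Longrightarrow> symbol_equiv X S U"
| shift: "symbol_equiv X S (shift S)"
| swap: "X = TypeD \<Longrightarrow> symbol_equiv X (L, M) (M, L)"

definition interlaced :: "nat list \<Rightarrow> nat list \<Rightarrow> bool" where
  "interlaced L M \<longleftrightarrow>
     (\<forall>i. i < length L \<and> i < length M \<longrightarrow> L ! i \<le> M ! i) \<and>
     (\<forall>i. i + 1 < length L \<and> i < length M \<longrightarrow> M ! i \<le> L ! (i + 1))"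

definition special_symbol :: "cartan_type \<Rightarrow> symbol \<Rightarrow> bool" where
  "special_symbol X S \<longleftrightarrow> is_symbol X S \<and>
     (interlaced (fst S) (snd S) \<or> X = TypeD \<and> interlaced (snd S) (fst S))"

definition symbol_entries :: "symbol \<Rightarrow> nat multiset" where
  "symbol_entries S = mset (fst S) + mset (snd S)"

text \<open>The symbols below are relations, since a representative depends on the number of zeros
  appended to the partition, and since the rows have the lengths required of a symbol only for
  suitable partitions.\<close>

definition B_symbol_of :: "nat list \<Rightarrow> symbol \<Rightarrow> bool" where
  "B_symbol_of p S \<longleftrightarrow> (\<exists>m. part p (2 * m + 2) = 0 \<and>
     is_symbol TypeB S \<and> length (snd S) = m \<and>
     (\<lambda>a. 2 * a) ` set (fst S) \<union> (\<lambda>b. 2 * b + 1) ` set (snd S) =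
       {part p k + (2 * m + 1 - k) | k. 1 \<le> k \<and> k \<le> 2 * m + 1})"

definition D_symbol_of :: "nat list \<Rightarrow> symbol \<Rightarrow> bool" where
  "D_symbol_of p S \<longleftrightarrow> (\<exists>L M. B_symbol_of p (L, M) \<and> S = (L, 0 # map Suc M))"

definition domino_symbol_of :: "cartan_type \<Rightarrow> nat list \<Rightarrow> symbol \<Rightarrow> bool" where
  "domino_symbol_of X p S \<longleftrightarrow> (case X of TypeD \<Rightarrow> D_symbol_of p S | _ \<Rightarrow> B_symbol_of p S)"

text \<open>The symbol of a partition of type \<open>X\<close>, with \<open>k\<close> parts. For types B and D the number of
  parts is automatically odd, respectively even.\<close>

definition type_symbol_of :: "cartan_type \<Rightarrow> nat list \<Rightarrow> symbol \<Rightarrow> bool" where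
  "type_symbol_of X d S \<longleftrightarrow>
     (let k = (if X = TypeC \<and> even (length d) then length d + 1 else length d) in
       is_symbol X S \<and>
       (case X of
          TypeC \<Rightarrow> (\<lambda>a. 2 * a) ` set (fst S) \<union> (\<lambda>b. 2 * b + 1) ` set (snd S)
        | _ \<Rightarrow> (\<lambda>a. 2 * a + 1) ` set (fst S) \<union> (\<lambda>b. 2 * b) ` set (snd S)) =
       {part d l + (k - l) | l. 1 \<le> l \<and> l \<le> k})"

text \<open>\<open>is_special_of X n p q\<close>: the partition \<open>q\<close> is \<open>p\<^sup>s\<close>. Entries are compared on
  representatives \<open>S\<close>, \<open>T\<close> with rows of the same lengths, which is forced by the equality of the
  multisets.\<close>

definition is_special_of :: "cartan_type \<Rightarrow> nat \<Rightarrow> nat list \<Rightarrow> nat list \<Rightarrow> bool" where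
  "is_special_of X n p q \<longleftrightarrow> special_partition X n q \<and>
     (\<exists>S T U. domino_symbol_of X p S \<and> special_symbol X T \<and> symbol_entries T = symbol_entries S \<and>
        type_symbol_of X q U \<and> symbol_equiv X U T)"


section \<open>The H-algorithms\<close>

text \<open>The box \<open>(k, l)\<close> is in row \<open>k\<close> and column \<open>l\<close>, both numbered from 1.\<close>

definition diagram :: "nat list \<Rightarrow> (nat \<times> nat) set" where
  "diagram p = {(k, l). 1 \<le> k \<and> k \<le> length p \<and> 1 \<le> l \<and> l \<le> part p k}"

definition young_diagram :: "(nat \<times> nat) set \<Rightarrow> bool" where
  "young_diagram D \<longleftrightarrow> finite D \<and> (\<forall>(k, l)\<in>D. 1 \<le> k \<and> 1 \<le> l) \<and>
     (\<forall>(k, l)\<in>D. \<forall>i j. 1 \<le> i \<and> i \<le> k \<and> 1 \<le> j \<and> j \<le> l \<longrightarrow> (i, j) \<in> D)"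

definition fill_holes :: "(nat \<times> nat) set \<Rightarrow> (nat \<times> nat) set" where
  "fill_holes A = \<Inter>{D. young_diagram D \<and> A \<subseteq> D}"

definition even_box :: "nat \<times> nat \<Rightarrow> bool" where
  "even_box b \<longleftrightarrow> even (fst b + snd b)"

text \<open>Whether a box belongs to the set formed in step (1): the odd boxes are kept in types B and C,
  the even ones in type D.\<close>

definition kept_box :: "cartan_type \<Rightarrow> nat \<times> nat \<Rightarrow> bool" where
  "kept_box X b \<longleftrightarrow> (case X of TypeD \<Rightarrow> even_box b | _ \<Rightarrow> \<not> even_box b)"

definition kept_boxes :: "cartan_type \<Rightarrow> nat list \<Rightarrow> (nat \<times> nat) set" where
  "kept_boxes X p = {b \<in> diagram p. kept_box X b}"

definition skipped_pair :: "cartan_type \<Rightarrow> nat list \<Rightarrow> nat \<Rightarrow> bool" where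
  "skipped_pair X p i \<longleftrightarrow> 1 \<le> i \<and> i + 1 \<le> length p \<and> part p i = part p (i + 1) \<and>
     \<not> kept_box X (i, part p i) \<and> kept_box X (i + 1, part p (i + 1))"

definition labeled_rows :: "cartan_type \<Rightarrow> nat list \<Rightarrow> nat set" where
  "labeled_rows X p = {i. 1 \<le> i \<and> i \<le> length p \<and>
     \<not> skipped_pair X p i \<and> \<not> (\<exists>j. i = j + 1 \<and> skipped_pair X p j)}"

definition row_label :: "cartan_type \<Rightarrow> nat list \<Rightarrow> nat \<Rightarrow> nat" where
  "row_label X p i = card {j \<in> labeled_rows X p. j \<le> i}"

definition extended_rows :: "cartan_type \<Rightarrow> nat list \<Rightarrow> nat set" where
  "extended_rows X p = {i \<in> labeled_rows X p.
     (case X of TypeB \<Rightarrow> odd (row_label X p i) | _ \<Rightarrow> even (row_label X p i))}"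

definition row_end :: "(nat \<times> nat) set \<Rightarrow> nat \<Rightarrow> nat \<times> nat" where
  "row_end A i = (i, Max (insert 0 {l. (i, l) \<in> A}) + 1)"

text \<open>The algorithms add a box in the end if exactly \<open>N\<close> boxes have been obtained.\<close>

definition add_box_if :: "nat \<Rightarrow> (nat \<times> nat) set \<Rightarrow> (nat \<times> nat) set" where
  "add_box_if N D = (if card D = N then insert (card {k. (k, 1) \<in> D} + 1, 1) D else D)"

definition H_algorithm :: "cartan_type \<Rightarrow> nat \<Rightarrow> nat list \<Rightarrow> (nat \<times> nat) set" where
  "H_algorithm X n p =
     (let A = kept_boxes X p;
          D = fill_holes (A \<union> row_end A ` extended_rows X p)
      in case X of
           TypeB \<Rightarrow> add_box_if (2 * n) D
         | TypeC \<Rightarrow> D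
         | TypeD \<Rightarrow> add_box_if (2 * n - 1) D)"


section \<open>Integral weights are real\<close>

lemma coroot_pairing_two:
  assumes "1 \<le> i" "i < j" "j \<le> n" "s \<in> {1, -1}" "t \<in> {1, -1}"
  shows "coroot_pairing n lam (\<lambda>k. s * std_vec i k + t * std_vec j k)
           = of_int s * lam i + of_int t * lam j"
proof -
  let ?a = "\<lambda>k. s * std_vec i k + t * std_vec j k"
  have "(\<Sum>k=1..n. lam k * of_int (?a k)) = (\<Sum>k\<in>{i, j}. lam k * of_int (?a k))"
    using assms by (intro sum.mono_neutral_right) (auto simp: std_vec_def)
  moreover have "(\<Sum>k=1..n. of_int (?a k * ?a k)) = (\<Sum>k\<in>{i, j}. of_int (?a k * ?a k) :: complex)"
    using assms by (intro sum.mono_neutral_right) (auto simp: std_vec_def)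
  ultimately show ?thesis
    using assms by (auto simp: coroot_pairing_def std_vec_def)
qed

lemma coroot_pairing_one:
  assumes "1 \<le> i" "i \<le> n" "c \<noteq> 0"
  shows "coroot_pairing n lam (\<lambda>k. c * std_vec i k) = 2 * lam i / of_int c"
proof -
  let ?a = "\<lambda>k. c * std_vec i k"
  have "(\<Sum>k=1..n. lam k * of_int (?a k)) = (\<Sum>k\<in>{i}. lam k * of_int (?a k))"
    using assms by (intro sum.mono_neutral_right) (auto simp: std_vec_def)
  moreover have "(\<Sum>k=1..n. of_int (?a k * ?a k)) = (\<Sum>k\<in>{i}. of_int (?a k * ?a k) :: complex)"
    using assms by (intro sum.mono_neutral_right) (auto simp: std_vec_def)
  ultimately show ?thesis
    using assms by (auto simp: coroot_pairing_def std_vec_def)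
qed

lemma Ints_imp_real: "z \<in> \<int> \<Longrightarrow> z \<in> \<real>" for z :: complex
  by (auto elim: Ints_cases)

lemma integral_weight_real:
  assumes "simple_rank X n" "integral_weight X n lam" "1 \<le> i" "i \<le> n"
  shows "lam i \<in> \<real>"
proof -
  have "2 * lam i \<in> \<real>"
  proof (cases "X = TypeD")
    case True
    then have n: "3 \<le> n" using assms by (simp add: simple_rank_def)
    have pm: "of_int s * lam a + of_int t * lam b \<in> \<real>"
      if "1 \<le> a" "a < b" "b \<le> n" "s \<in> {1, -1}" "t \<in> {1, -1}" for a b s t
    proof -
      have "(\<lambda>k. s * std_vec a k + t * std_vec b k) \<in> roots X n"
        using that unfolding roots_def by blast
      then show ?thesis
        using assms(2) coroot_pairing_two[OF that, of lam]
        by (metis Ints_imp_real integral_weight_def)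
    qed
    show ?thesis
    proof (cases "i < n")
      case True
      show ?thesis
        using Reals_add[OF pm[of i n 1 1] pm[of i n 1 "-1"]] True assms(3) by simp
    next
      case False
      then have "i = n" using assms by simp
      then show ?thesis
        using Reals_add[OF pm[of 1 n 1 1] pm[of 1 n "-1" 1]] n by simp
    qed
  next
    case False
    then obtain c :: int where c: "c \<noteq> 0" "(\<lambda>k. c * std_vec i k) \<in> roots X n"
    proof (cases X)
      case TypeB
      then have "(\<lambda>k. 1 * std_vec i k) \<in> roots X n"
        using assms(3,4) unfolding roots_def by fastforce
      then show ?thesis using that[of 1] by simp
    next
      case TypeC
      then have "(\<lambda>k. 2 * 1 * std_vec i k) \<in> roots X n"
        using assms(3,4) unfolding roots_def by fastforce
      then show ?thesis using that[of 2] by simp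
    qed auto
    then have "2 * lam i / of_int c \<in> \<real>"
      using assms coroot_pairing_one[of i n c lam]
      by (metis Ints_imp_real integral_weight_def)
    then have "2 * lam i / of_int c * of_int c \<in> \<real>"
      by (intro Reals_mult) auto
    then show ?thesis using c by simp
  qed
  then have "2 * lam i / 2 \<in> \<real>" by (intro Reals_divide) auto
  then show ?thesis by simp
qed

end

theory Submission
  imports Defs
begin

text \<open>
  The shape \<open>p\<close> of \<open>\<lambda>\<^sup>-\<close> is that of a permutation whose matrix is invariant under rotation by 180
  degrees. In Fomin's growth diagrams, inserting one more letter at the right end of a word and
  prolonging it at the left end are governed by a local rule and its transpose, and the two
  commute. Since rotation preserves shapes, adding the first and the last letter to the middle part
  of the word separately adds the same box, and then adding both adds a domino. Hence \<open>p\<close> has as many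
  even as odd boxes.

  Let \<open>K\<close> be an odd (types \<open>B\<close>, \<open>C\<close>) or even (type \<open>D\<close>) bound for the number of rows. The entries of the
  symbol of \<open>p\<close> are the numbers \<open>z\<^sub>k = \<lfloor>(p\<^sub>k + K - k) / 2\<rfloor>\<close>, and the special symbol with these entries
  distributes them to its two rows according to the parity of \<open>k\<close>. The numbers \<open>z\<^sub>k\<close> and \<open>z\<^sub>k\<^sub>+\<^sub>1\<close>
  agree exactly if \<open>k, k + 1\<close> is a skipped pair of rows; so labels have the parity of the row number,
  and both the algorithm and the special symbol turn an unskipped row into one of length \<open>p\<^sub>k\<close>, minus one if
  the last box is removed, plus one for one of the two parities of \<open>k\<close>.
\<close>

section \<open>Growth diagrams\<close>

text \<open>When \<open>m y\<close> and \<open>x m\<close> have the same shape, larger than that of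
  \<open>m\<close>, these three shapes do not determine that of \<open>x m y\<close>: its second new
  box may be the right or the lower neighbour of the first. The relation \<open>square\<close>
  records this choice and is carried from cube to cube together with the rule for the left end; the
  adjacency of the two boxes is what makes a domino. Of the symmetry of \<open>p\<close> only the
  balance is used afterwards: for every bound \<open>K\<close>, exactly \<open>K div 2\<close> of
  the numbers \<open>part p k + (K - k)\<close> are odd. It fixes the lengths of the symbol rows and
  the number of boxes produced. Diagrams and symbols are compared through the set of these numbers.
  For the output of the algorithm it consists of all \<open>2 * z_entry p K k + \<tau> k\<close>
  with \<open>\<tau>\<close> alternating between 0 and 1; a skipped pair contributes an even number
  and its successor whatever \<open>\<tau>\<close> is. The set determines the parts, since the
  numbers strictly decrease with \<open>k\<close>. In type \<open>D\<close> the rows of a symbol may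
  be exchanged, so uniqueness also has to deal with the opposite \<open>\<tau>\<close>.\<close>

definition ferrers :: "(nat \<times> nat) set \<Rightarrow> bool" where
  "ferrers D \<longleftrightarrow> finite D \<and> (\<forall>i j i' j'. (i, j) \<in> D \<longrightarrow> i' \<le> i \<longrightarrow> j' \<le> j \<longrightarrow> (i', j') \<in> D)"

definition addable :: "(nat \<times> nat) set \<Rightarrow> nat \<times> nat \<Rightarrow> bool" where
  "addable D b \<longleftrightarrow> ferrers D \<and> b \<notin> D \<and> ferrers (insert b D)"

definition row_len :: "(nat \<times> nat) set \<Rightarrow> nat \<Rightarrow> nat" where
  "row_len D i = card {j. (i, j) \<in> D}"

lemma ferrersD: "ferrers D \<Longrightarrow> (i, j) \<in> D \<Longrightarrow> i' \<le> i \<Longrightarrow> j' \<le> j \<Longrightarrow> (i', j') \<in> D"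
  unfolding ferrers_def by blast

lemma ferrers_swap [simp]: "ferrers (prod.swap ` D) \<longleftrightarrow> ferrers D"
  unfolding ferrers_def by (auto simp: finite_image_iff)

lemma swap_swap_image [simp]: "prod.swap ` prod.swap ` D = D"
  by force

lemma addable_swap [simp]: "addable (prod.swap ` D) (prod.swap b) \<longleftrightarrow> addable D b"
proof -
  have "insert (prod.swap b) (prod.swap ` D) = prod.swap ` insert b D" by simp
  then show ?thesis
    unfolding addable_def by (metis ferrers_swap inj_image_mem_iff inj_swap)
qed

lemma addable_iff:
  "addable D (i, j) \<longleftrightarrow>
     ferrers D \<and> (\<forall>j'. (i, j') \<in> D \<longleftrightarrow> j' < j) \<and> (\<forall>i'. (i', j) \<in> D \<longleftrightarrow> i' < i)"
proof
  assume a: "addable D (i, j)"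
  then have f: "ferrers D" "(i, j) \<notin> D" "ferrers (insert (i, j) D)" by (auto simp: addable_def)
  have "(i, j') \<in> D \<longleftrightarrow> j' < j" for j'
    using ferrersD[OF f(1), of i j' i j] ferrersD[OF f(3), of i j i j'] f(2) by (cases "j' < j") auto
  moreover have "(i', j) \<in> D \<longleftrightarrow> i' < i" for i'
    using ferrersD[OF f(1), of i' j i j] ferrersD[OF f(3), of i j i' j] f(2) by (cases "i' < i") auto
  ultimately show "ferrers D \<and> (\<forall>j'. (i, j') \<in> D \<longleftrightarrow> j' < j) \<and> (\<forall>i'. (i', j) \<in> D \<longleftrightarrow> i' < i)"
    using f by simp
next
  assume a: "ferrers D \<and> (\<forall>j'. (i, j') \<in> D \<longleftrightarrow> j' < j) \<and> (\<forall>i'. (i', j) \<in> D \<longleftrightarrow> i' < i)"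
  have "(i', j') \<in> insert (i, j) D" if "i' \<le> i" "j' \<le> j" for i' j'
  proof (cases "j' < j")
    case True
    then show ?thesis using a that ferrersD[of D i j' i' j'] by auto
  next
    case False
    then have "j' = j" using that by simp
    then show ?thesis using a that by (cases "i' = i") auto
  qed
  then show "addable D (i, j)"
    using a unfolding addable_def ferrers_def by auto
qed

lemma row_len_eq: "(\<And>j'. (i, j') \<in> D \<longleftrightarrow> j' < j) \<Longrightarrow> row_len D i = j"
  by (simp add: row_len_def)

lemma addable_row_len: "addable D b \<Longrightarrow> b = (fst b, row_len D (fst b))"
  by (cases b) (simp add: addable_iff row_len_eq)

lemma addable_row_unique: "addable D b \<Longrightarrow> addable D c \<Longrightarrow> fst b = fst c \<Longrightarrow> b = c"
  by (metis addable_row_len)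

lemma addable_col_unique: "addable D b \<Longrightarrow> addable D c \<Longrightarrow> snd b = snd c \<Longrightarrow> b = c"
  by (cases b, cases c) (metis addable_iff less_irrefl linorder_neqE_nat snd_conv)

lemma ex_row_end:
  assumes "ferrers D"
  obtains j where "\<And>j'. (i, j') \<in> D \<longleftrightarrow> j' < j"
proof -
  have "finite {j'. (i, j') \<in> D}"
    using assms finite_imageI[of D snd] by (auto simp: ferrers_def image_def intro: rev_finite_subset)
  then obtain j where j: "(i, j) \<notin> D"
    by (metis (mono_tags, lifting) ex_new_if_finite infinite_UNIV_nat mem_Collect_eq)
  let ?j = "LEAST j. (i, j) \<notin> D"
  have "(i, j') \<in> D \<longleftrightarrow> j' < ?j" for j'
    using LeastI[of "\<lambda>j. (i, j) \<notin> D", OF j] not_less_Least[of j' "\<lambda>j. (i, j) \<notin> D"]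
      ferrersD[OF assms, of i j' i ?j] by (meson leI order_refl)
  then show ?thesis using that by blast
qed

lemma ex_addable_first_row:
  assumes "ferrers D"
  obtains d where "addable D d" "fst d = 0"
proof -
  obtain j where j: "\<And>j'. (0, j') \<in> D \<longleftrightarrow> j' < j" using ex_row_end[OF assms, of 0] by blast
  have "addable D (0, j)"
    unfolding addable_iff using assms j ferrersD[OF assms, of _ j 0 j] by auto
  then show ?thesis using that by simp
qed

text \<open>Once row \<open>fst b\<close> has received a box, the row below it is strictly shorter
  and can be extended, so the bumping clause of the local rule always yields a diagram. The bound on
  the column serves, transposed, to locate the box next to the end of the first row.\<close>

lemma ex_addable_next_row:
  assumes "addable D b"
  obtains d where "addable (insert b D) d" "fst d = Suc (fst b)" "snd d \<le> snd b"
proof -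
  have f: "ferrers D" "ferrers (insert b D)" using assms by (auto simp: addable_def)
  obtain i j0 where b: "b = (i, j0)" by fastforce
  obtain j where j: "\<And>j'. (Suc i, j') \<in> D \<longleftrightarrow> j' < j" using ex_row_end[OF f(1), of "Suc i"] by blast
  have d: "(i, j') \<in> D \<longleftrightarrow> j' < j0" "(i', j0) \<in> D \<longleftrightarrow> i' < i" for i' j'
    using assms by (auto simp: b addable_iff)
  have le: "j \<le> j0"
  proof (rule ccontr)
    assume "\<not> j \<le> j0"
    then have "(Suc i, j0) \<in> D" using j by simp
    then show False using d by simp
  qed
  have "addable (insert b D) (Suc i, j)"
    unfolding addable_iff
  proof (intro conjI allI)
    fix i'
    show "(i', j) \<in> insert b D \<longleftrightarrow> i' < Suc i"
    proof
      assume a: "(i', j) \<in> insert b D"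
      show "i' < Suc i"
      proof (rule ccontr)
        assume "\<not> i' < Suc i"
        then have "(Suc i, j) \<in> insert b D" using ferrersD[OF f(2) a, of "Suc i" j] by simp
        then show False using j b by auto
      qed
    next
      assume "i' < Suc i"
      moreover have "(i, j) \<in> insert b D" using le d(1)[of j] b by (cases "j = j0") auto
      ultimately show "(i', j) \<in> insert b D" using ferrersD[OF f(2), of i j i' j] by simp
    qed
  qed (use f j b in auto)
  then show ?thesis using that[of "(Suc i, j)"] le b by simp
qed

lemma addable_insert:
  assumes "addable D b" "addable D c" "b \<noteq> c"
  shows "addable (insert b D) c"
proof -
  have "fst b \<noteq> fst c" "snd b \<noteq> snd c"
    using assms addable_row_unique addable_col_unique by blast+
  then show ?thesis
    using assms unfolding addable_def[of D b] by (cases b, cases c) (auto simp: addable_iff)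
qed

lemma ex_addable_next_col:
  assumes "addable D b"
  obtains d where "addable (insert b D) d" "snd d = Suc (snd b)" "fst d \<le> fst b"
proof -
  obtain d where "addable (insert (prod.swap b) (prod.swap ` D)) d" "fst d = Suc (fst (prod.swap b))"
      "snd d \<le> snd (prod.swap b)"
    using ex_addable_next_row[of "prod.swap ` D" "prod.swap b"] assms by auto
  then show ?thesis using that[of "prod.swap d"] addable_swap[of "insert b D" "prod.swap d"] by simp
qed

text \<open>Fomin's local rule for the fourth corner of a square with corners \<open>\<rho>, \<mu>, \<nu>\<close>, where \<open>pt\<close> says
  that the square contains a point of the matrix; its transpose, \<open>dual_rule\<close>, will turn out to
  govern the prolongation of a word at its left end.\<close>

definition local_rule ::
  "bool \<Rightarrow> (nat \<times> nat) set \<Rightarrow> (nat \<times> nat) set \<Rightarrow> (nat \<times> nat) set \<Rightarrow> (nat \<times> nat) set" where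
  "local_rule pt \<rho> \<mu> \<nu> =
     (if pt then insert (0, row_len \<rho> 0) \<rho>
      else if \<mu> = \<nu> \<and> \<mu> \<noteq> \<rho> then
        (let i = Suc (fst (the_elem (\<mu> - \<rho>))) in insert (i, row_len \<mu> i) \<mu>)
      else \<mu> \<union> \<nu>)"

definition dual_rule ::
  "bool \<Rightarrow> (nat \<times> nat) set \<Rightarrow> (nat \<times> nat) set \<Rightarrow> (nat \<times> nat) set \<Rightarrow> (nat \<times> nat) set" where
  "dual_rule pt \<rho> \<mu> \<nu> =
     prod.swap ` local_rule pt (prod.swap ` \<rho>) (prod.swap ` \<mu>) (prod.swap ` \<nu>)"

lemma local_rule_sym: "local_rule pt \<rho> \<mu> \<nu> = local_rule pt \<rho> \<nu> \<mu>"
  unfolding local_rule_def Let_def by auto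

lemma local_rule_point: "addable \<rho> d \<Longrightarrow> fst d = 0 \<Longrightarrow> local_rule True \<rho> \<mu> \<nu> = insert d \<rho>"
  using addable_row_len[of \<rho> d] by (simp add: local_rule_def)

lemma local_rule_left: "\<rho> \<subseteq> \<nu> \<Longrightarrow> local_rule False \<rho> \<rho> \<nu> = \<nu>"
  by (auto simp: local_rule_def)

lemma local_rule_right: "\<rho> \<subseteq> \<nu> \<Longrightarrow> local_rule False \<rho> \<nu> \<rho> = \<nu>"
  by (auto simp: local_rule_def)

lemma local_rule_neq:
  "b \<notin> \<rho> \<Longrightarrow> c \<notin> \<rho> \<Longrightarrow> b \<noteq> c \<Longrightarrow>
     local_rule False \<rho> (insert b \<rho>) (insert c \<rho>) = insert b (insert c \<rho>)"
  by (auto simp: local_rule_def)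

lemma local_rule_same:
  "b \<notin> \<rho> \<Longrightarrow> local_rule False \<rho> (insert b \<rho>) (insert b \<rho>) =
     insert (Suc (fst b), row_len (insert b \<rho>) (Suc (fst b))) (insert b \<rho>)"
proof -
  assume "b \<notin> \<rho>"
  then have "insert b \<rho> - \<rho> = {b}" "insert b \<rho> \<noteq> \<rho>" by auto
  then show ?thesis by (simp add: local_rule_def Let_def)
qed

lemma local_rule_eq:
  "b \<notin> \<rho> \<Longrightarrow> addable (insert b \<rho>) d \<Longrightarrow> fst d = Suc (fst b) \<Longrightarrow>
     local_rule False \<rho> (insert b \<rho>) (insert b \<rho>) = insert d (insert b \<rho>)"
  using addable_row_len[of "insert b \<rho>" d] by (simp add: local_rule_same)

lemma dual_rule_left: "\<rho> \<subseteq> \<nu> \<Longrightarrow> dual_rule False \<rho> \<rho> \<nu> = \<nu>"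
  using local_rule_left[of "prod.swap ` \<rho>" "prod.swap ` \<nu>"] by (simp add: dual_rule_def image_mono)

lemma dual_rule_right: "\<rho> \<subseteq> \<nu> \<Longrightarrow> dual_rule False \<rho> \<nu> \<rho> = \<nu>"
  using local_rule_right[of "prod.swap ` \<rho>" "prod.swap ` \<nu>"] by (simp add: dual_rule_def image_mono)

lemma swap_mem_image [simp]: "prod.swap b \<in> prod.swap ` D \<longleftrightarrow> b \<in> D"
  by (simp add: inj_image_mem_iff)

lemma dual_rule_neq:
  assumes "b \<notin> \<rho>" "c \<notin> \<rho>" "b \<noteq> c"
  shows "dual_rule False \<rho> (insert b \<rho>) (insert c \<rho>) = insert b (insert c \<rho>)"
proof -
  have "prod.swap b \<noteq> prod.swap c" using assms(3) by (cases b, cases c) auto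
  then have "local_rule False (prod.swap ` \<rho>) (insert (prod.swap b) (prod.swap ` \<rho>))
      (insert (prod.swap c) (prod.swap ` \<rho>)) =
      insert (prod.swap b) (insert (prod.swap c) (prod.swap ` \<rho>))"
    using assms by (intro local_rule_neq) auto
  then show ?thesis by (simp only: dual_rule_def image_insert swap_swap swap_swap_image)
qed

lemma dual_rule_eq:
  assumes "b \<notin> \<rho>" "addable (insert b \<rho>) d" "snd d = Suc (snd b)"
  shows "dual_rule False \<rho> (insert b \<rho>) (insert b \<rho>) = insert d (insert b \<rho>)"
proof -
  have "addable (insert (prod.swap b) (prod.swap ` \<rho>)) (prod.swap d)"
    using assms(2) addable_swap[of "insert b \<rho>" d] unfolding image_insert by simp
  then have "local_rule False (prod.swap ` \<rho>) (insert (prod.swap b) (prod.swap ` \<rho>))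
      (insert (prod.swap b) (prod.swap ` \<rho>)) =
      insert (prod.swap d) (insert (prod.swap b) (prod.swap ` \<rho>))"
    using assms by (intro local_rule_eq) auto
  then show ?thesis by (simp only: dual_rule_def image_insert swap_swap swap_swap_image)
qed

text \<open>An edge of a growth diagram. Whether it carries a box is a separate Boolean because the
  matrix alone decides this, see \<open>grow_steps\<close>.\<close>

definition step :: "bool \<Rightarrow> (nat \<times> nat) set \<Rightarrow> (nat \<times> nat) set \<Rightarrow> bool" where
  "step e \<rho> \<mu> \<longleftrightarrow> ferrers \<rho> \<and> (if e then \<exists>b. addable \<rho> b \<and> \<mu> = insert b \<rho> else \<mu> = \<rho>)"

lemma stepE:
  assumes "step e \<rho> \<mu>"
  obtains "\<not> e" "\<mu> = \<rho>" "ferrers \<rho>" | b where "e" "addable \<rho> b" "\<mu> = insert b \<rho>" "ferrers \<rho>" "ferrers \<mu>"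
  using assms by (auto simp: step_def addable_def split: if_splits)

lemma stepI: "e \<Longrightarrow> addable \<rho> b \<Longrightarrow> step e \<rho> (insert b \<rho>)"
  unfolding step_def addable_def by metis

lemma step_subset: "step e \<rho> \<mu> \<Longrightarrow> \<rho> \<subseteq> \<mu>"
  by (auto elim: stepE)

lemma local_rule_step:
  assumes "step e \<rho> \<mu>" "step f \<rho> \<nu>" "pt \<Longrightarrow> \<not> e \<and> \<not> f"
  shows "step (f \<or> pt) \<mu> (local_rule pt \<rho> \<mu> \<nu>)"
proof (cases pt)
  case True
  then have "\<mu> = \<rho>" "ferrers \<rho>" using assms by (auto elim: stepE)
  moreover obtain d where "addable \<rho> d" "fst d = 0" using ex_addable_first_row \<open>ferrers \<rho>\<close> by blast
  ultimately show ?thesis using True unfolding step_def by (metis local_rule_point)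
next
  case False
  show ?thesis using assms(1)
  proof (cases rule: stepE)
    case 1
    then show ?thesis using False assms(2) by (simp add: local_rule_left step_subset)
  next
    case (2 b)
    note b = 2
    show ?thesis using assms(2)
    proof (cases rule: stepE)
      case 1
      then show ?thesis using False b by (simp add: local_rule_right step_def subset_insertI)
    next
      case (2 c)
      show ?thesis
      proof (cases "b = c")
        case True
        obtain d where d: "addable (insert b \<rho>) d" "fst d = Suc (fst b)"
          using ex_addable_next_row b(2) by blast
        then have "local_rule pt \<rho> \<mu> \<nu> = insert d \<mu>"
          using 2 b True False local_rule_eq[of b \<rho> d] by (simp add: addable_def)
        then show ?thesis using 2 b d(1) stepI[of "f \<or> pt" \<mu> d] by simp
      next
        case n: False
        have "addable (insert b \<rho>) c" using addable_insert[of \<rho> b c] b(2) 2(2) n by simp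
        moreover have "local_rule False \<rho> \<mu> \<nu> = insert c \<mu>"
          using b 2 n by (auto simp: local_rule_neq addable_def)
        ultimately show ?thesis using 2 b False stepI[of "f \<or> pt" \<mu> c] by simp
      qed
    qed
  qed
qed

section \<open>Growth diagrams of partial permutation matrices\<close>

text \<open>The first index counts positions of a word and the second one values: for the matrix of
  a word, \<open>grow A i j\<close> is the shape of the first \<open>i\<close> letters restricted to
  the values below \<open>j\<close>, see \<open>insertion_tableau_grow\<close>.\<close>

fun grow :: "(nat \<Rightarrow> nat \<Rightarrow> bool) \<Rightarrow> nat \<Rightarrow> nat \<Rightarrow> (nat \<times> nat) set" where
  "grow A 0 j = {}"
| "grow A (Suc i) 0 = {}"
| "grow A (Suc i) (Suc j) = local_rule (A i j) (grow A i j) (grow A (Suc i) j) (grow A i (Suc j))"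

lemma grow_0_right [simp]: "grow A i 0 = {}"
  by (cases i) auto

definition partial_inj :: "(nat \<Rightarrow> nat \<Rightarrow> bool) \<Rightarrow> bool" where
  "partial_inj A \<longleftrightarrow> (\<forall>i j j'. A i j \<longrightarrow> A i j' \<longrightarrow> j = j') \<and> (\<forall>i i' j. A i j \<longrightarrow> A i' j \<longrightarrow> i = i')"

lemma partial_injD:
  "partial_inj A \<Longrightarrow> A i j \<Longrightarrow> A i j' \<Longrightarrow> j = j'"
  "partial_inj A \<Longrightarrow> A i j \<Longrightarrow> A i' j \<Longrightarrow> i = i'"
  unfolding partial_inj_def by blast+

lemma grow_cong:
  "(\<And>i' j'. i' < i \<Longrightarrow> j' < j \<Longrightarrow> A i' j' = B i' j') \<Longrightarrow> grow A i j = grow B i j"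
proof (induction A i j rule: grow.induct)
  case (3 A i j)
  have "grow A i j = grow B i j" "grow A (Suc i) j = grow B (Suc i) j"
       "grow A i (Suc j) = grow B i (Suc j)"
    by (rule 3, simp add: "3.prems")+
  then show ?case using "3.prems" by simp
qed auto

lemma grow_flip: "grow (\<lambda>i j. A j i) i j = grow A j i"
  by (induction A j i rule: grow.induct) (simp_all add: local_rule_sym)

lemma ferrers_empty [simp]: "ferrers {}"
  by (simp add: ferrers_def)

text \<open>Each edge arises from the opposite edge of its square, so both directions need a common
  induction. Injectivity of the matrix gives the premise of \<open>local_rule_step\<close> that a
  square with a point has no box on its two initial edges.\<close>

lemma grow_steps:
  assumes "partial_inj A"
  shows "step (\<exists>i'<i. A i' j) (grow A i j) (grow A i (Suc j))"
    and "step (\<exists>j'<j. A i j') (grow A i j) (grow A (Suc i) j)"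
proof -
  have main: "step (\<exists>j'<j. A i j') (grow A i j) (grow A (Suc i) j)"
    and sq: "step (\<exists>i'<Suc i. A i' j) (grow A (Suc i) j) (grow A (Suc i) (Suc j))"
    if IH: "\<And>j. step (\<exists>i'<i. A i' j) (grow A i j) (grow A i (Suc j))" for i j
  proof -
    have ex: "(\<exists>i'<Suc i. A i' j) = ((\<exists>i'<i. A i' j) \<or> A i j)"
      "(\<exists>j'<Suc j. A i j') = ((\<exists>j'<j. A i j') \<or> A i j)" for i j
      by (auto simp: less_Suc_eq)
    have pt: "A i j \<Longrightarrow> \<not> (\<exists>j'<j. A i j') \<and> \<not> (\<exists>i'<i. A i' j)" for j
      using partial_injD[OF assms] by blast
    have 1: "step (\<exists>j'<j. A i j') (grow A i j) (grow A (Suc i) j)" for j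
    proof (induction j)
      case 0
      then show ?case by (simp add: step_def)
    next
      case (Suc j)
      show ?case
        unfolding ex grow.simps local_rule_sym[of _ _ "grow A (Suc i) j"]
        by (rule local_rule_step[OF IH Suc]) (use pt in blast)
    qed
    show "step (\<exists>j'<j. A i j') (grow A i j) (grow A (Suc i) j)" by (rule 1)
    show "step (\<exists>i'<Suc i. A i' j) (grow A (Suc i) j) (grow A (Suc i) (Suc j))"
      unfolding ex grow.simps by (rule local_rule_step[OF 1 IH]) (use pt in blast)
  qed
  have v: "step (\<exists>i'<i. A i' j) (grow A i j) (grow A i (Suc j))" for i j
  proof (induction i arbitrary: j)
    case 0
    then show ?case by (simp add: step_def)
  next
    case (Suc i)
    then show ?case by (rule sq)
  qed
  show "step (\<exists>i'<i. A i' j) (grow A i j) (grow A i (Suc j))" by (rule v)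
  show "step (\<exists>j'<j. A i j') (grow A i j) (grow A (Suc i) j)" by (rule main) (rule v)
qed

lemma ferrers_grow: "partial_inj A \<Longrightarrow> ferrers (grow A i j)"
  using grow_steps(1)[of A i j] by (simp add: step_def)

section \<open>Commutation of the two rules on a cube\<close>

text \<open>The possible shapes of a subword \<open>m\<close> and of \<open>m y\<close>, \<open>x m\<close>, \<open>x m y\<close>, in this order.\<close>

definition square :: "(nat \<times> nat) set \<Rightarrow> (nat \<times> nat) set \<Rightarrow> (nat \<times> nat) set \<Rightarrow> (nat \<times> nat) set \<Rightarrow> bool" where
  "square \<rho> \<mu> \<nu> \<kappa> \<longleftrightarrow> ferrers \<rho> \<and>
     (\<mu> = \<rho> \<and> \<nu> = \<rho> \<and> \<kappa> = \<rho> \<or>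
      (\<exists>c. addable \<rho> c \<and> \<mu> = \<rho> \<and> \<nu> = insert c \<rho> \<and> \<kappa> = insert c \<rho>) \<or>
      (\<exists>r. addable \<rho> r \<and> \<mu> = insert r \<rho> \<and> \<nu> = \<rho> \<and> \<kappa> = insert r \<rho>) \<or>
      (\<exists>r c. addable \<rho> r \<and> addable \<rho> c \<and> r \<noteq> c \<and> \<mu> = insert r \<rho> \<and> \<nu> = insert c \<rho> \<and>
         \<kappa> = insert r (insert c \<rho>)) \<or>
      (\<exists>r d. addable \<rho> r \<and> addable (insert r \<rho>) d \<and> \<mu> = insert r \<rho> \<and> \<nu> = insert r \<rho> \<and>
         \<kappa> = insert d (insert r \<rho>) \<and>
         (d = (fst r, Suc (snd r)) \<or> d = (Suc (fst r), snd r))))"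

lemma squareE [consumes 1, case_names flat col row both same]:
  assumes "square \<rho> \<mu> \<nu> \<kappa>"
  obtains "ferrers \<rho>" "\<mu> = \<rho>" "\<nu> = \<rho>" "\<kappa> = \<rho>"
  | c where "ferrers \<rho>" "addable \<rho> c" "\<mu> = \<rho>" "\<nu> = insert c \<rho>" "\<kappa> = insert c \<rho>"
  | r where "ferrers \<rho>" "addable \<rho> r" "\<mu> = insert r \<rho>" "\<nu> = \<rho>" "\<kappa> = insert r \<rho>"
  | r c where "ferrers \<rho>" "addable \<rho> r" "addable \<rho> c" "r \<noteq> c" "\<mu> = insert r \<rho>"
      "\<nu> = insert c \<rho>" "\<kappa> = insert r (insert c \<rho>)"
  | r d where "ferrers \<rho>" "addable \<rho> r" "addable (insert r \<rho>) d" "\<mu> = insert r \<rho>"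
      "\<nu> = insert r \<rho>" "\<kappa> = insert d (insert r \<rho>)"
      "d = (fst r, Suc (snd r)) \<or> d = (Suc (fst r), snd r)"
  using assms unfolding square_def by blast

lemma squareI:
  assumes "ferrers \<rho>"
  shows "square \<rho> \<rho> \<rho> \<rho>"
    and "addable \<rho> c \<Longrightarrow> square \<rho> \<rho> (insert c \<rho>) (insert c \<rho>)"
    and "addable \<rho> r \<Longrightarrow> square \<rho> (insert r \<rho>) \<rho> (insert r \<rho>)"
    and "addable \<rho> r \<Longrightarrow> addable \<rho> c \<Longrightarrow> r \<noteq> c \<Longrightarrow>
           square \<rho> (insert r \<rho>) (insert c \<rho>) (insert r (insert c \<rho>))"
    and "addable \<rho> r \<Longrightarrow> addable (insert r \<rho>) d \<Longrightarrow>
           d = (fst r, Suc (snd r)) \<or> d = (Suc (fst r), snd r) \<Longrightarrow>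
           square \<rho> (insert r \<rho>) (insert r \<rho>) (insert d (insert r \<rho>))"
  using assms unfolding square_def by blast+

lemma addable_ferrers: "addable D b \<Longrightarrow> ferrers D" "addable D b \<Longrightarrow> b \<notin> D"
    "addable D b \<Longrightarrow> ferrers (insert b D)"
  by (auto simp: addable_def)

lemma square_swap:
  assumes "square \<rho> \<mu> \<nu> \<kappa>"
  shows "square (prod.swap ` \<rho>) (prod.swap ` \<nu>) (prod.swap ` \<mu>) (prod.swap ` \<kappa>)"
  using assms
proof (cases rule: squareE)
  case flat
  then show ?thesis by (simp add: squareI)
next
  case (col c)
  then show ?thesis using squareI(3)[of "prod.swap ` \<rho>" "prod.swap c"] by simp
next
  case (row r)
  then show ?thesis using squareI(2)[of "prod.swap ` \<rho>" "prod.swap r"] by simp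
next
  case (both r c)
  have "prod.swap c \<noteq> prod.swap r" using both(4) by (cases r, cases c) auto
  then show ?thesis using both squareI(4)[of "prod.swap ` \<rho>" "prod.swap c" "prod.swap r"]
    by (simp add: insert_commute)
next
  case (same r d)
  then show ?thesis
    using squareI(5)[of "prod.swap ` \<rho>" "prod.swap r" "prod.swap d"] addable_swap[of "insert r \<rho>" d]
    by (cases d) auto
qed

lemma dual_rule_swap:
  "prod.swap ` dual_rule q \<rho> \<mu> \<nu> = local_rule q (prod.swap ` \<rho>) (prod.swap ` \<mu>) (prod.swap ` \<nu>)"
  "prod.swap ` local_rule q \<rho> \<mu> \<nu> = dual_rule q (prod.swap ` \<rho>) (prod.swap ` \<mu>) (prod.swap ` \<nu>)"
  by (simp_all add: dual_rule_def)

lemma dual_rule_sym: "dual_rule q \<rho> \<mu> \<nu> = dual_rule q \<rho> \<nu> \<mu>"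
  unfolding dual_rule_def by (subst local_rule_sym) simp

text \<open>The point belongs to the appended letter, so \<open>\<mu>\<close> and the shape for the
  larger value bound both still equal \<open>\<rho>\<close>. The only interaction occurs when the
  prepended letter has already filled the end of the first row; then the second box goes to its
  right.\<close>

lemma cube_point:
  assumes "square \<rho> \<rho> \<nu> \<nu>"
  shows "local_rule True \<nu> \<nu> \<nu> = dual_rule False \<rho> (local_rule True \<rho> \<rho> \<rho>) \<nu>"
    and "square \<rho> (local_rule True \<rho> \<rho> \<rho>) \<nu> (local_rule True \<nu> \<nu> \<nu>)"
proof -
  have f: "ferrers \<rho>" using assms by (simp add: square_def)
  obtain d where d: "addable \<rho> d" "fst d = 0" using ex_addable_first_row[OF f] .
  have \<mu>': "local_rule True \<rho> \<rho> \<rho> = insert d \<rho>" using d by (rule local_rule_point)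
  note [simp] = addable_ferrers(2)[OF d(1)]
  have "local_rule True \<nu> \<nu> \<nu> = dual_rule False \<rho> (insert d \<rho>) \<nu> \<and>
        square \<rho> (insert d \<rho>) \<nu> (local_rule True \<nu> \<nu> \<nu>)"
  proof (cases "\<nu> = \<rho>")
    case True
    then show ?thesis using d f
      by (simp add: local_rule_point dual_rule_right subset_insertI squareI)
  next
    case False
    then obtain c where c: "addable \<rho> c" "\<nu> = insert c \<rho>"
      using assms unfolding square_def by blast
    note [simp] = addable_ferrers(2)[OF c(1)]
    show ?thesis
    proof (cases "c = d")
      case True
      obtain d2 where d2: "addable (insert d \<rho>) d2" "snd d2 = Suc (snd d)" "fst d2 \<le> fst d"
        using ex_addable_next_col[OF d(1)] .
      \<comment> \<open>A box in the next column and in no later row than \<open>d\<close>, which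
        lies in row 0, can only be the right neighbour of \<open>d\<close>.\<close>
      then have "d2 = (fst d, Suc (snd d))" using d(2) by (cases d2) auto
      moreover have "local_rule True \<nu> \<nu> \<nu> = insert d2 (insert d \<rho>)"
        using c(2) True d2 d(2) by (simp add: local_rule_point)
      moreover have "dual_rule False \<rho> (insert d \<rho>) \<nu> = insert d2 (insert d \<rho>)"
        using c(2) True d2 by (simp add: dual_rule_eq)
      ultimately show ?thesis using squareI(5)[OF f d(1) d2(1)] c(2) True by simp
    next
      case False
      then have "addable \<nu> d" using addable_insert[OF c(1) d(1)] c(2) by simp
      then have "local_rule True \<nu> \<nu> \<nu> = insert d \<nu>" using d(2) by (rule local_rule_point)
      moreover have "dual_rule False \<rho> (insert d \<rho>) \<nu> = insert d \<nu>"
        using False c(2) by (simp add: dual_rule_neq)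
      ultimately show ?thesis using squareI(4)[OF f d(1) c(1)] False c(2) by simp
    qed
  qed
  then show "local_rule True \<nu> \<nu> \<nu> = dual_rule False \<rho> (local_rule True \<rho> \<rho> \<rho>) \<nu>"
    "square \<rho> (local_rule True \<rho> \<rho> \<rho>) \<nu> (local_rule True \<nu> \<nu> \<nu>)"
    unfolding \<mu>' by auto
qed

text \<open>The axes of the cube are: append a letter (\<open>\<rho>\<close> to
  \<open>\<mu>\<close>), prepend a letter (\<open>\<rho>\<close> to \<open>\<nu>\<close>), admit one
  more value (\<open>\<rho>\<close> to \<open>\<rho>'\<close>). The last vertex can be computed on
  two faces, and the results must agree. The second conjunct supplies the hypothesis of the adjacent
  cube.\<close>

definition cube_closes where
  "cube_closes \<rho> \<mu> \<nu> \<kappa> \<rho>' \<longleftrightarrow>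
     local_rule False \<nu> \<kappa> (dual_rule False \<rho> \<rho>' \<nu>) = dual_rule False \<mu> (local_rule False \<rho> \<mu> \<rho>') \<kappa> \<and>
     square \<rho>' (local_rule False \<rho> \<mu> \<rho>') (dual_rule False \<rho> \<rho>' \<nu>)
       (local_rule False \<nu> \<kappa> (dual_rule False \<rho> \<rho>' \<nu>))"

text \<open>Transposition exchanges the two rules and with them \<open>\<mu>\<close> and
  \<open>\<nu>\<close>. This halves the case analysis.\<close>

lemma cube_closes_swap:
  assumes "cube_closes (prod.swap ` \<rho>) (prod.swap ` \<nu>) (prod.swap ` \<mu>) (prod.swap ` \<kappa>) (prod.swap ` \<rho>')"
  shows "cube_closes \<rho> \<mu> \<nu> \<kappa> \<rho>'"
proof -
  have "prod.swap ` dual_rule False \<mu> (local_rule False \<rho> \<mu> \<rho>') \<kappa> =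
        prod.swap ` local_rule False \<nu> \<kappa> (dual_rule False \<rho> \<rho>' \<nu>)"
    using assms unfolding cube_closes_def dual_rule_swap
    by (metis dual_rule_sym local_rule_sym)
  then have eq: "dual_rule False \<mu> (local_rule False \<rho> \<mu> \<rho>') \<kappa> =
        local_rule False \<nu> \<kappa> (dual_rule False \<rho> \<rho>' \<nu>)"
    by (metis swap_swap_image)
  have "square (prod.swap ` \<rho>') (prod.swap ` dual_rule False \<rho> \<rho>' \<nu>) (prod.swap ` local_rule False \<rho> \<mu> \<rho>')
      (prod.swap ` local_rule False \<nu> \<kappa> (dual_rule False \<rho> \<rho>' \<nu>))"
    using assms eq unfolding cube_closes_def dual_rule_swap
    by (metis dual_rule_sym local_rule_sym)
  then show ?thesis
    using square_swap[of "prod.swap ` \<rho>'"] eq unfolding cube_closes_def by (metis swap_swap_image)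
qed

lemma addable_same_row:
  assumes "addable D c" "addable (insert c D) d" "fst d = fst c"
  shows "d = (fst c, Suc (snd c))"
proof -
  have "(fst c, j) \<in> insert c D \<longleftrightarrow> j < snd d" "(fst c, j) \<in> D \<longleftrightarrow> j < snd c" for j
    using assms by (cases c, cases d, simp add: addable_iff)+
  then have "j < snd d \<longleftrightarrow> j < snd c \<or> j = snd c" for j
    by (metis insert_iff prod.collapse snd_conv)
  then have "snd d = Suc (snd c)"
    by (metis less_Suc_eq linorder_neqE_nat less_irrefl)
  then show ?thesis using assms(3) by (cases d) auto
qed

text \<open>The new value adds the box \<open>r\<close> of the appended letter, which is then bumped
  into the next row. The delicate case is that it would land on the box \<open>c\<close> of the
  prepended letter. With \<open>c\<close> occupied, the local rule continues the row of
  \<open>c\<close> and the dual rule takes the column after \<open>c\<close>; both choose the right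
  neighbour of \<open>c\<close>.\<close>

lemma cube_both:
  assumes r: "addable \<rho> r" and c: "addable \<rho> c" and ne: "r \<noteq> c"
  shows "cube_closes \<rho> (insert r \<rho>) (insert c \<rho>) (insert r (insert c \<rho>)) (insert r \<rho>)"
proof -
  let ?\<mu> = "insert r \<rho>" and ?\<kappa> = "insert r (insert c \<rho>)"
  note [simp] = addable_ferrers(2)[OF r] addable_ferrers(2)[OF c]
  have \<mu>c: "addable ?\<mu> c" and \<nu>r: "addable (insert c \<rho>) r"
    using addable_insert[OF r c] addable_insert[OF c r] ne by auto
  have \<kappa>: "?\<kappa> = insert c ?\<mu>" by blast
  obtain r' where r': "addable ?\<mu> r'" "fst r' = Suc (fst r)" using ex_addable_next_row[OF r] .
  note [simp] = addable_ferrers(2)[OF r'(1)]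
  obtain d where d: "addable ?\<kappa> d" "fst d = Suc (fst r)" using ex_addable_next_row[OF \<nu>r] .
  have \<mu>': "local_rule False \<rho> ?\<mu> ?\<mu> = insert r' ?\<mu>" using r' by (simp add: local_rule_eq)
  have \<nu>': "dual_rule False \<rho> ?\<mu> (insert c \<rho>) = ?\<kappa>" using ne by (simp add: dual_rule_neq)
  have \<kappa>': "local_rule False (insert c \<rho>) ?\<kappa> ?\<kappa> = insert d ?\<kappa>"
    using d addable_ferrers(2)[OF \<nu>r] by (intro local_rule_eq) auto
  have "insert d ?\<kappa> = dual_rule False ?\<mu> (insert r' ?\<mu>) ?\<kappa> \<and> square ?\<mu> (insert r' ?\<mu>) ?\<kappa> (insert d ?\<kappa>)"
  proof (cases "c = r'")
    case True
    obtain e where e: "addable (insert c ?\<mu>) e" "snd e = Suc (snd c)" using ex_addable_next_col[OF \<mu>c] .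
    have d2: "d = (fst c, Suc (snd c))" using addable_same_row[OF \<mu>c, of d] d r'(2) \<kappa> True by simp
    then have "d = e" using addable_col_unique[OF d(1), of e] e \<kappa> by simp
    moreover have "dual_rule False ?\<mu> (insert c ?\<mu>) (insert c ?\<mu>) = insert e (insert c ?\<mu>)"
      using e addable_ferrers(2)[OF \<mu>c] by (intro dual_rule_eq) auto
    ultimately show ?thesis
      using True squareI(5)[OF addable_ferrers(3)[OF r] \<mu>c e(1)] d2 unfolding \<kappa> by simp
  next
    case False
    have "addable ?\<kappa> r'" using addable_insert[OF \<mu>c r'(1) False] \<kappa> by simp
    then have "d = r'" using addable_row_unique[OF d(1)] d r' by simp
    moreover have "dual_rule False ?\<mu> (insert r' ?\<mu>) (insert c ?\<mu>) = insert r' (insert c ?\<mu>)"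
      using False addable_ferrers(2)[OF \<mu>c] addable_ferrers(2)[OF r'(1)] by (intro dual_rule_neq) auto
    ultimately show ?thesis
      using squareI(4)[OF addable_ferrers(3)[OF r] r'(1) \<mu>c] False unfolding \<kappa> by auto
  qed
  then show ?thesis unfolding cube_closes_def \<mu>' \<nu>' \<kappa>' .
qed

text \<open>If the new value adds \<open>r\<close> too, the local rule bumps it downwards and the
  dual rule bumps it to the right, onto \<open>d\<close>, so the two resulting boxes differ.
  Otherwise \<open>b\<close> lies outside the row shared by \<open>r\<close> and \<open>d\<close>
  and nothing interacts. The case of \<open>d\<close> below \<open>r\<close> follows by
  transposition.\<close>

lemma cube_same:
  assumes r: "addable \<rho> r" and d: "addable (insert r \<rho>) d" "d = (fst r, Suc (snd r))" and b: "addable \<rho> b"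
  shows "cube_closes \<rho> (insert r \<rho>) (insert r \<rho>) (insert d (insert r \<rho>)) (insert b \<rho>)"
proof (cases "b = r")
  case True
  let ?\<mu> = "insert r \<rho>"
  note [simp] = addable_ferrers(2)[OF r] addable_ferrers(2)[OF d(1)]
  obtain r' where r': "addable ?\<mu> r'" "fst r' = Suc (fst r)" using ex_addable_next_row[OF r] .
  note [simp] = addable_ferrers(2)[OF r'(1)]
  have ne: "r' \<noteq> d" using r' d by auto
  have \<kappa>r': "addable (insert d ?\<mu>) r'" using addable_insert[OF d(1) r'(1)] ne by simp
  have "local_rule False \<rho> ?\<mu> ?\<mu> = insert r' ?\<mu>" using r' by (intro local_rule_eq) auto
  moreover have "dual_rule False \<rho> ?\<mu> ?\<mu> = insert d ?\<mu>" using d by (intro dual_rule_eq) auto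
  moreover have "local_rule False ?\<mu> (insert d ?\<mu>) (insert d ?\<mu>) = insert r' (insert d ?\<mu>)"
    using \<kappa>r' r' d(2) addable_ferrers(2)[OF d(1)] by (intro local_rule_eq) auto
  moreover have "dual_rule False ?\<mu> (insert r' ?\<mu>) (insert d ?\<mu>) = insert r' (insert d ?\<mu>)"
    using ne addable_ferrers(2)[OF d(1)] addable_ferrers(2)[OF r'(1)] by (intro dual_rule_neq) auto
  ultimately show ?thesis
    using squareI(4)[OF addable_ferrers(3)[OF r] r'(1) d(1) ne] True unfolding cube_closes_def by simp
next
  case False
  let ?\<mu> = "insert r \<rho>"
  note [simp] = addable_ferrers(2)[OF r] addable_ferrers(2)[OF b]
  have "b \<noteq> d"
    using addable_row_unique[OF b r] False d(2) by auto
  have \<mu>b: "addable ?\<mu> b" using addable_insert[OF r b] False by simp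
  have "local_rule False \<rho> ?\<mu> (insert b \<rho>) = insert b ?\<mu>" using False
    by (subst local_rule_neq) auto
  moreover have "dual_rule False \<rho> (insert b \<rho>) ?\<mu> = insert b ?\<mu>" using False
    by (intro dual_rule_neq) auto
  moreover have "local_rule False ?\<mu> (insert d ?\<mu>) (insert b ?\<mu>) = insert d (insert b ?\<mu>)"
    using \<open>b \<noteq> d\<close> addable_ferrers(2)[OF \<mu>b] addable_ferrers(2)[OF d(1)] by (intro local_rule_neq) auto
  moreover have "dual_rule False ?\<mu> (insert b ?\<mu>) (insert d ?\<mu>) = insert d (insert b ?\<mu>)"
    using \<open>b \<noteq> d\<close> addable_ferrers(2)[OF \<mu>b] addable_ferrers(2)[OF d(1)] by (subst dual_rule_neq) auto
  moreover have "square (insert b \<rho>) (insert b ?\<mu>) (insert b ?\<mu>) (insert d (insert b ?\<mu>))"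
    using squareI(5)[OF addable_ferrers(3)[OF b], of r d] addable_insert[OF b r False]
      addable_insert[OF \<mu>b d(1) \<open>b \<noteq> d\<close>] d(2) by (simp add: insert_commute)
  ultimately show ?thesis unfolding cube_closes_def by simp
qed

lemma cube_box:
  assumes sq: "square \<rho> \<mu> \<nu> \<kappa>" and b: "addable \<rho> b"
  shows "cube_closes \<rho> \<mu> \<nu> \<kappa> (insert b \<rho>)"
proof -
  have f': "ferrers (insert b \<rho>)" and bn [simp]: "b \<notin> \<rho>" using addable_ferrers[OF b] by auto
  have row_case: "cube_closes \<rho> (insert r \<rho>) \<rho> (insert r \<rho>) (insert b \<rho>)"
    if r: "addable \<rho> r" and b: "addable \<rho> b" for \<rho> r b
  proof -
    note [simp] = addable_ferrers(2)[OF r] addable_ferrers(2)[OF b]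
    have \<nu>': "dual_rule False \<rho> (insert b \<rho>) \<rho> = insert b \<rho>" by (simp add: dual_rule_right subset_insertI)
    obtain e where e: "addable (insert b \<rho>) e" "local_rule False \<rho> (insert r \<rho>) (insert b \<rho>) = insert e (insert b \<rho>)"
    proof (cases "b = r")
      case True
      obtain e where "addable (insert b \<rho>) e" "fst e = Suc (fst b)" using ex_addable_next_row[OF b] .
      then show ?thesis using True that[of e] by (simp add: local_rule_eq)
    next
      case False
      then show ?thesis using addable_insert[OF b r] that[of r] by (simp add: local_rule_neq)
    qed
    have "insert r \<rho> \<subseteq> insert e (insert b \<rho>)"
      using step_subset[OF local_rule_step[OF stepI[OF TrueI r] stepI[OF TrueI b], of False]] e(2) by simp
    then show ?thesis
      using squareI(3)[OF addable_ferrers(3)[OF b] e(1)]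
      unfolding cube_closes_def \<nu>' e(2) by (simp add: dual_rule_right)
  qed
  from sq show ?thesis
  proof (cases rule: squareE)
    case flat
    then show ?thesis unfolding cube_closes_def
      by (simp add: local_rule_left dual_rule_right squareI f' subset_insertI)
  next
    case (row r)
    then show ?thesis using row_case b by blast
  next
    case (col c)
    then show ?thesis
      using row_case[of "prod.swap ` \<rho>" "prod.swap c" "prod.swap b"] b
      by - (rule cube_closes_swap, simp)
  next
    case (both r c)
    note [simp] = addable_ferrers(2)[OF both(2)] addable_ferrers(2)[OF both(3)]
    consider "b \<noteq> r" "b \<noteq> c" | "b = r" | "b = c" by blast
    then show ?thesis
    proof cases
      case 1
      have "local_rule False \<rho> \<mu> (insert b \<rho>) = insert b (insert r \<rho>)" using 1 both
        by (simp add: local_rule_neq insert_commute)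
      moreover have "dual_rule False \<rho> (insert b \<rho>) \<nu> = insert b (insert c \<rho>)" using 1 both
        by (simp add: dual_rule_neq)
      moreover have "local_rule False \<nu> \<kappa> (insert b (insert c \<rho>)) = insert b (insert r (insert c \<rho>))"
        unfolding both(6,7) using 1 both(4) by (subst local_rule_neq) auto
      moreover have "dual_rule False \<mu> (insert b (insert r \<rho>)) \<kappa> = insert b (insert c (insert r \<rho>))"
        unfolding both(5,7) insert_commute[of r c \<rho>] using 1 both(4) by (intro dual_rule_neq) auto
      moreover have "square (insert b \<rho>) (insert r (insert b \<rho>)) (insert c (insert b \<rho>))
          (insert r (insert c (insert b \<rho>)))"
        using 1 both f' addable_insert[OF b both(2)] addable_insert[OF b both(3)]
        by (intro squareI) auto
      ultimately show ?thesis by (simp add: cube_closes_def insert_commute)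
    next
      case 2
      then show ?thesis using both cube_both by blast
    next
      case 3
      have "prod.swap c \<noteq> prod.swap r" using both(4) by (cases r, cases c) auto
      then show ?thesis
        using both 3 cube_both[of "prod.swap ` \<rho>" "prod.swap c" "prod.swap r"]
        by - (rule cube_closes_swap, simp add: insert_commute)
    qed
  next
    case (same r d)
    show ?thesis
    proof (cases "d = (fst r, Suc (snd r))")
      case True
      then show ?thesis using same b cube_same by simp
    next
      case False
      then have "prod.swap d = (fst (prod.swap r), Suc (snd (prod.swap r)))" using same(7) by simp
      then show ?thesis
        using same b cube_same[of "prod.swap ` \<rho>" "prod.swap r" "prod.swap d" "prod.swap b"]
          addable_swap[of "insert r \<rho>" d]
        by - (rule cube_closes_swap, simp)
    qed
  qed
qed

lemma cube_point_dual:
  assumes "square \<rho> \<mu> \<rho> \<mu>"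
  shows "local_rule False \<rho> \<mu> (dual_rule True \<rho> \<rho> \<rho>) = dual_rule True \<mu> \<mu> \<mu>"
    and "square \<rho> \<mu> (dual_rule True \<rho> \<rho> \<rho>) (dual_rule True \<mu> \<mu> \<mu>)"
proof -
  note p = cube_point[OF square_swap[OF assms]]
  have "prod.swap ` local_rule False \<rho> \<mu> (dual_rule True \<rho> \<rho> \<rho>) = prod.swap ` dual_rule True \<mu> \<mu> \<mu>"
    unfolding dual_rule_swap p(1) by (rule dual_rule_sym)
  then show "local_rule False \<rho> \<mu> (dual_rule True \<rho> \<rho> \<rho>) = dual_rule True \<mu> \<mu> \<mu>"
    by (metis swap_swap_image)
  show "square \<rho> \<mu> (dual_rule True \<rho> \<rho> \<rho>) (dual_rule True \<mu> \<mu> \<mu>)"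
    using square_swap[OF p(2)] by (simp add: dual_rule_def)
qed

lemma insert_addable_neq: "addable D b \<Longrightarrow> insert b D \<noteq> D"
  by (auto simp: addable_def)

lemma square_trivial:
  shows "square \<rho> \<rho> \<nu> \<kappa> \<Longrightarrow> \<kappa> = \<nu>" and "square \<rho> \<mu> \<rho> \<kappa> \<Longrightarrow> \<kappa> = \<mu>"
proof -
  show "square \<rho> \<rho> \<nu> \<kappa> \<Longrightarrow> \<kappa> = \<nu>"
    by (erule squareE) (use insert_addable_neq in blast)+
  show "square \<rho> \<mu> \<rho> \<kappa> \<Longrightarrow> \<kappa> = \<mu>"
    by (erule squareE) (use insert_addable_neq in blast)+
qed

lemma square_subset:
  assumes "square \<rho> \<mu> \<nu> \<kappa>" shows "\<rho> \<subseteq> \<mu>" "\<rho> \<subseteq> \<nu>" "\<mu> \<subseteq> \<kappa>" "\<nu> \<subseteq> \<kappa>"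
  using assms unfolding square_def by blast+

lemma partial_inj_tl: "partial_inj A \<Longrightarrow> partial_inj (\<lambda>i. A (Suc i))"
  unfolding partial_inj_def by blast

text \<open>Induction step in the number of letters: \<open>B\<close> is the matrix without the
  first letter, and the rule for prepending that letter is passed from \<open>Suc i\<close> to
  \<open>Suc (Suc i)\<close> letters. Along \<open>j\<close>, the square for one value bound yields
  both the rule and the square for the next.\<close>

lemma grow_tl_step:
  assumes A: "partial_inj A"
  defines "B \<equiv> \<lambda>i. A (Suc i)"
  assumes rule: "\<And>j. grow A (Suc i) (Suc j) = dual_rule (A 0 j) (grow B i j) (grow B i (Suc j)) (grow A (Suc i) j)"
  shows "square (grow B i j) (grow B (Suc i) j) (grow A (Suc i) j) (grow A (Suc (Suc i)) j)"
    and "grow A (Suc (Suc i)) (Suc j) =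
           dual_rule (A 0 j) (grow B (Suc i) j) (grow B (Suc i) (Suc j)) (grow A (Suc (Suc i)) j)"
proof -
  have B: "partial_inj B" unfolding B_def by (rule partial_inj_tl[OF A])
  note steps = grow_steps[OF B]
  \<comment> \<open>As long as the value bound has not passed the first letter, prepending it
    changes nothing.\<close>
  have below: "grow A (Suc i) j = grow B i j" if "\<And>j'. j' < j \<Longrightarrow> \<not> A 0 j'" for j
    using that
  proof (induction j)
    case (Suc j)
    then have "\<not> A 0 j" "grow A (Suc i) j = grow B i j" by auto
    then show ?case
      using rule[of j] step_subset[OF steps(1)[of i j]] by (simp add: dual_rule_right)
  qed simp
  have next_level: "grow A (Suc (Suc i)) (Suc j) =
           dual_rule (A 0 j) (grow B (Suc i) j) (grow B (Suc i) (Suc j)) (grow A (Suc (Suc i)) j) \<and>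
         square (grow B i (Suc j)) (grow B (Suc i) (Suc j)) (grow A (Suc i) (Suc j)) (grow A (Suc (Suc i)) (Suc j))"
    if sq: "square (grow B i j) (grow B (Suc i) j) (grow A (Suc i) j) (grow A (Suc (Suc i)) j)" for j
  proof -
    define \<rho> \<mu> \<nu> \<kappa> \<rho>' where "\<rho> = grow B i j" and "\<mu> = grow B (Suc i) j" and "\<nu> = grow A (Suc i) j"
      and "\<kappa> = grow A (Suc (Suc i)) j" and "\<rho>' = grow B i (Suc j)"
    note defs = \<rho>_def \<mu>_def \<nu>_def \<kappa>_def \<rho>'_def
    have \<mu>': "grow B (Suc i) (Suc j) = local_rule (B i j) \<rho> \<mu> \<rho>'" by (simp add: defs)
    have \<nu>': "grow A (Suc i) (Suc j) = dual_rule (A 0 j) \<rho> \<rho>' \<nu>" unfolding defs by (rule rule)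
    have \<kappa>': "grow A (Suc (Suc i)) (Suc j) = local_rule (B i j) \<nu> \<kappa> (dual_rule (A 0 j) \<rho> \<rho>' \<nu>)"
      unfolding \<nu>'[symmetric] by (simp add: defs B_def)
    have sq: "square \<rho> \<mu> \<nu> \<kappa>" using sq by (simp add: defs)
    note sub = square_subset[OF sq]
    have st: "step (\<exists>i'<i. B i' j) \<rho> \<rho>'" "step (\<exists>j'<j. B i j') \<rho> \<mu>" using steps by (simp_all add: defs)
    \<comment> \<open>The value \<open>j\<close> may be the appended letter, the first letter, a
      letter between them, or absent. In the first two cases injectivity makes the other edges of
      the cube at \<open>\<rho>\<close> trivial as far as \<open>cube_point\<close> and its dual
      require.\<close>
    have "local_rule (B i j) \<nu> \<kappa> (dual_rule (A 0 j) \<rho> \<rho>' \<nu>) = dual_rule (A 0 j) \<mu> (local_rule (B i j) \<rho> \<mu> \<rho>') \<kappa> \<and>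
       square \<rho>' (local_rule (B i j) \<rho> \<mu> \<rho>') (dual_rule (A 0 j) \<rho> \<rho>' \<nu>)
         (local_rule (B i j) \<nu> \<kappa> (dual_rule (A 0 j) \<rho> \<rho>' \<nu>))"
    proof (cases "B i j")
      case True
      have "\<not> (\<exists>i'<i. B i' j)" using partial_injD(2)[OF B True] by blast
      moreover have "\<not> (\<exists>j'<j. B i j')" using partial_injD(1)[OF B True] by blast
      moreover have "\<not> A 0 j" using partial_injD(2)[OF A, of "Suc i" j 0] True by (auto simp: B_def)
      ultimately have e: "\<rho>' = \<rho>" "\<mu> = \<rho>" "\<not> A 0 j" using st by (auto simp: step_def)
      then have "\<kappa> = \<nu>" using sq square_trivial by blast
      then show ?thesis using True e sub sq cube_point[of \<rho> \<nu>] by (simp add: dual_rule_left)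
    next
      case nB: False
      show ?thesis
      proof (cases "A 0 j")
        case True
        have "\<not> (\<exists>i'<i. B i' j)" unfolding B_def by (auto dest: partial_injD(2)[OF A True])
        moreover have "\<not> (\<exists>j'<j. A 0 j')" using partial_injD(1)[OF A True] by blast
        ultimately have e: "\<rho>' = \<rho>" "\<nu> = \<rho>" using st below[of j] by (auto simp: step_def defs)
        then have "\<kappa> = \<mu>" using sq square_trivial by blast
        then show ?thesis using True nB e sub sq cube_point_dual[of \<rho> \<mu>] by (simp add: local_rule_right)
      next
        case nA: False
        from st(1) show ?thesis
        proof (cases rule: stepE)
          case 1
          then show ?thesis using nA nB sub sq
            by (simp add: local_rule_right dual_rule_left)
        next
          case (2 b)
          then show ?thesis using cube_box[OF sq, of b] nA nB unfolding cube_closes_def by simp metis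
        qed
      qed
    qed
    then show ?thesis unfolding \<mu>' \<nu>' \<kappa>' defs .
  qed
  have "square (grow B i j) (grow B (Suc i) j) (grow A (Suc i) j) (grow A (Suc (Suc i)) j)" for j
  proof (induction j)
    case 0
    show ?case by (simp add: squareI(1))
  next
    case (Suc j)
    show ?case using next_level[OF Suc] by blast
  qed
  then show "square (grow B i j) (grow B (Suc i) j) (grow A (Suc i) j) (grow A (Suc (Suc i)) j)"
    "grow A (Suc (Suc i)) (Suc j) =
           dual_rule (A 0 j) (grow B (Suc i) j) (grow B (Suc i) (Suc j)) (grow A (Suc (Suc i)) j)"
    using next_level by blast+
qed

lemma row_len_empty [simp]: "row_len {} i = 0"
  by (simp add: row_len_def)

lemma grow_tl:
  assumes "partial_inj A"
  shows "grow A (Suc i) (Suc j) =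
    dual_rule (A 0 j) (grow (\<lambda>i. A (Suc i)) i j) (grow (\<lambda>i. A (Suc i)) i (Suc j)) (grow A (Suc i) j)"
proof (induction i arbitrary: j)
  case 0
  show ?case by (simp add: dual_rule_def local_rule_def)
next
  case (Suc i)
  then show ?case using grow_tl_step(2)[OF assms] by blast
qed

lemma grow_square:
  assumes "partial_inj A"
  shows "square (grow (\<lambda>i. A (Suc i)) i j) (grow (\<lambda>i. A (Suc i)) (Suc i) j)
    (grow A (Suc i) j) (grow A (Suc (Suc i)) j)"
  using grow_tl_step(1)[OF assms grow_tl[OF assms]] .

section \<open>Reversal and rotation of words\<close>

text \<open>Appending letters to the reversed word prepends them to the original one, and the rule
  for this is the transposed local rule. This is Schensted's theorem that reversal transposes the
  shape.\<close>

lemma grow_reverse: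
  assumes "partial_inj A"
  shows "grow (\<lambda>i. A (n - 1 - i)) n j = prod.swap ` grow A n j"
  using assms
proof (induction n arbitrary: A j)
  case (Suc n)
  note IH = Suc.IH[OF partial_inj_tl[OF Suc.prems]]
  have tl: "grow (\<lambda>i. A (Suc n - 1 - i)) n j = prod.swap ` grow (\<lambda>i. A (Suc i)) n j" for j
    unfolding IH[symmetric] by (rule grow_cong) (simp add: Suc_diff_Suc)
  show ?case
  proof (induction j)
    case (Suc j)
    show ?case
      unfolding grow_tl[OF \<open>partial_inj A\<close>, of n j] dual_rule_swap
        grow.simps(3)[of "\<lambda>i. A (Suc n - 1 - i)" n j] tl Suc
      by (subst local_rule_sym) simp
  qed simp
qed simp

lemma partial_inj_flip: "partial_inj A \<Longrightarrow> partial_inj (\<lambda>i j. A j i)"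
  unfolding partial_inj_def by blast

text \<open>Reversing the positions transposes the shape, and so does reversing the values, by the
  symmetry \<open>grow_flip\<close>; the two transpositions cancel. The bounds on \<open>i\<close>
  and \<open>j\<close> are needed because truncated subtraction would send all later indices to row
  or column 0 and destroy injectivity.\<close>

lemma grow_rotate:
  assumes "partial_inj A"
  shows "grow (\<lambda>i j. i < n \<and> j < m \<and> A (n - 1 - i) (m - 1 - j)) n m = grow A n m"
proof -
  let ?A = "\<lambda>i j. i < n \<and> j < m \<and> A i j"
  have A: "partial_inj ?A" using assms unfolding partial_inj_def by blast
  let ?R = "\<lambda>i j. n - 1 - i < n \<and> j < m \<and> A (n - 1 - i) j"
  have R: "grow ?R n m = prod.swap ` grow ?A n m" using grow_reverse[OF A, of n m] .
  let ?R' = "\<lambda>i j. i < n \<and> j < m \<and> A (n - 1 - i) j"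
  have "i = i'" if "i < n" "i' < n" "A (n - 1 - i) j" "A (n - 1 - i') j" for i i' j
    using partial_injD(2)[OF assms that(3,4)] that(1,2) by arith
  then have R': "partial_inj ?R'" unfolding partial_inj_def using partial_injD(1)[OF assms] by blast
  have "grow (\<lambda>j i. ?R' i (m - 1 - j)) m n = prod.swap ` grow (\<lambda>j i. ?R' i j) m n"
    using grow_reverse[OF partial_inj_flip[OF R'], of m n] .
  then have "grow (\<lambda>i j. ?R' i (m - 1 - j)) n m = prod.swap ` grow ?R' n m"
    using grow_flip[of "\<lambda>i j. ?R' i (m - 1 - j)" m n] grow_flip[of ?R' m n] by simp
  moreover have "grow (\<lambda>i j. ?R' i (m - 1 - j)) n m =
      grow (\<lambda>i j. i < n \<and> j < m \<and> A (n - 1 - i) (m - 1 - j)) n m"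
    by (rule grow_cong) auto
  moreover have "grow ?R' n m = grow ?R n m" by (rule grow_cong) auto
  moreover have "grow ?A n m = grow A n m" by (rule grow_cong) auto
  ultimately show ?thesis using R by simp
qed

text \<open>This vanishes exactly for the shapes with empty 2-core.\<close>

definition content_balance :: "(nat \<times> nat) set \<Rightarrow> int" where
  "content_balance D = (\<Sum>(i, j)\<in>D. (- 1) ^ (i + j))"

lemma content_balance_insert:
  "finite D \<Longrightarrow> (i, j) \<notin> D \<Longrightarrow> content_balance (insert (i, j) D) = (- 1) ^ (i + j) + content_balance D"
  by (simp add: content_balance_def)

lemma content_balance_grow_symmetric:
  assumes "partial_inj A" "\<And>i j. i < 2 * n \<Longrightarrow> j < m \<Longrightarrow> A (2 * n - 1 - i) (m - 1 - j) \<longleftrightarrow> A i j"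
  shows "content_balance (grow A (2 * n) m) = 0"
  using assms
proof (induction n arbitrary: A)
  case 0
  then show ?case by (simp add: content_balance_def)
next
  case (Suc n)
  let ?B = "\<lambda>i. A (Suc i)"
  let ?N = "2 * n"
  define \<rho> \<mu> \<nu> \<kappa> where "\<rho> = grow ?B ?N m" and "\<mu> = grow ?B (Suc ?N) m" and "\<nu> = grow A (Suc ?N) m"
    and "\<kappa> = grow A (Suc (Suc ?N)) m"
  have sq: "square \<rho> \<mu> \<nu> \<kappa>" unfolding \<rho>_def \<mu>_def \<nu>_def \<kappa>_def by (rule grow_square[OF Suc.prems(1)])
  have "content_balance \<rho> = 0" unfolding \<rho>_def
  proof (rule Suc.IH[OF partial_inj_tl[OF Suc.prems(1)]])
    fix i j assume "i < 2 * n" "j < m"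
    then show "A (Suc (2 * n - 1 - i)) (m - 1 - j) \<longleftrightarrow> A (Suc i) j"
      using Suc.prems(2)[of "Suc i" j] by (simp add: Suc_diff_Suc)
  qed
  moreover have "\<mu> = \<nu>"
  proof -
    have "\<nu> = grow (\<lambda>i j. i < Suc ?N \<and> j < m \<and> A (Suc ?N - 1 - i) (m - 1 - j)) (Suc ?N) m"
      unfolding \<nu>_def by (rule grow_rotate[OF Suc.prems(1), symmetric])
    also have "\<dots> = \<mu>" unfolding \<mu>_def
    proof (rule grow_cong)
      fix i j assume ij: "i < Suc ?N" "j < m"
      then show "(i < Suc ?N \<and> j < m \<and> A (Suc ?N - 1 - i) (m - 1 - j)) = A (Suc i) j"
        using Suc.prems(2)[of "Suc i" j] by simp
    qed
    finally show ?thesis ..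
  qed
  \<comment> \<open>With equal middle shapes only two cases of the square survive: no new box at
    all, or two neighbouring boxes, whose signs cancel.\<close>
  moreover have "content_balance \<kappa> = content_balance \<rho>"
    using sq
  proof (cases rule: squareE)
    case (both r c)
    then show ?thesis using \<open>\<mu> = \<nu>\<close> by (auto simp: addable_def)
  next
    case (same r d)
    have "finite \<rho>" "r \<notin> \<rho>" "d \<notin> insert r \<rho>" using same by (auto simp: addable_def ferrers_def)
    moreover obtain i j where "r = (i, j)" by fastforce
    ultimately show ?thesis using same
      by (auto simp: content_balance_insert)
  qed (use \<open>\<mu> = \<nu>\<close> in \<open>auto simp: addable_def\<close>)
  ultimately show ?case by (simp add: \<kappa>_def)
qed


section \<open>Growth diagrams and Robinson--Schensted insertion\<close>

definition strict_rows :: "'a::linorder list list \<Rightarrow> bool" where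
  "strict_rows T \<longleftrightarrow> (\<forall>r\<in>set T. sorted_wrt (<) r)"

lemma row_insert_append:
  "\<forall>z\<in>set r. z \<le> y \<Longrightarrow> row_insert y r = (r @ [y], None)"
  by (induction r) auto

lemma row_insert_bump:
  "\<forall>z\<in>set a. z \<le> y \<Longrightarrow> y < z \<Longrightarrow> row_insert y (a @ z # b) = (a @ y # b, Some z)"
  by (induction a) auto

lemma row_insert_cases:
  obtains "\<forall>z\<in>set r. z \<le> y" "row_insert y r = (r @ [y], None)"
  | a z b where "r = a @ z # b" "\<forall>x\<in>set a. x \<le> y" "y < z" "row_insert y r = (a @ y # b, Some z)"
proof (cases "\<forall>z\<in>set r. z \<le> y")
  case True
  then show ?thesis using that(1) row_insert_append by blast
next
  case False
  then have "\<exists>z\<in>set r. y < z" by (auto simp: not_le)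
  then obtain a z b where "r = a @ z # b" "y < z" "\<forall>x\<in>set a. \<not> y < x"
    by (metis split_list_first_prop)
  then show ?thesis using that(2)[of a z b] row_insert_bump[of a y z b] by (auto simp: not_less)
qed

lemma mset_tableau_insert: "mset (concat (tableau_insert y T)) = add_mset y (mset (concat T))"
proof (induction T arbitrary: y)
  case (Cons r T)
  show ?case
    by (cases rule: row_insert_cases[of r y]) (simp_all add: Cons.IH)
qed simp

lemma set_tableau_insert: "set (concat (tableau_insert y T)) = insert y (set (concat T))"
  by (metis mset_tableau_insert set_mset_add_mset_insert set_mset_mset)

lemma strict_rows_tableau_insert:
  assumes "strict_rows T" "y \<notin> set (concat T)" "distinct (concat T)"
  shows "strict_rows (tableau_insert y T)"
  using assms
proof (induction T arbitrary: y)
  case (Cons r T)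
  have r: "sorted_wrt (<) r" "strict_rows T" "distinct (concat T)" "y \<notin> set r" "y \<notin> set (concat T)"
    using Cons.prems by (auto simp: strict_rows_def)
  show ?case
  proof (cases rule: row_insert_cases[of r y])
    case 1
    then have "\<forall>z\<in>set r. z < y" using r(4) by (metis nless_le)
    then show ?thesis using 1 r by (simp add: strict_rows_def sorted_wrt_append)
  next
    case (2 a z b)
    then have "\<forall>x\<in>set a. x < y" using r(4) by (metis Un_iff nless_le set_append)
    moreover have "strict_rows (tableau_insert z T)"
      using Cons.IH[of z] r Cons.prems 2(1) by auto
    moreover have "sorted_wrt (<) (a @ z # b)" using r(1) 2(1) by simp
    ultimately show ?thesis using 2 by (auto simp: strict_rows_def sorted_wrt_append)
  qed
qed (simp add: strict_rows_def)

lemma tableau_insert_nonempty: "[] \<notin> set T \<Longrightarrow> [] \<notin> set (tableau_insert y T)"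
proof (induction T arbitrary: y)
  case (Cons r T)
  show ?case
    by (cases rule: row_insert_cases[of r y]) (use Cons in auto)
qed simp

lemma insertion_tableau_snoc:
  "insertion_tableau (w @ [y]) = tableau_insert y (insertion_tableau w)"
  by (simp add: insertion_tableau_def)

lemma insertion_tableau_Nil [simp]: "insertion_tableau [] = []"
  by (simp add: insertion_tableau_def)

lemma mset_insertion_tableau: "mset (concat (insertion_tableau w)) = mset w"
  by (induction w rule: rev_induct) (simp_all add: insertion_tableau_snoc mset_tableau_insert)

lemma set_insertion_tableau: "set (concat (insertion_tableau w)) = set w"
  by (metis mset_insertion_tableau set_mset_mset)

lemma insertion_tableau_nonempty: "[] \<notin> set (insertion_tableau w)"
  by (induction w rule: rev_induct) (simp_all add: insertion_tableau_snoc tableau_insert_nonempty)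

lemma insertion_tableau_distinct: "distinct w \<Longrightarrow> distinct (concat (insertion_tableau w))"
  by (metis mset_eq_imp_distinct_iff mset_insertion_tableau)

lemma insertion_tableau_strict_rows: "distinct w \<Longrightarrow> strict_rows (insertion_tableau w)"
proof (induction w rule: rev_induct)
  case (snoc y w)
  then show ?case
    using insertion_tableau_distinct[of w] set_insertion_tableau[of w]
    by (simp add: insertion_tableau_snoc strict_rows_tableau_insert)
qed (simp add: strict_rows_def)

definition row_count :: "nat list list \<Rightarrow> nat \<Rightarrow> nat \<Rightarrow> nat" where
  "row_count T j r = (if r < length T then length (filter (\<lambda>x. x < j) (T ! r)) else 0)"

lemma row_count_Nil [simp]: "row_count [] j r = 0"
  by (simp add: row_count_def)

lemma row_count_Cons:
  "row_count (t # T) j r = (case r of 0 \<Rightarrow> length (filter (\<lambda>x. x < j) t) | Suc r \<Rightarrow> row_count T j r)"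
  by (cases r) (simp_all add: row_count_def)

definition shape_of :: "(nat \<Rightarrow> nat) \<Rightarrow> (nat \<times> nat) set" where
  "shape_of f = {(r, k). k < f r}"

lemma row_len_shape_of [simp]: "row_len (shape_of f) r = f r"
  by (simp add: row_len_def shape_of_def)

lemma shape_of_upd: "shape_of (f(r := Suc (f r))) = insert (r, f r) (shape_of f)"
  by (auto simp: shape_of_def split: if_splits)

lemma not_in_shape_of [simp]: "(r, f r) \<notin> shape_of f"
  by (simp add: shape_of_def)

text \<open>\<open>R j\<close> is the row that gains a box in the part of the tableau formed by the entries below \<open>j\<close>:
  it moves down whenever the bumping route displaces the entry \<open>j\<close>.\<close>

lemma bumping_route:
  assumes "strict_rows T" "distinct (concat T)" "y \<notin> set (concat T)"
  obtains R where "R (Suc y) = 0"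
    "\<And>j r. row_count (tableau_insert y T) j r = row_count T j r + (if y < j \<and> r = R j then 1 else 0)"
    "\<And>j. y < j \<Longrightarrow> R (Suc j) = (if R j < length T \<and> j \<in> set (T ! R j) then Suc (R j) else R j)"
  using assms
proof (induction T arbitrary: y thesis)
  case Nil
  show ?case
    by (rule Nil.prems(1)[of "\<lambda>_. 0"]) (auto simp: row_count_def)
next
  case (Cons t T)
  have t: "sorted_wrt (<) t" "strict_rows T" "distinct (concat T)" "y \<notin> set t" "y \<notin> set (concat T)"
    using Cons.prems by (auto simp: strict_rows_def)
  show ?case
  proof (cases rule: row_insert_cases[of t y])
    case 1
    show ?thesis
    proof (rule Cons.prems(1)[of "\<lambda>_. 0"])
      fix j assume "y < j"
      then show "(0::nat) = (if 0 < length (t # T) \<and> j \<in> set ((t # T) ! 0) then Suc 0 else 0)"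
        using 1(1) by auto
    qed (auto simp: 1 row_count_Cons split: nat.splits)
  next
    case (2 a z b)
    have z: "z \<notin> set (concat T)" using Cons.prems(3) 2(1) by auto
    obtain R where R: "R (Suc z) = 0"
      "\<And>j r. row_count (tableau_insert z T) j r = row_count T j r + (if z < j \<and> r = R j then 1 else 0)"
      "\<And>j. z < j \<Longrightarrow> R (Suc j) = (if R j < length T \<and> j \<in> set (T ! R j) then Suc (R j) else R j)"
      using Cons.IH[of z] t z by blast
    have zt: "\<And>x. x \<in> set b \<Longrightarrow> z < x" "\<And>x. x \<in> set a \<Longrightarrow> x < z"
      using t(1) 2(1) by (auto simp: sorted_wrt_append)
    \<comment> \<open>Entries up to the bumped \<open>z\<close> see only the box gained by the top
      row; beyond \<open>z\<close> the route is that of \<open>z\<close> in the remaining rows, one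
      row further down.\<close>
    show ?thesis
    proof (rule Cons.prems(1)[of "\<lambda>j. if j \<le> z then 0 else Suc (R j)"])
      show "(if Suc y \<le> z then 0 else Suc (R (Suc y))) = 0" using 2(3) by simp
      show "row_count (tableau_insert y (t # T)) j r = row_count (t # T) j r +
          (if y < j \<and> r = (if j \<le> z then 0 else Suc (R j)) then 1 else 0)" for j r
        using 2 by (cases r) (auto simp: row_count_Cons R(2))
      fix j assume j: "y < j"
      have "j \<in> set t \<longleftrightarrow> j = z" if "j \<le> z"
        using that 2(1,2) zt(1)[of j] j by force
      moreover have "j = z \<Longrightarrow> Suc (R (Suc j)) = Suc 0" using R(1) by simp
      ultimately show "(if Suc j \<le> z then 0 else Suc (R (Suc j))) =
          (if (if j \<le> z then 0 else Suc (R j)) < length (t # T) \<and>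
              j \<in> set ((t # T) ! (if j \<le> z then 0 else Suc (R j)))
           then Suc (if j \<le> z then 0 else Suc (R j)) else (if j \<le> z then 0 else Suc (R j)))"
        using R(3)[of j] by (cases "j \<le> z") (auto simp: not_le)
    qed
  qed
qed

lemma row_count_Suc:
  assumes "strict_rows T" "distinct (concat T)"
  shows "(\<forall>r. row_count T (Suc j) r = row_count T j r) \<and> j \<notin> set (concat T) \<or>
    (\<exists>s < length T. j \<in> set (T ! s) \<and> (\<forall>r. r < length T \<longrightarrow> j \<in> set (T ! r) \<longrightarrow> r = s) \<and>
       row_count T (Suc j) = (row_count T j)(s := Suc (row_count T j s)))"
  using assms
proof (induction T)
  case (Cons t T)
  have t: "sorted_wrt (<) t" "strict_rows T" "distinct (concat T)" "set t \<inter> set (concat T) = {}"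
    using Cons.prems by (auto simp: strict_rows_def)
  have f: "filter (\<lambda>x. x < Suc j) t = filter (\<lambda>x. x < j) t" if "j \<notin> set t"
    using that by (intro filter_cong) (auto simp: less_Suc_eq)
  show ?case
  proof (cases "j \<in> set t")
    case True
    then obtain a b where ab: "t = a @ j # b" by (meson split_list)
    have "filter (\<lambda>x. x < Suc j) t = a @ [j]" "filter (\<lambda>x. x < j) t = a"
      using t(1) unfolding ab by (auto simp: sorted_wrt_append filter_id_conv filter_empty_conv less_Suc_eq)
    moreover have nT: "j \<notin> set (T ! r)" if "r < length T" for r
      using True t(4) nth_mem[OF that] by auto
    moreover have "row_count T (Suc j) r = row_count T j r" for r
      using Cons.IH[OF t(2,3)] nT by metis
    ultimately have "row_count (t # T) (Suc j) = (row_count (t # T) j)(0 := Suc (row_count (t # T) j 0))"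
      by (simp add: row_count_Cons fun_eq_iff split: nat.split)
    moreover have "r = 0" if "r < length (t # T)" "j \<in> set ((t # T) ! r)" for r
      using that nT by (cases r) auto
    ultimately show ?thesis using True by (intro disjI2 exI[of _ 0]) simp
  next
    case False
    from Cons.IH[OF t(2,3)] show ?thesis
    proof
      assume "(\<forall>r. row_count T (Suc j) r = row_count T j r) \<and> j \<notin> set (concat T)"
      then show ?thesis using False f by (intro disjI1) (auto simp: row_count_Cons split: nat.splits)
    next
      assume "\<exists>s < length T. j \<in> set (T ! s) \<and> (\<forall>r. r < length T \<longrightarrow> j \<in> set (T ! r) \<longrightarrow> r = s) \<and>
       row_count T (Suc j) = (row_count T j)(s := Suc (row_count T j s))"
      then obtain s where "s < length T" "j \<in> set (T ! s)"
        "\<forall>r. r < length T \<longrightarrow> j \<in> set (T ! r) \<longrightarrow> r = s"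
        "row_count T (Suc j) = (row_count T j)(s := Suc (row_count T j s))" by blast
      note s = this
      have "row_count (t # T) (Suc j) = (row_count (t # T) j)(Suc s := Suc (row_count (t # T) j (Suc s)))"
        using s(4) f[OF False] by (simp add: row_count_Cons fun_eq_iff split: nat.split)
      moreover have "r = Suc s" if "r < length (t # T)" "j \<in> set ((t # T) ! r)" for r
        using that s(3) False by (cases r) auto
      ultimately show ?thesis using s(1,2) by (intro disjI2 exI[of _ "Suc s"]) simp
    qed
  qed
qed (simp add: row_count_def)

text \<open>The position \<open>R j\<close> of the bumping route is the row of the box that
  \<open>y\<close> adds among the entries below \<open>j\<close>. The clause for equal boxes applies
  exactly when the entry \<open>j\<close> of \<open>T\<close> lies in that row: then
  \<open>j\<close> is displaced and the route moves down. A point of the matrix is the start of the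
  route in the top row.\<close>

lemma tableau_insert_local_rule:
  assumes "strict_rows T" "distinct (concat T)" "y \<notin> set (concat T)"
  shows "shape_of (row_count (tableau_insert y T) (Suc j)) =
    local_rule (y = j) (shape_of (row_count T j)) (shape_of (row_count (tableau_insert y T) j))
      (shape_of (row_count T (Suc j)))"
proof -
  let ?T' = "tableau_insert y T"
  obtain R where R: "R (Suc y) = 0"
    "\<And>j r. row_count ?T' j r = row_count T j r + (if y < j \<and> r = R j then 1 else 0)"
    "\<And>j. y < j \<Longrightarrow> R (Suc j) = (if R j < length T \<and> j \<in> set (T ! R j) then Suc (R j) else R j)"
    using bumping_route[OF assms] by blast
  have below: "row_count ?T' j = row_count T j" if "j \<le> y" for j
    using that by (auto simp: R(2) fun_eq_iff)
  have above: "row_count ?T' j = (row_count T j)(R j := Suc (row_count T j (R j)))" if "y < j" for j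
    using that by (auto simp: R(2) fun_eq_iff)
  have sub: "shape_of (row_count T j) \<subseteq> shape_of (row_count T (Suc j))"
    using row_count_Suc[OF assms(1,2), of j]
  proof
    assume "(\<forall>r. row_count T (Suc j) r = row_count T j r) \<and> j \<notin> set (concat T)"
    then show ?thesis by (simp add: shape_of_def)
  next
    assume "\<exists>s < length T. j \<in> set (T ! s) \<and> (\<forall>r. r < length T \<longrightarrow> j \<in> set (T ! r) \<longrightarrow> r = s) \<and>
       row_count T (Suc j) = (row_count T j)(s := Suc (row_count T j s))"
    then obtain s where "row_count T (Suc j) = (row_count T j)(s := Suc (row_count T j s))" by blast
    then show ?thesis by (simp add: shape_of_upd subset_insertI)
  qed
  consider "j < y" | "j = y" | "y < j" by linarith
  then show ?thesis
  proof cases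
    case 1
    then show ?thesis using sub by (simp add: below local_rule_left)
  next
    case 2
    have "row_count T (Suc y) = row_count T y"
      using row_count_Suc[OF assms(1,2), of y] assms(3) by (auto dest: nth_mem)
    then show ?thesis using 2 above[of "Suc y"] R(1) by (simp add: local_rule_def shape_of_upd)
  next
    case 3
    let ?f = "row_count T j"
    have \<mu>: "shape_of (row_count ?T' j) = insert (R j, ?f (R j)) (shape_of ?f)"
      using above[OF 3] by (simp add: shape_of_upd)
    from row_count_Suc[OF assms(1,2), of j] show ?thesis
    proof
      assume a: "(\<forall>r. row_count T (Suc j) r = ?f r) \<and> j \<notin> set (concat T)"
      then have "row_count T (Suc j) = ?f" by (auto simp: fun_eq_iff)
      moreover have "R (Suc j) = R j" using a R(3)[OF 3] nth_mem by fastforce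
      ultimately show ?thesis using 3 above[of "Suc j"] \<mu>
        by (simp add: shape_of_upd local_rule_right subset_insertI)
    next
      assume "\<exists>s < length T. j \<in> set (T ! s) \<and> (\<forall>r. r < length T \<longrightarrow> j \<in> set (T ! r) \<longrightarrow> r = s) \<and>
       row_count T (Suc j) = ?f(s := Suc (?f s))"
      then obtain s where s: "s < length T" "j \<in> set (T ! s)"
        "\<forall>r. r < length T \<longrightarrow> j \<in> set (T ! r) \<longrightarrow> r = s" "row_count T (Suc j) = ?f(s := Suc (?f s))"
        by blast
      have \<nu>: "shape_of (row_count T (Suc j)) = insert (s, ?f s) (shape_of ?f)"
        using s(4) by (simp add: shape_of_upd)
      show ?thesis
      proof (cases "R j = s")
        case True
        then have R': "R (Suc j) = Suc s" using R(3)[OF 3] s(1,2) by simp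
        have "row_len (insert (s, ?f s) (shape_of ?f)) (Suc s) = ?f (Suc s)"
          unfolding shape_of_upd[symmetric] by simp
        then have "local_rule False (shape_of ?f) (insert (s, ?f s) (shape_of ?f)) (insert (s, ?f s) (shape_of ?f)) =
          insert (Suc s, ?f (Suc s)) (insert (s, ?f s) (shape_of ?f))"
          by (simp add: local_rule_same)
        moreover have "shape_of (row_count ?T' (Suc j)) =
            insert (Suc s, row_count T (Suc j) (Suc s)) (shape_of (row_count T (Suc j)))"
          using above[of "Suc j"] 3 R' by (simp add: shape_of_upd)
        moreover have "row_count T (Suc j) (Suc s) = ?f (Suc s)" using s(4) by simp
        ultimately show ?thesis unfolding \<mu> \<nu> True using 3 by simp
      next
        case False
        then have "\<not> (R j < length T \<and> j \<in> set (T ! R j))" using s(3) by blast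
        then have "R (Suc j) = R j" using R(3)[OF 3] by simp
        then have "shape_of (row_count ?T' (Suc j)) =
            insert (R j, row_count T (Suc j) (R j)) (shape_of (row_count T (Suc j)))"
          using above[of "Suc j"] 3 by (simp add: shape_of_upd)
        moreover have "row_count T (Suc j) (R j) = ?f (R j)" using s(4) False by simp
        moreover have "local_rule False (shape_of ?f) (insert (R j, ?f (R j)) (shape_of ?f))
            (insert (s, ?f s) (shape_of ?f)) = insert (R j, ?f (R j)) (insert (s, ?f s) (shape_of ?f))"
          using False by (intro local_rule_neq) auto
        ultimately show ?thesis unfolding \<mu> \<nu> using 3 by simp
      qed
    qed
  qed
qed

definition point_matrix :: "nat list \<Rightarrow> nat \<Rightarrow> nat \<Rightarrow> bool" where
  "point_matrix w i j \<longleftrightarrow> i < length w \<and> w ! i = j"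

lemma row_count_0 [simp]: "shape_of (row_count T 0) = {}"
  by (auto simp: shape_of_def row_count_def)

lemma insertion_tableau_grow:
  assumes "distinct w" "i \<le> length w"
  shows "grow (point_matrix w) i j = shape_of (row_count (insertion_tableau (take i w)) j)"
  using assms(2)
proof (induction i arbitrary: j)
  case 0
  then show ?case by (simp add: shape_of_def)
next
  case (Suc i)
  let ?T = "insertion_tableau (take i w)"
  have T: "take (Suc i) w = take i w @ [w ! i]" "distinct (take i w)" "w ! i \<notin> set (concat ?T)"
    using assms(1) Suc.prems distinct_take[of w "Suc i"] unfolding set_insertion_tableau
    by (simp_all add: take_Suc_conv_app_nth)
  note l = tableau_insert_local_rule[OF insertion_tableau_strict_rows[OF T(2)]
      insertion_tableau_distinct[OF T(2)] T(3)]
  have IH: "grow (point_matrix w) i j = shape_of (row_count ?T j)" for j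
    using Suc.IH Suc.prems by simp
  have pt: "point_matrix w i j \<longleftrightarrow> w ! i = j" for j using Suc.prems by (simp add: point_matrix_def)
  show ?case
  proof (induction j)
    case (Suc j)
    then show ?case unfolding grow.simps(3) IH pt T(1) insertion_tableau_snoc l by simp
  qed simp
qed

lemma partial_inj_point_matrix: "distinct w \<Longrightarrow> partial_inj (point_matrix w)"
  unfolding partial_inj_def point_matrix_def by (auto simp: nth_eq_iff_index_eq)

lemma rs_shape_grow:
  assumes "distinct w" "\<And>x. x \<in> set w \<Longrightarrow> x < m"
  shows "grow (point_matrix w) (length w) m =
    {(r, k). r < length (rs_shape w) \<and> k < rs_shape w ! r}"
proof -
  let ?T = "insertion_tableau w"
  have "row_count ?T m r = length (?T ! r)" if "r < length ?T" for r
  proof -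
    have "\<forall>x\<in>set (?T ! r). x < m"
      using assms(2) set_insertion_tableau[of w] nth_mem[OF that] by auto
    then show ?thesis using that by (simp add: row_count_def)
  qed
  then show ?thesis
    unfolding insertion_tableau_grow[OF assms(1) order_refl]
    by (auto simp: shape_of_def rs_shape_def row_count_def split: if_splits)
qed

text \<open>That the row lengths decrease is taken from the growth diagram, all of whose shapes are
  \<open>ferrers\<close>; no column condition on the tableau has to be maintained.\<close>

lemma rs_shape_partition:
  fixes w :: "nat list"
  assumes "distinct w"
  shows "is_partition (length w) (rs_shape w)"
  unfolding is_partition_def
proof (intro conjI)
  obtain m where m: "\<And>x. x \<in> set w \<Longrightarrow> x < m"
    using finite_nat_set_iff_bounded[of "set w"] by auto
  let ?p = "rs_shape w"
  have f: "ferrers {(r, k). r < length ?p \<and> k < ?p ! r}"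
    using ferrers_grow[OF partial_inj_point_matrix[OF assms]] rs_shape_grow[OF assms m] by metis
  show "sorted_wrt (\<ge>) ?p"
    unfolding sorted_wrt_iff_nth_less
  proof (intro allI impI)
    fix i j assume ij: "i < j" "j < length ?p"
    show "?p ! j \<le> ?p ! i"
    proof (cases "?p ! j")
      case (Suc k)
      then have "(i, k) \<in> {(r, k). r < length ?p \<and> k < ?p ! r}"
        using ij by (intro ferrersD[OF f, of j k i k]) auto
      then show ?thesis using Suc by simp
    qed simp
  qed
  show "0 \<notin> set ?p"
    using insertion_tableau_nonempty[of w] by (auto simp: rs_shape_def)
  show "sum_list ?p = length w"
    using arg_cong[OF mset_insertion_tableau[of w], of size] by (simp add: rs_shape_def length_concat)
qed


section \<open>Standardization\<close>

text \<open>The invariant of standardization: among entries with equal \<open>f\<close>, those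
  further down are smaller. Hence a bumped entry exceeds its equals in the rows below, just as a
  newly inserted letter does, and the comparisons with and without \<open>f\<close> have the same
  outcome.\<close>

definition ties_descend :: "('a::linorder \<Rightarrow> 'b) \<Rightarrow> 'a list list \<Rightarrow> bool" where
  "ties_descend f T \<longleftrightarrow> sorted_wrt (\<lambda>r s. \<forall>a\<in>set r. \<forall>b\<in>set s. f a = f b \<longrightarrow> b < a) T"

lemma tableau_insert_map:
  fixes f :: "'a::linorder \<Rightarrow> 'b::linorder"
  assumes "mono_on (insert y (set (concat T))) f" "strict_rows T" "ties_descend f T"
    "\<And>a. a \<in> set (concat T) \<Longrightarrow> f a = f y \<Longrightarrow> a < y"
  shows "tableau_insert (f y) (map (map f) T) = map (map f) (tableau_insert y T) \<and>
    ties_descend f (tableau_insert y T)"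
  using assms
proof (induction T arbitrary: y)
  case (Cons r T)
  have r: "sorted_wrt (<) r" "strict_rows T" "ties_descend f T"
    "\<And>a b. a \<in> set r \<Longrightarrow> b \<in> set (concat T) \<Longrightarrow> f a = f b \<Longrightarrow> b < a"
    using Cons.prems by (auto simp: strict_rows_def ties_descend_def)
  show ?case
  proof (cases rule: row_insert_cases[of r y])
    case 1
    have "\<forall>z\<in>set (map f r). z \<le> f y"
      using 1(1) Cons.prems(1) by (auto intro: mono_onD)
    then have "row_insert (f y) (map f r) = (map f r @ [f y], None)" by (rule row_insert_append)
    moreover have "ties_descend f ((r @ [y]) # T)"
      using r Cons.prems(4) unfolding ties_descend_def by fastforce
    ultimately show ?thesis using 1 by simp
  next
    case (2 a z b)
    have le: "\<forall>x\<in>set (map f a). x \<le> f y"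
      using 2(1,2) Cons.prems(1) by (auto intro: mono_onD)
    have "f y \<le> f z" using 2(1,3) Cons.prems(1) by (intro mono_onD[OF Cons.prems(1)]) auto
    moreover have "f y \<noteq> f z" using Cons.prems(4)[of z] 2(1,3) by auto
    ultimately have lt: "f y < f z" by simp
    have ins: "row_insert (f y) (map f r) = (map f a @ f y # map f b, Some (f z))"
      unfolding 2(1) using row_insert_bump[OF le lt] by simp
    have IH: "tableau_insert (f z) (map (map f) T) = map (map f) (tableau_insert z T)"
      "ties_descend f (tableau_insert z T)"
    proof -
      have "mono_on (insert z (set (concat T))) f"
        by (rule mono_on_subset[OF Cons.prems(1)]) (use 2(1) in auto)
      moreover have "c < z" if "c \<in> set (concat T)" "f c = f z" for c
        using r(4)[of z c] that 2(1) by simp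
      ultimately show "tableau_insert (f z) (map (map f) T) = map (map f) (tableau_insert z T)"
        "ties_descend f (tableau_insert z T)"
        using Cons.IH[of z] r by blast+
    qed
    have "d < c" if c: "c \<in> set (a @ y # b)" and d: "d \<in> set (concat (tableau_insert z T))" and eq: "f c = f d" for c d
    proof -
      have "z < x" if "x \<in> set b" for x using r(1) 2(1) that by (auto simp: sorted_wrt_append)
      then have z: "d < c" if "d = z" using c eq le lt that by auto
      show ?thesis
        using d z c eq eq[symmetric] r(4)[of c d] Cons.prems(4)[of d] 2(1)
        unfolding set_tableau_insert by auto
    qed
    then have "ties_descend f ((a @ y # b) # tableau_insert z T)"
      using IH(2) unfolding ties_descend_def by auto
    then show ?thesis using 2 ins IH by simp
  qed
qed (simp add: ties_descend_def)

text \<open>Replacing equal entries by increasing ones from left to right does not change the course of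
  the insertions.\<close>

lemma insertion_tableau_map:
  fixes f :: "'a::linorder \<Rightarrow> 'b::linorder"
  assumes "mono_on (set u) f" "distinct u"
    "\<And>i j. i < j \<Longrightarrow> j < length u \<Longrightarrow> f (u ! i) = f (u ! j) \<Longrightarrow> u ! i < u ! j"
  shows "insertion_tableau (map f u) = map (map f) (insertion_tableau u) \<and> ties_descend f (insertion_tableau u)"
  using assms
proof (induction u rule: rev_induct)
  case (snoc y u)
  have "mono_on (set u) f" using snoc.prems(1) by (rule mono_on_subset) auto
  moreover have "u ! i < u ! j" if "i < j" "j < length u" "f (u ! i) = f (u ! j)" for i j
    using snoc.prems(3)[of i j] that by (simp add: nth_append)
  ultimately have IH: "insertion_tableau (map f u) = map (map f) (insertion_tableau u)"
    "ties_descend f (insertion_tableau u)"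
    using snoc.IH snoc.prems(2) by auto
  have "a < y" if a: "a \<in> set u" "f a = f y" for a
  proof -
    obtain i where "i < length u" "a = u ! i" using a(1) unfolding in_set_conv_nth by metis
    then show ?thesis using snoc.prems(3)[of i "length u"] a(2) by (simp add: nth_append)
  qed
  then show ?case
    using tableau_insert_map[of y "insertion_tableau u" f] IH snoc.prems(1,2)
      insertion_tableau_strict_rows[of u] unfolding set_insertion_tableau
    by (simp add: insertion_tableau_snoc)
qed (simp add: ties_descend_def)

lemma rs_shape_map:
  fixes f :: "'a::linorder \<Rightarrow> 'b::linorder"
  assumes "mono_on (set u) f" "distinct u"
    "\<And>i j. i < j \<Longrightarrow> j < length u \<Longrightarrow> f (u ! i) = f (u ! j) \<Longrightarrow> u ! i < u ! j"
  shows "rs_shape (map f u) = rs_shape u"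
proof -
  have "insertion_tableau (map f u) = map (map f) (insertion_tableau u)"
    using insertion_tableau_map[OF assms] by blast
  then show ?thesis by (simp add: rs_shape_def)
qed

lemma rs_shape_strict_mono_map:
  fixes f :: "'a::linorder \<Rightarrow> 'b::linorder"
  assumes "strict_mono_on (set u) f" "distinct u"
  shows "rs_shape (map f u) = rs_shape u"
proof (rule rs_shape_map[OF _ assms(2)])
  show "mono_on (set u) f" using assms(1) by (rule strict_mono_on_imp_mono_on)
  fix i j assume "i < j" "j < length u" "f (u ! i) = f (u ! j)"
  then show "u ! i < u ! j"
    using strict_mono_on_imp_inj_on[OF assms(1)] assms(2)
    by (metis inj_onD less_trans nat_neq_iff nth_eq_iff_index_eq nth_mem)
qed

text \<open>Ties are ranked from left to right. Since \<open>w ! (N - 1 - i) = - w ! i\<close>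
  reverses values and positions at once, it reverses the order \<open>prec\<close> with its ties,
  and ranks turn into their complements: the matrix of \<open>u\<close> is invariant under
  rotation.\<close>

lemma standardization:
  fixes w :: "real list"
  assumes len: "length w = N" and sym: "\<And>i. i < N \<Longrightarrow> w ! (N - 1 - i) = - w ! i"
  obtains u :: "nat list" where "length u = N" "distinct u" "set u = {..<N}"
    "\<And>i. i < N \<Longrightarrow> u ! (N - 1 - i) = N - 1 - u ! i" "rs_shape w = rs_shape u"
proof -
  define prec where "prec i j \<longleftrightarrow> w ! i < w ! j \<or> (w ! i = w ! j \<and> i < j)" for i j
  define rank where "rank i = card {j. j < N \<and> prec j i}" for i
  define u where "u = map rank [0..<N]"
  have mono: "rank i < rank j" if "prec i j" "i < N" for i j
    unfolding rank_def by (rule psubset_card_mono) (use that in \<open>auto simp: prec_def\<close>)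
  have total: "prec i j \<or> i = j \<or> prec j i" for i j by (auto simp: prec_def)
  have less_N: "rank i < N" if "i < N" for i
  proof -
    have "{j. j < N \<and> prec j i} \<subset> {..<N}" using that by (auto simp: prec_def)
    from psubset_card_mono[OF finite_lessThan this] show ?thesis unfolding rank_def by simp
  qed
  have inj: "inj_on rank {..<N}"
  proof (rule inj_onI)
    fix i j assume "i \<in> {..<N}" "j \<in> {..<N}" "rank i = rank j"
    then show "i = j" using mono[of i j] mono[of j i] total[of i j] by (metis lessThan_iff less_irrefl)
  qed
  have img: "rank ` {..<N} = {..<N}"
    by (rule card_subset_eq) (use less_N in \<open>auto simp: card_image[OF inj]\<close>)
  have "length u = N" by (simp add: u_def)
  moreover have "distinct u" using inj by (simp add: u_def distinct_map atLeast0LessThan)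
  moreover have su: "set u = {..<N}" using img by (simp add: u_def atLeast0LessThan)
  moreover have "u ! (N - 1 - i) = N - 1 - u ! i" if i: "i < N" for i
  proof -
    let ?g = "\<lambda>j. N - 1 - j"
    have flip: "prec (?g j) (?g i) \<longleftrightarrow> prec i j" if "j < N" for j
      using sym[OF that] sym[OF i] that i by (auto simp: prec_def)
    have gg: "?g (?g j) = j" if "j < N" for j using that by simp
    have "{j. j < N \<and> prec j (?g i)} = ?g ` {j. j < N \<and> prec i j}"
    proof (intro set_eqI iffI)
      fix j assume "j \<in> {j. j < N \<and> prec j (?g i)}"
      then show "j \<in> ?g ` {j. j < N \<and> prec i j}"
        using flip[of "?g j"] gg[of j] by (intro image_eqI[of _ _ "?g j"]) auto
    next
      fix j assume "j \<in> ?g ` {j. j < N \<and> prec i j}"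
      then show "j \<in> {j. j < N \<and> prec j (?g i)}" using flip by auto
    qed
    moreover have "inj_on ?g {j. j < N \<and> prec i j}" by (intro inj_onI) auto
    ultimately have "rank (?g i) = card {j. j < N \<and> prec i j}"
      by (simp add: rank_def card_image)
    moreover have "{..<N} = insert i ({j. j < N \<and> prec j i} \<union> {j. j < N \<and> prec i j})"
      using i total by auto
    then have "N = card (insert i ({j. j < N \<and> prec j i} \<union> {j. j < N \<and> prec i j}))"
      by (metis card_lessThan)
    moreover have "card (insert i ({j. j < N \<and> prec j i} \<union> {j. j < N \<and> prec i j})) = Suc (rank i + card {j. j < N \<and> prec i j})"
    proof -
      have "{j. j < N \<and> prec j i} \<inter> {j. j < N \<and> prec i j} = {}" by (auto simp: prec_def)
      then show ?thesis unfolding rank_def by (simp add: card_Un_disjoint prec_def)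
    qed
    ultimately show ?thesis using i by (simp add: u_def)
  qed
  moreover have "rs_shape w = rs_shape u"
  proof -
    define f where "f k = w ! (inv_into {..<N} rank k)" for k
    have f: "f (rank i) = w ! i" if "i < N" for i
      using inv_into_f_f[OF inj, of i] that by (simp add: f_def)
    have "map f u = w"
      by (rule nth_equalityI) (simp_all add: u_def len f)
    moreover have "rs_shape (map f u) = rs_shape u"
    proof (rule rs_shape_map)
      show "mono_on (set u) f"
      proof (rule mono_onI)
        fix r s assume "r \<in> set u" "s \<in> set u" "r \<le> s"
        then obtain i j where ij: "i < N" "j < N" "r = rank i" "s = rank j"
          by (auto simp: u_def)
        then have "\<not> prec j i" using mono[of j i] \<open>r \<le> s\<close> by auto
        then show "f r \<le> f s" using ij f by (auto simp: prec_def)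
      qed
      fix i j assume "i < j" "j < length u" "f (u ! i) = f (u ! j)"
      then show "u ! i < u ! j" using mono[of i j] by (auto simp: u_def f prec_def)
    qed fact
    ultimately show ?thesis by simp
  qed
  ultimately show ?thesis using that by blast
qed

section \<open>The word of a weight and the balance of its shape\<close>

lemma lambda_minus_nth:
  assumes "i < 2 * n"
  shows "lambda_minus n lam ! i = (if i < n then Re (lam (Suc i)) else - Re (lam (2 * n - i)))"
proof (cases "i < n")
  case False
  then have "rev [1..<n + 1] ! (i - n) = 2 * n - i" using assms
    by (subst rev_nth) (auto simp del: upt_Suc)
  moreover have "lambda_minus n lam ! i = - Re (lam (rev [1..<n + 1] ! (i - n)))"
    using False assms by (simp add: lambda_minus_def nth_append del: upt_Suc)
  ultimately show ?thesis using False by (simp only: if_False)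
qed (simp add: lambda_minus_def nth_append del: upt_Suc)

lemma lambda_minus_symmetric:
  "length (lambda_minus n lam) = 2 * n"
  "i < 2 * n \<Longrightarrow> lambda_minus n lam ! (2 * n - 1 - i) = - lambda_minus n lam ! i"
proof -
  show "length (lambda_minus n lam) = 2 * n" by (simp add: lambda_minus_def)
  show "lambda_minus n lam ! (2 * n - 1 - i) = - lambda_minus n lam ! i" if "i < 2 * n"
    using that by (auto simp: lambda_minus_nth intro!: arg_cong[of _ _ "\<lambda>i. Re (lam i)"])
qed

text \<open>\<open>g\<close> relabels \<open>0, ..., 2 * n - 1\<close> increasingly by the nonzero
  integers from \<open>- n\<close> to \<open>n\<close>, which does not affect the insertion, and
  \<open>h k\<close> is the position of the letter \<open>w k\<close> in the word. Invariance under
  rotation makes \<open>w\<close> odd.\<close>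

lemma domino_type_standard:
  assumes "length u = 2 * n" "distinct u" "set u = {..<2 * n}"
    "\<And>i. i < 2 * n \<Longrightarrow> u ! (2 * n - 1 - i) = 2 * n - 1 - u ! i"
  shows "domino_type n (rs_shape u)"
proof -
  define g where "g k = (if k < n then int k - int n else int k - int n + 1)" for k
  define w where "w k = (if 0 < k then g (u ! (n + nat k - 1)) else - g (u ! (n + nat (- k) - 1)))" for k
  have u: "u ! i < 2 * n" if "i < 2 * n" for i using assms(1,3) that nth_mem by fastforce
  have g: "strict_mono_on (set u) g" by (rule strict_mono_onI) (auto simp: g_def)
  have gneg: "g (2 * n - 1 - k) = - g k" if "k < 2 * n" for k using that by (auto simp: g_def)
  have wneg: "w (- k) = - w k" if "k \<noteq> 0" for k using that by (simp add: w_def)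
  define h where "h k = (if 0 < k then n + nat k - 1 else nat (int n + k))" for k
  have w_nth: "w k = g (u ! h k)"
    if "k \<in> {- int n..int n} - {0}" for k
  proof (cases "0 < k")
    case False
    then have k: "nat (- k) \<le> n" "0 < nat (- k)" using that by auto
    have "n + nat (- k) - 1 = 2 * n - 1 - nat (int n + k)" using False that by auto
    moreover have "nat (int n + k) < 2 * n" using False that by auto
    ultimately have "g (u ! (n + nat (- k) - 1)) = - g (u ! nat (int n + k))"
      using assms(4) gneg u by simp
    then show ?thesis using False by (simp add: w_def h_def)
  qed (simp add: w_def h_def)
  let ?S = "{- int n..int n} - {0}"
  have "bij_betw w ?S ?S"
  proof -
    have gh: "g (h k) = k \<and> h k < 2 * n" if "k \<in> ?S" for k
      using that by (cases "0 < k") (auto simp: g_def h_def)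
    have hg: "h (g i) = i \<and> g i \<in> ?S" if "i < 2 * n" for i
      using that by (cases "i < n") (simp_all add: g_def h_def nat_diff_distrib nat_add_distrib)
    have h: "bij_betw h ?S {..<2 * n}"
      by (rule bij_betw_byWitness[where f' = g]) (use gh hg in \<open>auto simp del: Diff_iff\<close>)
    have nth: "bij_betw ((!) u) {..<2 * n} {..<2 * n}"
      by (rule bij_betw_nth[OF assms(2)]) (simp_all only: assms(1,3))
    have g': "bij_betw g {..<2 * n} ?S"
      by (rule bij_betw_byWitness[where f' = h]) (use gh hg in \<open>auto simp del: Diff_iff\<close>)
    have "bij_betw (\<lambda>k. g (u ! h k)) ?S ?S"
      using bij_betw_trans[OF bij_betw_trans[OF h nth] g'] unfolding comp_def .
    moreover have "bij_betw w ?S ?S = bij_betw (\<lambda>k. g (u ! h k)) ?S ?S"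
      by (rule bij_betw_cong) (rule w_nth)
    ultimately show ?thesis by (simp only:)
  qed
  then have "signed_permutation n w" using wneg by (auto simp: signed_permutation_def)
  moreover have "minus_word n w = map g u"
  proof (rule nth_equalityI)
    show len: "length (minus_word n w) = length (map g u)" using assms(1) by (simp add: minus_word_def)
    fix i assume "i < length (minus_word n w)"
    then have i: "i < 2 * n" using len assms(1) by simp
    show "minus_word n w ! i = map g u ! i"
    proof (cases "i < n")
      case True
      have "minus_word n w ! i = - w (int n - int i)"
        using True by (simp add: minus_word_def nth_append rev_nth)
      also have "\<dots> = w (int i - int n)" using wneg[of "int i - int n"] True by simp
      also have "\<dots> = g (u ! i)" using w_nth[of "int i - int n"] True by (simp add: h_def)
      finally show ?thesis using i assms(1) by simp
    next
      case False
      have "minus_word n w ! i = w (int i - int n + 1)"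
        using False i by (simp add: minus_word_def nth_append algebra_simps)
      also have "\<dots> = g (u ! i)" using False i
        by (simp add: w_def nat_add_distrib nat_diff_distrib)
      finally show ?thesis using i assms(1) by simp
    qed
  qed
  ultimately show ?thesis
    unfolding domino_type_def using rs_shape_strict_mono_map[OF g assms(2)] by metis
qed

lemma alternating_row_sum: "(\<Sum>k<l. (- 1) ^ k) = (if odd l then 1 else 0 :: int)"
  by (induction l) (simp_all add: minus_one_power_iff)

text \<open>A row contributes to the content balance only if its length is odd, with a sign
  alternating from row to row. The indicator of \<open>odd (part p k + (K - k))\<close> is that of
  \<open>odd (K - k)\<close> plus the sign of \<open>K - k\<close> times that of
  \<open>odd (part p k)\<close>; the second terms sum to zero by balance, the first ones to
  \<open>K div 2\<close>.\<close>

lemma odd_last_box_count: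
  assumes "content_balance {(r, k). r < length p \<and> k < p ! r} = 0" "length p \<le> K"
  shows "card {k \<in> {1..K}. odd (part p k + (K - k))} = K div 2"
proof -
  let ?D = "{(r, k). r < length p \<and> k < p ! r}"
  have D: "?D = Sigma {..<length p} (\<lambda>r. {..<p ! r})" by auto
  have "content_balance ?D = (\<Sum>r<length p. \<Sum>k<p ! r. (- 1) ^ (r + k))"
    unfolding content_balance_def D by (subst sum.Sigma) auto
  also have "\<dots> = (\<Sum>r<length p. (- 1) ^ r * (if odd (p ! r) then 1 else 0))"
    by (simp add: power_add sum_distrib_left[symmetric] alternating_row_sum)
  also have "\<dots> = (\<Sum>k\<in>{1..length p}. (- 1) ^ (k - 1) * (if odd (part p k) then 1 else 0))"
    by (rule sum.reindex_bij_witness[of _ "\<lambda>k. k - 1" Suc]) (auto simp: part_def)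
  also have "\<dots> = (\<Sum>k\<in>{1..K}. (- 1) ^ (k - 1) * (if odd (part p k) then 1 else 0))"
    using assms(2) by (intro sum.mono_neutral_left) (auto simp: part_def)
  finally have 0: "(\<Sum>k\<in>{1..K}. (- 1) ^ (k - 1) * (if odd (part p k) then 1 else 0)) = (0::int)"
    using assms(1) by simp
  have "int (card {k \<in> {1..K}. P k}) = (\<Sum>k\<in>{1..K}. if P k then 1 else 0)" for P
    by (simp add: sum.If_cases Int_def)
  then have "int (card {k \<in> {1..K}. odd (part p k + (K - k))}) =
      (\<Sum>k\<in>{1..K}. if odd (part p k + (K - k)) then 1 else 0)" .
  also have "\<dots> = (\<Sum>k\<in>{1..K}. (if odd (K - k) then 1 else 0) +
      (- 1) ^ (K + 1) * ((- 1) ^ (k - 1) * (if odd (part p k) then 1 else 0)))"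
    by (intro sum.cong HOL.refl) (auto simp: minus_one_power_iff)
  also have "\<dots> = (\<Sum>k\<in>{1..K}. if odd (K - k) then 1 else 0)"
    unfolding sum.distrib sum_distrib_left[symmetric] 0 by simp
  also have "\<dots> = (\<Sum>k<K. if odd k then 1 else 0)"
    by (rule sum.reindex_bij_witness[of _ "\<lambda>k. K - k" "\<lambda>k. K - k"]) auto
  also have "\<dots> = int (K div 2)"
    by (induction K) auto
  finally show ?thesis by simp
qed

lemma content_balance_rs_shape:
  assumes "length u = 2 * n" "distinct u" "set u = {..<2 * n}"
    "\<And>i. i < 2 * n \<Longrightarrow> u ! (2 * n - 1 - i) = 2 * n - 1 - u ! i"
  shows "content_balance {(r, k). r < length (rs_shape u) \<and> k < rs_shape u ! r} = 0"
proof -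
  have "content_balance (grow (point_matrix u) (2 * n) (2 * n)) = 0"
  proof (rule content_balance_grow_symmetric[OF partial_inj_point_matrix[OF assms(2)]])
    fix i j assume ij: "i < 2 * n" "j < 2 * n"
    have "u ! i < 2 * n" using nth_mem[of i u] assms(1,3) ij by auto
    then show "point_matrix u (2 * n - 1 - i) (2 * n - 1 - j) \<longleftrightarrow> point_matrix u i j"
      using assms(1) assms(4)[OF ij(1)] ij by (auto simp: point_matrix_def)
  qed
  then show ?thesis using rs_shape_grow[OF assms(2), of "2 * n"] assms(1,3) by simp
qed

lemma lambda_minus_shape:
  fixes n lam
  defines "p \<equiv> rs_shape (lambda_minus n lam)"
  shows "is_partition (2 * n) p" "domino_type n p"
    "\<And>K. length p \<le> K \<Longrightarrow> card {k \<in> {1..K}. odd (part p k + (K - k))} = K div 2"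
proof -
  obtain u :: "nat list" where u: "length u = 2 * n" "distinct u" "set u = {..<2 * n}"
    "\<And>i. i < 2 * n \<Longrightarrow> u ! (2 * n - 1 - i) = 2 * n - 1 - u ! i"
    "rs_shape (lambda_minus n lam) = rs_shape u"
    using standardization[of "lambda_minus n lam" "2 * n"] lambda_minus_symmetric by metis
  show "is_partition (2 * n) p" using rs_shape_partition[OF u(2)] u(1,5) by (simp add: p_def)
  show "domino_type n p" using domino_type_standard[OF u(1-4)] u(5) by (simp add: p_def)
  show "card {k \<in> {1..K}. odd (part p k + (K - k))} = K div 2" if "length p \<le> K" for K
    using odd_last_box_count[OF content_balance_rs_shape[OF u(1-4)]] that u(5) by (simp add: p_def)
qed


section \<open>Partitions given by their parts\<close>

lemma part_antimono:
  assumes "is_partition N d" "1 \<le> i" "i \<le> j"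
  shows "part d j \<le> part d i"
proof (cases "j \<le> length d \<and> i < j")
  case True
  then have "d ! (j - 1) \<le> d ! (i - 1)"
    using assms sorted_wrt_nth_less[of "(\<ge>)" d "i - 1" "j - 1"] by (auto simp: is_partition_def)
  then show ?thesis using True assms(2,3) by (simp add: part_def)
next
  case False
  then show ?thesis using assms(3) by (cases "i = j") (auto simp: part_def)
qed

lemma part_eq_0: "length d < k \<Longrightarrow> part d k = 0"
  by (simp add: part_def)

lemma part_pos: "is_partition N d \<Longrightarrow> 1 \<le> k \<Longrightarrow> k \<le> length d \<Longrightarrow> 0 < part d k"
  by (auto simp: is_partition_def part_def in_set_conv_nth)

lemma part_pos_iff: "is_partition N d \<Longrightarrow> 0 < part d k \<longleftrightarrow> 1 \<le> k \<and> k \<le> length d"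
  using part_pos[of N d k] by (auto simp: part_def)

lemma sum_part: "length d \<le> K \<Longrightarrow> (\<Sum>k\<in>{1..K}. part d k) = sum_list d"
proof -
  assume K: "length d \<le> K"
  have "(\<Sum>k\<in>{1..K}. part d k) = (\<Sum>k\<in>{1..length d}. part d k)"
    using K by (intro sum.mono_neutral_right) (auto simp: part_def)
  also have "\<dots> = (\<Sum>i<length d. d ! i)"
    by (rule sum.reindex_bij_witness[of _ Suc "\<lambda>k. k - 1"]) (auto simp: part_def)
  finally show ?thesis by (simp add: sum_list_sum_nth atLeast0LessThan)
qed

lemma count_list_part:
  assumes "is_partition N d" "length d \<le> K" "0 < a"
  shows "count_list d a = card {k \<in> {1..K}. part d k = a}"
proof -
  have "count_list d a = card {i. i < length d \<and> d ! i = a}"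
    by (simp add: count_list_eq_length_filter length_filter_conv_card eq_commute)
  also have "\<dots> = card {k \<in> {1..K}. part d k = a}"
    by (rule bij_betw_same_card[of Suc], rule bij_betw_byWitness[where f' = "\<lambda>k. k - 1"])
      (use assms in \<open>auto simp: part_def split: if_splits\<close>)
  finally show ?thesis .
qed

lemma partition_eqI:
  assumes "is_partition N d" "is_partition M e" "\<And>k. 1 \<le> k \<Longrightarrow> part d k = part e k"
  shows "d = e"
proof -
  have "1 \<le> k \<Longrightarrow> k \<le> length d \<longleftrightarrow> k \<le> length e" for k
    using part_pos_iff[OF assms(1), of k] part_pos_iff[OF assms(2), of k] assms(3)[of k] by auto
  then have len: "length d = length e"
    by (metis One_nat_def Suc_leI le_antisym le_refl not_gr_zero)
  show ?thesis
  proof (rule nth_equalityI[OF len])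
    fix i assume "i < length d"
    then show "d ! i = e ! i" using assms(3)[of "Suc i"] len by (simp add: part_def)
  qed
qed

definition partition_of :: "(nat \<Rightarrow> nat) \<Rightarrow> nat list" where
  "partition_of g = map g [1..<Suc (LEAST k. g (Suc k) = 0)]"

lemma partition_of:
  assumes anti: "\<And>k. 1 \<le> k \<Longrightarrow> g (Suc k) \<le> g k" and zero: "\<And>k. N < k \<Longrightarrow> g k = 0"
  shows "\<And>k. 1 \<le> k \<Longrightarrow> part (partition_of g) k = g k"
    and "length (partition_of g) \<le> N"
    and "is_partition (\<Sum>k\<in>{1..N}. g k) (partition_of g)"
proof -
  define L where "L = (LEAST k. g (Suc k) = 0)"
  have d: "partition_of g = map g [1..<Suc L]" by (simp add: partition_of_def L_def)
  have L0: "g (Suc L) = 0" unfolding L_def by (rule LeastI[of _ N]) (simp add: zero)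
  have LN: "L \<le> N" unfolding L_def by (rule Least_le) (simp add: zero)
  have pos: "0 < g k" if "1 \<le> k" "k \<le> L" for k
  proof -
    have "k - 1 < (LEAST k. g (Suc k) = 0)" using that by (simp add: L_def)
    from not_less_Least[OF this] that show ?thesis by simp
  qed
  have mono: "g j \<le> g i" if "1 \<le> i" "i \<le> j" for i j
    using that(2) by (induction rule: dec_induct) (use that(1) anti in \<open>auto intro: order_trans\<close>)
  have beyond: "g k = 0" if "L < k" for k using mono[of "Suc L" k] L0 that by simp
  show p: "part (partition_of g) k = g k" if "1 \<le> k" for k
    using that beyond[of k] by (auto simp: part_def d nth_append simp del: upt_Suc)
  show len: "length (partition_of g) \<le> N" using LN by (simp add: d)
  have "sorted_wrt (\<ge>) (partition_of g)"
    unfolding sorted_wrt_iff_nth_less d by (auto simp del: upt_Suc intro: mono)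
  moreover have "0 \<notin> set (partition_of g)"
  proof
    assume "0 \<in> set (partition_of g)"
    then obtain k where "1 \<le> k" "k \<le> L" "g k = 0" by (auto simp: d simp del: upt_Suc)
    then show False using pos by force
  qed
  moreover have "sum_list (partition_of g) = (\<Sum>k\<in>{1..N}. g k)"
    using sum_part[OF len] p by simp
  ultimately show "is_partition (\<Sum>k\<in>{1..N}. g k) (partition_of g)" by (simp add: is_partition_def)
qed

lemma transpose_partition:
  assumes d: "is_partition N d"
  shows "is_partition N (transpose_partition d)"
    and "0 < a \<Longrightarrow> count_list (transpose_partition d) a = part d a - part d (Suc a)"
proof -
  define c where "c l = card {k. 1 \<le> k \<and> k \<le> length d \<and> l \<le> part d k}" for l
  have t: "transpose_partition d = map c [1..<Suc (part d 1)]"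
    by (simp add: transpose_partition_def c_def)
  \<comment> \<open>The Galois connection between row and column lengths; monotonicity, positivity
    and the multiplicities are all read off from it.\<close>
  have c_ge: "a \<le> c l \<longleftrightarrow> l \<le> part d a" if "0 < a" "0 < l" for a l
  proof -
    let ?S = "{k. 1 \<le> k \<and> k \<le> length d \<and> l \<le> part d k}"
    have fin: "finite ?S" by (rule finite_subset[of _ "{1..length d}"]) auto
    show ?thesis
    proof
      assume "l \<le> part d a"
      then have "{1..a} \<subseteq> ?S"
        using part_antimono[OF d, of _ a] part_pos_iff[OF d, of a] that by fastforce
      from card_mono[OF fin this] show "a \<le> c l" by (simp add: c_def)
    next
      assume a: "a \<le> c l"
      show "l \<le> part d a"
      proof (rule ccontr)
        assume n: "\<not> l \<le> part d a"
        have "?S \<subseteq> {1..<a}"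
        proof
          fix k assume k: "k \<in> ?S"
          then have "k < a" using n part_antimono[OF d, of a k] that by (cases "k < a") auto
          then show "k \<in> {1..<a}" using k by simp
        qed
        from card_mono[OF _ this] have "c l \<le> a - 1" by (simp add: c_def)
        then show False using a that by simp
      qed
    qed
  qed
  have anti: "c l' \<le> c l" if "0 < l" "l \<le> l'" for l l'
    using c_ge[of "c l'" l] c_ge[of "c l'" l'] that by (cases "c l' = 0") auto
  have pos: "0 < c l" if "0 < l" "l \<le> part d 1" for l
    using c_ge[of 1 l] that by simp
  show "count_list (transpose_partition d) a = part d a - part d (Suc a)" if a: "0 < a"
  proof -
    have "count_list (transpose_partition d) a = length (filter (\<lambda>l. a = c l) [1..<Suc (part d 1)])"
      unfolding t count_list_eq_length_filter filter_map length_map comp_def ..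
    also have "\<dots> = card {l \<in> {1..<Suc (part d 1)}. c l = a}"
      by (subst distinct_length_filter) (auto intro!: arg_cong[of _ _ card] simp del: upt_Suc)
    also have "{l \<in> {1..<Suc (part d 1)}. c l = a} = {part d (Suc a)<..part d a}"
    proof (intro set_eqI iffI)
      fix l assume "l \<in> {l \<in> {1..<Suc (part d 1)}. c l = a}"
      then show "l \<in> {part d (Suc a)<..part d a}"
        using c_ge[of a l] c_ge[of "Suc a" l] a by auto
    next
      fix l assume l: "l \<in> {part d (Suc a)<..part d a}"
      then have "c l = a" using c_ge[of a l] c_ge[of "Suc a" l] a by auto
      then show "l \<in> {l \<in> {1..<Suc (part d 1)}. c l = a}"
        using l part_antimono[OF d, of 1 a] a by auto
    qed
    finally show ?thesis by simp
  qed
  have "sum_list (transpose_partition d) = (\<Sum>l\<in>{1..part d 1}. c l)"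
    by (simp add: t interv_sum_list_conv_sum_set_nat atLeastLessThanSuc_atLeastAtMost del: upt_Suc)
  also have "\<dots> = (\<Sum>l\<in>{1..part d 1}. \<Sum>k\<in>{1..length d}. if l \<le> part d k then 1 else 0)"
    unfolding c_def by (simp add: sum.If_cases Int_def conj_assoc)
  also have "\<dots> = (\<Sum>k\<in>{1..length d}. \<Sum>l\<in>{1..part d 1}. if l \<le> part d k then 1 else 0)"
    by (rule sum.swap)
  also have "\<dots> = (\<Sum>k\<in>{1..length d}. part d k)"
  proof (rule sum.cong[OF HOL.refl])
    fix k assume "k \<in> {1..length d}"
    then have "part d k \<le> part d 1" using part_antimono[OF d, of 1 k] by simp
    then have "{1..part d 1} \<inter> {l. l \<le> part d k} = {1..part d k}" by auto
    then show "(\<Sum>l\<in>{1..part d 1}. if l \<le> part d k then 1 else 0) = part d k"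
      by (simp add: sum.If_cases)
  qed
  also have "\<dots> = N" using sum_part[of d "length d"] d by (simp add: is_partition_def)
  finally have "sum_list (transpose_partition d) = N" .
  moreover have "sorted_wrt (\<ge>) (transpose_partition d)"
    unfolding sorted_wrt_iff_nth_less t by (auto simp del: upt_Suc intro: anti)
  moreover have "0 \<notin> set (transpose_partition d)"
  proof
    assume "0 \<in> set (transpose_partition d)"
    then have "0 \<in> c ` {1..<Suc (part d 1)}" by (simp add: t del: upt_Suc)
    then obtain l where "l \<in> {1..<Suc (part d 1)}" "c l = 0" by (metis imageE)
    then show False using pos[of l] by simp
  qed
  ultimately show "is_partition N (transpose_partition d)" by (simp add: is_partition_def)
qed


section \<open>The rows produced by the H-algorithm\<close>

text \<open>Unlike \<open>skipped_pair\<close> this is not limited to the rows of \<open>p\<close>: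
  empty rows, given a fictitious last box in column 0, are paired as well. That the last box of the
  second row is kept is automatic, since equal rows end in boxes of opposite parity.\<close>

definition first_row :: "cartan_type \<Rightarrow> nat list \<Rightarrow> nat \<Rightarrow> bool" where
  "first_row X p k \<longleftrightarrow> 1 \<le> k \<and> part p k = part p (Suc k) \<and> \<not> kept_box X (k, part p k)"

definition paired_row :: "cartan_type \<Rightarrow> nat list \<Rightarrow> nat \<Rightarrow> bool" where
  "paired_row X p k \<longleftrightarrow> first_row X p k \<or> (\<exists>j. k = Suc j \<and> first_row X p j)"

definition removed_box :: "cartan_type \<Rightarrow> nat list \<Rightarrow> nat \<Rightarrow> nat" where
  "removed_box X p k = of_bool (\<not> kept_box X (k, part p k))"

definition added_box :: "cartan_type \<Rightarrow> nat \<Rightarrow> nat" where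
  "added_box X k = of_bool (case X of TypeB \<Rightarrow> odd k | _ \<Rightarrow> even k)"

definition alternating :: "(nat \<Rightarrow> nat) \<Rightarrow> bool" where
  "alternating \<tau> \<longleftrightarrow> (\<forall>k. \<tau> k + \<tau> (Suc k) = 1)"

text \<open>Besides \<open>added_box X\<close>, the opposite choice of \<open>\<tau>\<close> is needed: it corresponds to the exchange of
  the rows of a symbol.\<close>

definition h_part :: "cartan_type \<Rightarrow> nat list \<Rightarrow> (nat \<Rightarrow> nat) \<Rightarrow> nat \<Rightarrow> nat" where
  "h_part X p \<tau> k = (if paired_row X p k then part p k else part p k - removed_box X p k + \<tau> k)"

lemma alternating_added_box: "alternating (added_box X)"
  by (cases X) (auto simp: alternating_def added_box_def)

lemma alternatingD: "alternating \<tau> \<Longrightarrow> \<tau> k + \<tau> (Suc k) = 1"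
  by (simp add: alternating_def)

lemma alternating_le: "alternating \<tau> \<Longrightarrow> \<tau> k \<le> 1"
  using alternatingD[of \<tau> k] by simp

lemma kept_box_iff:
  "odd K = (X \<noteq> TypeD) \<Longrightarrow> k \<le> K \<Longrightarrow> kept_box X (k, l) \<longleftrightarrow> even (l + (K - k))"
  by (cases X) (auto simp: kept_box_def even_box_def)

lemma kept_box_Suc: "kept_box X (Suc k, l) \<longleftrightarrow> \<not> kept_box X (k, l)"
    "kept_box X (k, Suc l) \<longleftrightarrow> \<not> kept_box X (k, l)"
  by (cases X; auto simp: kept_box_def even_box_def)+

lemma first_row_Suc: "first_row X p k \<Longrightarrow> \<not> first_row X p (Suc k)"
  by (auto simp: first_row_def kept_box_Suc)

lemma first_row_kept: "first_row X p k \<Longrightarrow> kept_box X (Suc k, part p (Suc k))"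
  by (auto simp: first_row_def kept_box_Suc)

text \<open>An empty row whose fictitious box is not kept forms a pair with the next empty row. So
  the subtraction in \<open>h_part\<close> is never truncated for unpaired rows.\<close>

lemma unpaired_removed_le:
  assumes "is_partition N p" "1 \<le> k" "\<not> paired_row X p k"
  shows "removed_box X p k \<le> part p k"
  using assms part_antimono[OF assms(1), of k "Suc k"]
  by (cases "part p k") (auto simp: removed_box_def paired_row_def first_row_def)

text \<open>Only rows differing by at most one box are critical. If they are equal and unpaired, it
  is the lower one that loses its last box; if they differ by one, both or neither do. In each case
  the alternation of \<open>\<tau>\<close> cannot invert the order.\<close>

lemma h_part_antimono:
  assumes p: "is_partition N p" and \<tau>: "alternating \<tau>" and k: "1 \<le> k"
  shows "h_part X p \<tau> (Suc k) \<le> h_part X p \<tau> k"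
proof -
  let ?a = "part p k" and ?b = "part p (Suc k)"
  have ab: "?b \<le> ?a" using part_antimono[OF p, of k "Suc k"] k by simp
  have eq: "removed_box X p k + removed_box X p (Suc k) = 1" if "?a = ?b"
    using that by (auto simp: removed_box_def kept_box_Suc)
  have suc: "removed_box X p k = removed_box X p (Suc k)" if "?a = Suc ?b"
    using that by (auto simp: removed_box_def kept_box_Suc)
  have le1: "removed_box X p i \<le> 1" for i by (simp add: removed_box_def)
  note t = alternatingD[OF \<tau>, of k]
  consider "first_row X p k" | "\<not> first_row X p k" "paired_row X p k" | "\<not> paired_row X p k" by blast
  then show ?thesis
  proof cases
    case 1
    then show ?thesis by (auto simp: h_part_def paired_row_def first_row_def)
  next
    case 2
    then have o: "removed_box X p k = 0"
      by (auto simp: removed_box_def paired_row_def first_row_kept)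
    show ?thesis
    proof (cases "paired_row X p (Suc k)")
      case False
      then show ?thesis using 2 o ab eq t le1[of "Suc k"] unpaired_removed_le[OF p _ False] unfolding h_part_def by (cases "?a = ?b") auto
    qed (use 2 ab in \<open>simp add: h_part_def\<close>)
  next
    case 3
    note ok = unpaired_removed_le[OF p k 3]
    have "first_row X p k = False" using 3 by (simp add: paired_row_def)
    then have o: "?a = ?b \<Longrightarrow> removed_box X p k = 0" using k by (auto simp: first_row_def removed_box_def)
    show ?thesis
    proof (cases "paired_row X p (Suc k)")
      case True
      then show ?thesis using 3 ab o le1[of k] unfolding h_part_def by (cases "?a = ?b") auto
    next
      case False
      note ok' = unpaired_removed_le[OF p _ False]
      consider "?a = ?b" | "?a = Suc ?b" | "Suc (Suc ?b) \<le> ?a" using ab by linarith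
      then show ?thesis
        using 3 False eq suc o ok ok' t le1[of k] unfolding h_part_def by cases auto
    qed
  qed
qed

section \<open>Beta numbers of the new rows\<close>

definition z_entry :: "nat list \<Rightarrow> nat \<Rightarrow> nat \<Rightarrow> nat" where
  "z_entry p K k = (part p k + (K - k)) div 2"

text \<open>The parity of \<open>K\<close> is chosen by type so that the last box of row
  \<open>k\<close> is removed exactly if \<open>part p k + (K - k)\<close> is odd.\<close>

lemma z_entry:
  assumes "odd K = (X \<noteq> TypeD)" "k \<le> K"
  shows "part p k + (K - k) = 2 * z_entry p K k + removed_box X p k"
  using kept_box_iff[OF assms, of "part p k"] unfolding z_entry_def removed_box_def
  by (cases "kept_box X (k, part p k)") (auto simp: odd_two_times_div_two_succ)

lemma h_part_unpaired:
  assumes "is_partition N p" "odd K = (X \<noteq> TypeD)" "1 \<le> k" "k \<le> K" "\<not> paired_row X p k"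
  shows "h_part X p \<tau> k + (K - k) = 2 * z_entry p K k + \<tau> k"
  using z_entry[OF assms(2,4), of p] unpaired_removed_le[OF assms(1,3,5)] assms(5)
  by (simp add: h_part_def)

text \<open>The two rows of a pair give the numbers \<open>2 * z + 1\<close> and
  \<open>2 * z\<close> with a common \<open>z\<close>, independently of
  \<open>\<tau>\<close>.\<close>

lemma h_part_first:
  assumes "odd K = (X \<noteq> TypeD)" "Suc k \<le> K" "first_row X p k"
  shows "h_part X p \<tau> k + (K - k) = 2 * z_entry p K k + 1"
    and "h_part X p \<tau> (Suc k) + (K - Suc k) = 2 * z_entry p K k"
    and "z_entry p K (Suc k) = z_entry p K k"
proof -
  have h: "h_part X p \<tau> k = part p k" "h_part X p \<tau> (Suc k) = part p k"
    using assms(3) by (auto simp: h_part_def paired_row_def first_row_def)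
  have o: "removed_box X p k = 1" "removed_box X p (Suc k) = 0" "part p (Suc k) = part p k"
    using assms(3) first_row_kept[OF assms(3)] by (auto simp: removed_box_def first_row_def)
  have z: "part p k + (K - k) = 2 * z_entry p K k + 1"
    "part p k + (K - Suc k) = 2 * z_entry p K (Suc k)"
    using z_entry[OF assms(1), of k p] z_entry[OF assms(1,2), of p] assms(2) o by auto
  then show "h_part X p \<tau> k + (K - k) = 2 * z_entry p K k + 1" using h by simp
  show zz: "z_entry p K (Suc k) = z_entry p K k" using z assms(2) by linarith
  show "h_part X p \<tau> (Suc k) + (K - Suc k) = 2 * z_entry p K k" using z h zz by simp
qed

lemma z_entry_Suc:
  assumes "is_partition N p" "odd K = (X \<noteq> TypeD)" "1 \<le> k" "Suc k \<le> K"
  shows "z_entry p K (Suc k) \<le> z_entry p K k"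
    and "z_entry p K (Suc k) = z_entry p K k \<longleftrightarrow> first_row X p k"
proof -
  have ab: "part p (Suc k) \<le> part p k" using part_antimono[OF assms(1,3)] by simp
  then show "z_entry p K (Suc k) \<le> z_entry p K k"
    unfolding z_entry_def by (intro div_le_mono) linarith
  show "z_entry p K (Suc k) = z_entry p K k \<longleftrightarrow> first_row X p k"
  proof
    assume eq: "z_entry p K (Suc k) = z_entry p K k"
    have r: "removed_box X p k \<le> 1" by (simp add: removed_box_def)
    have "part p k + (K - k) = 2 * z_entry p K k + removed_box X p k"
      "part p (Suc k) + (K - Suc k) = 2 * z_entry p K k + removed_box X p (Suc k)"
      using z_entry[OF assms(2), of k p] z_entry[OF assms(2), of "Suc k" p] assms(4) eq by auto
    then have "part p (Suc k) = part p k" "removed_box X p k = 1"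
      using ab r assms(4) by linarith+
    then show "first_row X p k" using assms(3) by (auto simp: first_row_def removed_box_def)
  next
    assume "first_row X p k"
    then show "z_entry p K (Suc k) = z_entry p K k" using h_part_first(3) assms(2,4) by blast
  qed
qed

lemma z_entry_Suc_Suc:
  assumes "is_partition N p" "1 \<le> k" "Suc (Suc k) \<le> K"
  shows "z_entry p K (Suc (Suc k)) < z_entry p K k"
proof -
  have "part p (Suc (Suc k)) + (K - Suc (Suc k)) + 2 \<le> part p k + (K - k)"
    using part_antimono[OF assms(1,2), of "Suc (Suc k)"] assms(3) by simp
  then show ?thesis unfolding z_entry_def by linarith
qed

lemma z_entry_antimono:
  assumes "is_partition N p" "1 \<le> i" "i \<le> j" "j \<le> K"
  shows "z_entry p K j \<le> z_entry p K i"
  using part_antimono[OF assms(1-3)] assms(3,4) unfolding z_entry_def by (intro div_le_mono) linarith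


text \<open>Ensures that no pair straddles the bound \<open>K\<close>: if row \<open>K\<close> had
  the length of the empty row after it, its number would be 0, which is even.\<close>

lemma not_first_row_last:
  assumes "odd K = (X \<noteq> TypeD)" "length p \<le> K"
  shows "\<not> first_row X p K"
proof
  assume "first_row X p K"
  then have "part p K = part p (Suc K)" and k: "\<not> kept_box X (K, part p K)"
    unfolding first_row_def by blast+
  then have "part p K = 0" using part_eq_0[of p "Suc K"] assms(2) by simp
  from k[unfolded this] show False using kept_box_iff[OF assms(1), of K 0] by simp
qed

lemma inj_on_z_entry:
  assumes "is_partition N p" "odd K = (X \<noteq> TypeD)" "alternating \<tau>"
  shows "inj_on (\<lambda>k. 2 * z_entry p K k + \<tau> k) {1..K}"
proof (rule linorder_inj_onI')
  fix i j assume ij: "i \<in> {1..K}" "j \<in> {1..K}" "i < j"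
  show "2 * z_entry p K i + \<tau> i \<noteq> 2 * z_entry p K j + \<tau> j"
  proof (cases "z_entry p K j < z_entry p K i")
    case True
    then show ?thesis using alternating_le[OF assms(3), of j] by linarith
  next
    case False
    have "j = Suc i"
    proof (rule ccontr)
      assume "j \<noteq> Suc i"
      then have "z_entry p K j < z_entry p K i"
        using z_entry_antimono[OF assms(1), of "Suc (Suc i)" j K] z_entry_Suc_Suc[OF assms(1), of i K] ij
        by simp
      then show False using False by simp
    qed
    then have "z_entry p K j = z_entry p K i" using z_entry_antimono[OF assms(1), of i j K] ij False by simp
    then show ?thesis using alternatingD[OF assms(3), of i] unfolding \<open>j = Suc i\<close> by presburger
  qed
qed

lemma inj_on_beta:
  assumes "\<And>k. 1 \<le> k \<Longrightarrow> g (Suc k) \<le> g k"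
  shows "inj_on (\<lambda>k. g k + (K - k)) {1..K :: nat}" and "k \<in> {1..K} \<Longrightarrow> j \<in> {1..K} \<Longrightarrow> k < j \<Longrightarrow> g j + (K - j) < g k + (K - k)"
proof -
  have mono: "g j \<le> g i" if "1 \<le> i" "i \<le> j" for i j
    using that(2) by (induction rule: dec_induct) (use that(1) assms in \<open>auto intro: order_trans\<close>)
  have less: "g j + (K - j) < g k + (K - k)" if "k \<in> {1..K}" "j \<in> {1..K}" "k < j" for k j
  proof -
    have "g j \<le> g k" "K - j < K - k" using mono[of k j] that by auto
    then show ?thesis by simp
  qed
  then show "k \<in> {1..K} \<Longrightarrow> j \<in> {1..K} \<Longrightarrow> k < j \<Longrightarrow> g j + (K - j) < g k + (K - k)" by blast
  show "inj_on (\<lambda>k. g k + (K - k)) {1..K}"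
    by (rule linorder_inj_onI') (use less in force)
qed

lemma inj_on_h_part_beta:
  assumes "is_partition N p" "alternating \<tau>"
  shows "inj_on (\<lambda>k. h_part X p \<tau> k + (K - k)) {1..K}"
  by (rule inj_on_beta(1)) (rule h_part_antimono[OF assms])

text \<open>An unpaired row matches index by index. In a pair, \<open>\<tau>\<close> takes both
  values 0 and 1, so the same two numbers occur on both sides, possibly in the other order. Both
  families are injective, so one inclusion suffices.\<close>

lemma beta_set_h_part:
  assumes p: "is_partition N p" and K: "odd K = (X \<noteq> TypeD)" "length p \<le> K" and \<tau>: "alternating \<tau>"
  shows "(\<lambda>k. h_part X p \<tau> k + (K - k)) ` {1..K} = (\<lambda>k. 2 * z_entry p K k + \<tau> k) ` {1..K}"
proof (rule card_subset_eq)
  show "(\<lambda>k. h_part X p \<tau> k + (K - k)) ` {1..K} \<subseteq> (\<lambda>k. 2 * z_entry p K k + \<tau> k) ` {1..K}"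
  proof (rule image_subsetI)
    fix k assume k: "k \<in> {1..K}"
    consider "\<not> paired_row X p k" | "first_row X p k" | j where "k = Suc j" "first_row X p j"
      by (auto simp: paired_row_def)
    then have "\<exists>i\<in>{1..K}. h_part X p \<tau> k + (K - k) = 2 * z_entry p K i + \<tau> i"
    proof cases
      case 1
      then show ?thesis using h_part_unpaired[OF p K(1)] k by auto
    next
      case 2
      then have "k \<noteq> K" using not_first_row_last[OF K] by auto
      then have kK: "Suc k \<le> K" using k by simp
      note h = h_part_first(1,2)[OF K(1) kK 2, of \<tau>] h_part_first(3)[OF K(1) kK 2]
      show ?thesis
      proof (cases "\<tau> k = 1")
        case True
        then show ?thesis using h(1) k by (intro bexI[of _ k]) auto
      next
        case False
        then have "\<tau> (Suc k) = 1" using alternatingD[OF \<tau>, of k] by simp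
        then show ?thesis using h(1,3) kK by (intro bexI[of _ "Suc k"]) auto
      qed
    next
      case (3 j)
      then have kK: "Suc j \<le> K" "1 \<le> j" using k by (auto simp: first_row_def)
      note h = h_part_first(1,2)[OF K(1) kK(1) 3(2), of \<tau>] h_part_first(3)[OF K(1) kK(1) 3(2)]
      show ?thesis
      proof (cases "\<tau> k = 0")
        case True
        then show ?thesis using h(2,3) k 3(1) by (intro bexI[of _ k]) auto
      next
        case False
        then have "\<tau> j = 0" using alternatingD[OF \<tau>, of j] 3(1) by simp
        then show ?thesis using h(2) 3(1) kK by (intro bexI[of _ j]) auto
      qed
    qed
    then show "h_part X p \<tau> k + (K - k) \<in> (\<lambda>k. 2 * z_entry p K k + \<tau> k) ` {1..K}" by auto
  qed
  show "card ((\<lambda>k. h_part X p \<tau> k + (K - k)) ` {1..K}) = card ((\<lambda>k. 2 * z_entry p K k + \<tau> k) ` {1..K})"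
    using card_image[OF inj_on_h_part_beta[OF p \<tau>, of X K]] card_image[OF inj_on_z_entry[OF p K(1) \<tau>]]
    by simp
qed simp

text \<open>Summing the numbers belonging to \<open>h_part\<close> and to \<open>p\<close> gives
  twice the sum of the \<open>z_entry\<close> values in both cases, plus the sum of
  \<open>\<tau>\<close> and the count of odd numbers respectively.\<close>

lemma sum_h_part:
  assumes p: "is_partition N p" and K: "odd K = (X \<noteq> TypeD)" "length p \<le> K" and \<tau>: "alternating \<tau>"
  shows "(\<Sum>k\<in>{1..K}. h_part X p \<tau> k) + card {k \<in> {1..K}. odd (part p k + (K - k))} =
    N + (\<Sum>k\<in>{1..K}. \<tau> k)"
proof -
  have "(\<Sum>k\<in>{1..K}. h_part X p \<tau> k + (K - k)) = sum id ((\<lambda>k. h_part X p \<tau> k + (K - k)) ` {1..K})"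
    by (subst sum.reindex[OF inj_on_h_part_beta[OF p \<tau>]]) (simp only: comp_def id_def)
  also have "\<dots> = (\<Sum>k\<in>{1..K}. 2 * z_entry p K k + \<tau> k)"
    unfolding beta_set_h_part[OF p K \<tau>] 
    by (subst sum.reindex[OF inj_on_z_entry[OF p K(1) \<tau>]]) (simp only: comp_def id_def)
  finally have "(\<Sum>k\<in>{1..K}. h_part X p \<tau> k) + (\<Sum>k\<in>{1..K}. K - k) =
      (\<Sum>k\<in>{1..K}. 2 * z_entry p K k) + (\<Sum>k\<in>{1..K}. \<tau> k)"
    by (simp only: sum.distrib)
  moreover have "(\<Sum>k\<in>{1..K}. part p k + (K - k)) = (\<Sum>k\<in>{1..K}. 2 * z_entry p K k + removed_box X p k)"
    using z_entry[OF K(1), of _ p] by (intro sum.cong HOL.refl) simp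
  then have "N + (\<Sum>k\<in>{1..K}. K - k) = (\<Sum>k\<in>{1..K}. 2 * z_entry p K k) + (\<Sum>k\<in>{1..K}. removed_box X p k)"
    using sum_part[OF K(2)] p by (simp only: sum.distrib is_partition_def)
  moreover have "(\<Sum>k\<in>{1..K}. removed_box X p k) = card {k \<in> {1..K}. odd (part p k + (K - k))}"
  proof -
    have "(\<Sum>k\<in>{1..K}. removed_box X p k) = (\<Sum>k\<in>{1..K}. of_bool (odd (part p k + (K - k))))"
      using kept_box_iff[OF K(1)] by (intro sum.cong HOL.refl) (auto simp: removed_box_def)
    also have "(\<Sum>k\<in>{1..K}. of_bool (P k)) = card {k \<in> {1..K}. P k}" for P
      by (simp add: Int_def)
    finally show ?thesis .
  qed
  ultimately show ?thesis by simp
qed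

lemma sum_added_box:
  "odd K = (X \<noteq> TypeD) \<Longrightarrow> (\<Sum>k\<in>{1..K}. added_box X k) = (if X = TypeB then Suc (K div 2) else K div 2)"
proof -
  have even: "(\<Sum>k\<in>{1..K}. of_bool (even k)) = K div 2" for K :: nat
    by (induction K) (auto simp del: sum_of_bool_eq)
  have "(\<Sum>k\<in>{1..K}. of_bool (odd k)) = Suc K div 2" for K :: nat
    by (induction K) (auto simp del: sum_of_bool_eq)
  note odd = this
  assume "odd K = (X \<noteq> TypeD)"
  then show ?thesis
    unfolding added_box_def using even[of K] odd[of K] by (cases X) (auto simp del: sum_of_bool_eq)
qed

text \<open>In consecutive rows, kept boxes lie in columns of opposite parity, and only every second
  row is extended. The two alternations cancel, so all unpaired rows get the same parity, the one
  whose multiplicity type \<open>X\<close> does not restrict.\<close>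

lemma h_part_parity:
  assumes "is_partition N p" "1 \<le> k" "\<not> paired_row X p k"
  shows "odd (h_part X p (added_box X) k) \<longleftrightarrow> X \<noteq> TypeC"
proof -
  have "h_part X p (added_box X) k + removed_box X p k = part p k + added_box X k"
    using unpaired_removed_le[OF assms] assms(3) by (simp add: h_part_def)
  then have "odd (h_part X p (added_box X) k) \<longleftrightarrow>
      odd (part p k + added_box X k + removed_box X p k)"
    by (metis even_add)
  then show ?thesis
    by (cases X) (auto simp: removed_box_def added_box_def kept_box_def even_box_def)
qed

lemma h_part_pair:
  assumes "first_row X p k"
  shows "h_part X p \<tau> k = part p k" and "h_part X p \<tau> (Suc k) = part p k"
proof -
  have "paired_row X p k" "paired_row X p (Suc k)" using assms by (auto simp: paired_row_def)
  moreover have "part p (Suc k) = part p k" using assms unfolding first_row_def by metis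
  ultimately show "h_part X p \<tau> k = part p k" "h_part X p \<tau> (Suc k) = part p k"
    by (simp_all add: h_part_def)
qed

lemma first_row_parity:
  assumes "first_row X p k"
  shows "odd (part p k) \<longleftrightarrow> (X \<noteq> TypeC) = (added_box X k = 1)"
  using assms unfolding first_row_def
  by (cases X) (auto simp: added_box_def kept_box_def even_box_def)

section \<open>The output of the algorithm as a special partition\<close>

locale balanced_partition =
  fixes X :: cartan_type and n :: nat and p :: "nat list"
  assumes partition: "is_partition (2 * n) p"
    and balance: "\<And>K. length p \<le> K \<Longrightarrow> card {k \<in> {1..K}. odd (part p k + (K - k))} = K div 2"
    and rank: "1 \<le> n"
begin

abbreviation h :: "nat \<Rightarrow> nat" where
  "h \<equiv> h_part X p (added_box X)"

definition H_partition :: "nat list" where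
  "H_partition = partition_of h"

lemma h_antimono: "1 \<le> k \<Longrightarrow> h (Suc k) \<le> h k"
  by (rule h_part_antimono[OF partition alternating_added_box])

lemma sum_h: "odd K = (X \<noteq> TypeD) \<Longrightarrow> length p \<le> K \<Longrightarrow> (\<Sum>k\<in>{1..K}. h k) = partition_size X n"
proof -
  assume K: "odd K = (X \<noteq> TypeD)" "length p \<le> K"
  have "(\<Sum>k\<in>{1..K}. h k) + K div 2 = 2 * n + (if X = TypeB then Suc (K div 2) else K div 2)"
    using sum_h_part[OF partition K alternating_added_box[of X]]
    unfolding balance[OF K(2)] sum_added_box[OF K(1)] .
  then show ?thesis by (cases X) (simp_all add: partition_size_def)
qed

lemma first_row_beyond:
  assumes "length p < k"
  shows "first_row X p k \<longleftrightarrow> \<not> kept_box X (k, 0)"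
  using assms by (auto simp: first_row_def part_eq_0)

text \<open>Empty rows are paired from \<open>Suc (length p)\<close> or the row after it onwards.
  Only row \<open>Suc (length p)\<close> can stay unpaired, and by \<open>h_Suc_length\<close> it
  then holds the box that types \<open>B\<close> and \<open>D\<close> add in the end.\<close>

lemma h_beyond: "Suc (length p) < k \<Longrightarrow> h k = 0"
proof -
  assume k: "Suc (length p) < k"
  have "paired_row X p k"
  proof (cases "kept_box X (k, 0)")
    case True
    then have "first_row X p (k - 1)"
      using first_row_beyond[of "k - 1"] kept_box_Suc(1)[of X "k - 1" 0] k by simp
    then show ?thesis using k unfolding paired_row_def by (intro disjI2 exI[of _ "k - 1"]) auto
  qed (use first_row_beyond[of k] k in \<open>simp add: paired_row_def\<close>)
  then show ?thesis using k by (simp add: h_part_def part_eq_0)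
qed

lemma h_Suc_length:
  "h (Suc (length p)) = (if kept_box X (Suc (length p), 0) then added_box X (Suc (length p)) else 0)"
proof -
  have "\<not> first_row X p (length p)"
    using part_pos[OF partition, of "length p"] by (auto simp: first_row_def part_eq_0)
  then show ?thesis
    using first_row_beyond[of "Suc (length p)"]
    by (auto simp: h_part_def paired_row_def part_eq_0 removed_box_def)
qed

lemma part_H_partition: "1 \<le> k \<Longrightarrow> part H_partition k = h k"
  and length_H_partition: "length H_partition \<le> Suc (length p)"
  and H_partition_partition: "is_partition (partition_size X n) H_partition"
proof -
  have z: "h k = 0" if "Suc (length p) < k" for k using h_beyond that by simp
  note q = partition_of[of h "Suc (length p)", OF h_antimono z]
  show "1 \<le> k \<Longrightarrow> part H_partition k = h k" unfolding H_partition_def using q(1) by blast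
  show "length H_partition \<le> Suc (length p)" unfolding H_partition_def using q(2) by blast
  \<comment> \<open>The smallest bound of the required parity that includes the possible extra
    row.\<close>
  define K where "K = (if odd (Suc (length p)) = (X \<noteq> TypeD) then Suc (length p) else Suc (Suc (length p)))"
  have K: "odd K = (X \<noteq> TypeD)" "Suc (length p) \<le> K" by (auto simp: K_def)
  have "(\<Sum>k\<in>{1..Suc (length p)}. h k) = (\<Sum>k\<in>{1..K}. h k)"
    using K(2) z by (intro sum.mono_neutral_left) auto
  also have "\<dots> = partition_size X n" by (rule sum_h) (use K in auto)
  finally show "is_partition (partition_size X n) H_partition"
    unfolding H_partition_def using q(3) by (simp only:)
qed

text \<open>Unpaired rows have the unrestricted parity by \<open>h_part_parity\<close>, so a part of
  the other parity occurs only in pairs of consecutive rows.\<close>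

lemma type_partition_H: "type_partition X n H_partition"
  unfolding type_partition_def
proof (intro conjI allI impI H_partition_partition)
  fix a :: nat assume a: "case X of TypeC \<Rightarrow> odd a | _ \<Rightarrow> even a"
  show "even (count_list H_partition a)"
  proof (cases "a = 0")
    case True
    then show ?thesis using H_partition_partition by (simp add: is_partition_def count_list_0_iff)
  next
    case False
    let ?K = "Suc (length p)"
    let ?F = "{k \<in> {1..length p}. first_row X p k \<and> part p k = a}"
    have first: "first_row X p k \<Longrightarrow> part p k = a \<Longrightarrow> Suc k \<le> length p" for k
      using False part_pos_iff[OF partition, of "Suc k"] by (simp add: first_row_def)
    have "count_list H_partition a = card {k \<in> {1..?K}. part H_partition k = a}"
      by (rule count_list_part[OF H_partition_partition length_H_partition]) (use False in simp)
    also have "{k \<in> {1..?K}. part H_partition k = a} = ?F \<union> Suc ` ?F"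
    proof (intro set_eqI iffI)
      fix k assume "k \<in> {k \<in> {1..?K}. part H_partition k = a}"
      then have k: "1 \<le> k" "h k = a" by (auto simp: part_H_partition)
      have "paired_row X p k"
        using h_part_parity[OF partition k(1), of X] a k(2) by (cases X) auto
      then show "k \<in> ?F \<union> Suc ` ?F"
        using k first[of k] first[of "k - 1"] by (auto simp: h_part_def paired_row_def first_row_def image_iff)
    next
      fix k assume k: "k \<in> ?F \<union> Suc ` ?F"
      then have "paired_row X p k" "part p k = a" by (auto simp: paired_row_def first_row_def)
      then show "k \<in> {k \<in> {1..?K}. part H_partition k = a}"
        using k by (auto simp: part_H_partition h_part_def)
    qed
    also have "card (?F \<union> Suc ` ?F) = card ?F + card (Suc ` ?F)"
      using first_row_Suc[of X p] by (intro card_Un_disjoint) auto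
    also have "card (Suc ` ?F) = card ?F" by (rule card_image) simp
    finally show ?thesis by simp
  qed
qed

lemma special_partition_H: "special_partition X n H_partition"
proof -
  define Y where "Y = (case X of TypeB \<Rightarrow> TypeB | TypeC \<Rightarrow> TypeC | TypeD \<Rightarrow> TypeC)"
  have size: "partition_size Y n = partition_size X n"
    unfolding Y_def by (cases X) (auto simp: partition_size_def)
  have tp: "is_partition (partition_size Y n) (transpose_partition H_partition)"
    unfolding size by (rule transpose_partition(1)[OF H_partition_partition])
  have "even (count_list (transpose_partition H_partition) a)"
    if a: "case Y of TypeC \<Rightarrow> odd a | _ \<Rightarrow> even a" for a
  proof (cases "a = 0")
    case True
    then show ?thesis using tp by (simp add: is_partition_def count_list_0_iff)
  next
    case False
    \<comment> \<open>The multiplicity of \<open>a\<close> in the transpose is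
      \<open>h a - h (Suc a)\<close>. For the restricted parity of \<open>a\<close>, row
      \<open>a\<close> is of the kind not extended and row \<open>Suc a\<close> of the kind
      extended; unless these two rows form a pair, the position of any pair they belong to forces
      the same parity as in unpaired rows.\<close>
    have t: "added_box X a = 0" "added_box X (Suc a) = 1" using a unfolding Y_def by (cases X; simp add: added_box_def)+
    have le: "h (Suc a) \<le> h a" using h_antimono False by simp
    have "even (h a - h (Suc a))"
    proof (cases "first_row X p a")
      case True
      then show ?thesis by (simp add: h_part_pair)
    next
      case nf: False
      have "odd (h a) \<longleftrightarrow> X \<noteq> TypeC"
      proof (cases "paired_row X p a")
        case True
        then obtain j where j: "a = Suc j" "first_row X p j" using nf by (auto simp: paired_row_def)
        then have "added_box X j = 1" using alternatingD[OF alternating_added_box, of X j] t(1) by simp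
        then show ?thesis using first_row_parity[OF j(2)] h_part_pair(2)[OF j(2)] j(1) by simp
      qed (use h_part_parity[OF partition] False in simp)
      moreover have "odd (h (Suc a)) \<longleftrightarrow> X \<noteq> TypeC"
      proof (cases "paired_row X p (Suc a)")
        case True
        then have "first_row X p (Suc a)" using nf by (auto simp: paired_row_def)
        then show ?thesis using first_row_parity h_part_pair(1) t(2) by simp
      qed (use h_part_parity[OF partition] in simp)
      ultimately show ?thesis using le by simp
    qed
    then show ?thesis
      using transpose_partition(2)[OF H_partition_partition, of a] False by (simp add: part_H_partition)
  qed
  with tp have "type_partition Y n (transpose_partition H_partition)"
    unfolding type_partition_def by blast
  then show ?thesis unfolding special_partition_def Y_def by (rule conjI[OF type_partition_H])
qed

end


section \<open>The H-algorithm\<close>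

lemma fill_holes_eqI:
  assumes "young_diagram D" "A \<subseteq> D" "\<And>k l. (k, l) \<in> D \<Longrightarrow> \<exists>k' l'. (k', l') \<in> A \<and> k \<le> k' \<and> l \<le> l'"
  shows "fill_holes A = D"
proof
  show "fill_holes A \<subseteq> D" using assms(1,2) unfolding fill_holes_def by blast
  show "D \<subseteq> fill_holes A"
  proof (rule subrelI)
    fix k l assume kl: "(k, l) \<in> D"
    then have pos: "1 \<le> k" "1 \<le> l" using assms(1) unfolding young_diagram_def by auto
    obtain k' l' where A: "(k', l') \<in> A" "k \<le> k'" "l \<le> l'" using assms(3)[OF kl] by blast
    show "(k, l) \<in> fill_holes A"
      unfolding fill_holes_def
    proof (rule InterI)
      fix E assume "E \<in> {D. young_diagram D \<and> A \<subseteq> D}"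
      then have E: "young_diagram E" "(k', l') \<in> E" using A(1) by auto
      then have "\<forall>i j. 1 \<le> i \<and> i \<le> k' \<and> 1 \<le> j \<and> j \<le> l' \<longrightarrow> (i, j) \<in> E"
        unfolding young_diagram_def by blast
      then show "(k, l) \<in> E" using pos A by blast
    qed
  qed
qed

lemma young_diagram_rows:
  assumes "\<And>k. 1 \<le> k \<Longrightarrow> g (Suc k) \<le> g k"
  shows "young_diagram {(k, l). 1 \<le> k \<and> k \<le> m \<and> 1 \<le> l \<and> l \<le> g k}"
proof -
  have mono: "g j \<le> g i" if "1 \<le> i" "i \<le> j" for i j
    using that(2) by (induction rule: dec_induct) (use that(1) assms in \<open>auto intro: order_trans\<close>)
  have "{(k, l). 1 \<le> k \<and> k \<le> m \<and> 1 \<le> l \<and> l \<le> g k} = Sigma {1..m} (\<lambda>k. {1..g k})" by auto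
  then have "finite {(k, l). 1 \<le> k \<and> k \<le> m \<and> 1 \<le> l \<and> l \<le> g k}" by simp
  moreover have "j \<le> g i" if "1 \<le> i" "i \<le> k" "j \<le> l" "l \<le> g k" for i j k l
    using mono[OF that(1,2)] that by simp
  ultimately show ?thesis unfolding young_diagram_def by fastforce
qed

lemma card_rows:
  fixes g :: "nat \<Rightarrow> nat"
  shows "card {(k, l). 1 \<le> k \<and> k \<le> m \<and> 1 \<le> l \<and> l \<le> g k} = (\<Sum>k\<in>{1..m}. g k)"
proof -
  have eq: "{(k, l). 1 \<le> k \<and> k \<le> m \<and> 1 \<le> l \<and> l \<le> g k} = Sigma {1..m} (\<lambda>k. {1..g k})" by auto
  show ?thesis unfolding eq by (subst card_SigmaI) auto
qed

context balanced_partition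
begin

lemma skipped_pair_iff: "i \<le> length p \<Longrightarrow> skipped_pair X p i \<longleftrightarrow> first_row X p i"
proof -
  assume i: "i \<le> length p"
  have "first_row X p i \<Longrightarrow> Suc i \<le> length p"
    using part_pos_iff[OF partition, of i] part_pos_iff[OF partition, of "Suc i"] i
    by (simp add: first_row_def)
  then show ?thesis
    using first_row_kept[of X p i] by (auto simp: skipped_pair_def first_row_def)
qed

lemma labeled_rows_iff: "i \<in> labeled_rows X p \<longleftrightarrow> 1 \<le> i \<and> i \<le> length p \<and> \<not> paired_row X p i"
proof -
  have "(\<exists>j. i = j + 1 \<and> skipped_pair X p j) \<longleftrightarrow> (\<exists>j. i = Suc j \<and> first_row X p j)" if "i \<le> length p"
    using skipped_pair_iff that by (metis Suc_eq_plus1 Suc_leD)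
  then show ?thesis
    unfolding labeled_rows_def paired_row_def using skipped_pair_iff by auto
qed

lemma row_label_parity:
  assumes "i \<in> labeled_rows X p"
  shows "odd (row_label X p i) \<longleftrightarrow> odd i"
proof -
  let ?L = "{j \<in> labeled_rows X p. j \<le> i}"
  let ?F = "{j \<in> {1..i}. first_row X p j}"
  have i: "i \<le> length p" "\<not> paired_row X p i" using assms by (auto simp: labeled_rows_iff)
  have F: "Suc j \<le> i" if "j \<in> ?F" for j
    using that i(2) by (cases "j = i") (auto simp: paired_row_def)
  have "{1..i} = ?L \<union> (?F \<union> Suc ` ?F)"
  proof (intro set_eqI iffI)
    fix j assume "j \<in> {1..i}"
    then show "j \<in> ?L \<union> (?F \<union> Suc ` ?F)"
      using i(1) by (auto simp: labeled_rows_iff paired_row_def first_row_def)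
  next
    fix j assume "j \<in> ?L \<union> (?F \<union> Suc ` ?F)"
    then show "j \<in> {1..i}" using F by (auto simp: labeled_rows_iff)
  qed
  moreover have "?L \<inter> (?F \<union> Suc ` ?F) = {}"
    by (auto simp: labeled_rows_iff paired_row_def)
  moreover have "finite ?L" by (rule finite_subset[of _ "{..i}"]) auto
  ultimately have "card {1..i} = card ?L + card (?F \<union> Suc ` ?F)"
    by (metis (no_types, lifting) card_Un_disjoint finite_Un finite_atLeastAtMost)
  moreover have "card (?F \<union> Suc ` ?F) = card ?F + card (Suc ` ?F)"
    using first_row_Suc[of X p] by (intro card_Un_disjoint) auto
  moreover have "card (Suc ` ?F) = card ?F" by (rule card_image) simp
  ultimately have "i = row_label X p i + 2 * card ?F"
    by (simp add: row_label_def)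
  then show ?thesis by presburger
qed

lemma extended_rows_iff:
  "i \<in> extended_rows X p \<longleftrightarrow> i \<in> labeled_rows X p \<and> added_box X i = 1"
  unfolding extended_rows_def added_box_def
  using row_label_parity by (cases X) auto

lemma row_end_kept_boxes:
  assumes "1 \<le> i" "i \<le> length p"
  shows "row_end (kept_boxes X p) i = (i, part p i - removed_box X p i + 1)"
proof -
  let ?S = "insert 0 {l. (i, l) \<in> kept_boxes X p}"
  have S: "{l. (i, l) \<in> kept_boxes X p} = {l. 1 \<le> l \<and> l \<le> part p i \<and> kept_box X (i, l)}"
    using assms by (auto simp: kept_boxes_def diagram_def)
  have fin: "finite ?S" unfolding S by (rule finite_subset[of _ "{..part p i}"]) auto
  have pos: "0 < part p i" using part_pos[OF partition] assms by simp
  have "Max ?S = part p i - removed_box X p i"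
  proof (rule Max_eqI[OF fin])
    fix y assume "y \<in> ?S"
    then show "y \<le> part p i - removed_box X p i"
      unfolding S removed_box_def by (cases "y = part p i") auto
  next
    show "part p i - removed_box X p i \<in> ?S"
    proof (cases "kept_box X (i, part p i)")
      case True
      then show ?thesis unfolding S removed_box_def using pos by simp
    next
      case False
      then have "kept_box X (i, part p i - 1)"
        using kept_box_Suc(2)[of X i "part p i - 1"] pos by simp
      then show ?thesis unfolding S removed_box_def using pos by auto
    qed
  qed
  then show ?thesis by (simp add: row_end_def)
qed

lemma fill_holes_kept_boxes:
  "fill_holes (kept_boxes X p \<union> row_end (kept_boxes X p) ` extended_rows X p) =
    {(k, l). 1 \<le> k \<and> k \<le> length p \<and> 1 \<le> l \<and> l \<le> h k}"
proof (rule fill_holes_eqI)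
  let ?A = "kept_boxes X p" and ?E = "row_end (kept_boxes X p) ` extended_rows X p"
  let ?D = "{(k, l). 1 \<le> k \<and> k \<le> length p \<and> 1 \<le> l \<and> l \<le> h k}"
  show "young_diagram ?D" by (rule young_diagram_rows) (rule h_antimono)
  show "?A \<union> ?E \<subseteq> ?D"
  proof (rule Un_least)
    show "?A \<subseteq> ?D"
    proof (rule subrelI)
      fix k l assume "(k, l) \<in> ?A"
      then have kl: "1 \<le> k" "k \<le> length p" "1 \<le> l" "l \<le> part p k" "kept_box X (k, l)"
        by (auto simp: kept_boxes_def diagram_def)
      then have "l \<le> part p k - removed_box X p k"
        by (cases "l = part p k") (auto simp: removed_box_def)
      then have "l \<le> h k" using kl by (cases "paired_row X p k") (simp_all add: h_part_def)
      then show "(k, l) \<in> ?D" using kl by simp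
    qed
    show "?E \<subseteq> ?D"
    proof (rule image_subsetI)
      fix i assume "i \<in> extended_rows X p"
      then have "1 \<le> i" "i \<le> length p" "\<not> paired_row X p i" "added_box X i = 1"
        by (auto simp: extended_rows_iff labeled_rows_iff)
      then show "row_end ?A i \<in> ?D" by (simp add: row_end_kept_boxes h_part_def)
    qed
  qed
  fix k l assume "(k, l) \<in> ?D"
  then have kl: "1 \<le> k" "k \<le> length p" "1 \<le> l" "l \<le> h k" by auto
  have pos: "0 < part p k" using part_pos[OF partition] kl by simp
  consider "first_row X p k" | "paired_row X p k" "\<not> first_row X p k" | "\<not> paired_row X p k" by blast
  then show "\<exists>k' l'. (k', l') \<in> ?A \<union> ?E \<and> k \<le> k' \<and> l \<le> l'"
  proof cases
    \<comment> \<open>The last box of the first row of a pair is removed, but filling the holes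
      restores it, because the box directly below is kept.\<close>
    case 1
    then have eq: "part p (Suc k) = part p k" and hk: "h k = part p k"
      by (simp_all add: first_row_def h_part_pair[OF 1])
    then have "Suc k \<le> length p" using part_pos_iff[OF partition, of "Suc k"] pos by simp
    then have "(Suc k, part p k) \<in> ?A"
      using first_row_kept[OF 1] eq pos by (simp add: kept_boxes_def diagram_def)
    then show ?thesis using kl hk by (intro exI[of _ "Suc k"] exI[of _ "part p k"]) auto
  next
    case 2
    then obtain j where "k = Suc j" "first_row X p j" by (auto simp: paired_row_def)
    then have "(k, part p k) \<in> ?A"
      using first_row_kept[of X p j] kl pos by (simp add: kept_boxes_def diagram_def)
    moreover have "h k = part p k" using 2 by (simp add: h_part_def)
    ultimately show ?thesis using kl by (intro exI[of _ k] exI[of _ "part p k"]) auto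
  next
    case 3
    show ?thesis
    proof (cases "added_box X k = 1")
      case True
      then have "k \<in> extended_rows X p" using 3 kl by (simp add: extended_rows_iff labeled_rows_iff)
      then have "row_end ?A k \<in> ?E" by (rule imageI)
      moreover have "row_end ?A k = (k, h k)"
        using 3 True kl by (simp add: row_end_kept_boxes h_part_def)
      ultimately show ?thesis using kl by (intro exI[of _ k] exI[of _ "h k"]) auto
    next
      case False
      then have hk: "h k = part p k - removed_box X p k"
        using 3 alternating_le[OF alternating_added_box, of X k] by (simp add: h_part_def)
      have "kept_box X (k, h k)"
        using hk kept_box_Suc(2)[of X k "part p k - 1"] pos
        by (cases "kept_box X (k, part p k)") (auto simp: removed_box_def)
      then have "(k, h k) \<in> ?A"
        using hk kl by (simp add: kept_boxes_def diagram_def)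
      then show ?thesis using kl by (intro exI[of _ k] exI[of _ "h k"]) auto
    qed
  qed
qed

lemma H_algorithm: "H_algorithm X n p = diagram H_partition"
proof -
  let ?D = "{(k, l). 1 \<le> k \<and> k \<le> length p \<and> 1 \<le> l \<and> l \<le> h k}"
  let ?m = "Suc (length p)"
  have diag: "diagram H_partition = {(k, l). 1 \<le> k \<and> 1 \<le> l \<and> l \<le> h k}"
  proof -
    have "k \<le> length H_partition" if "1 \<le> k" "1 \<le> l" "l \<le> h k" for k l
      using that part_H_partition[of k] part_pos_iff[OF H_partition_partition, of k] by simp
    then show ?thesis using part_H_partition by (auto simp: diagram_def)
  qed
  have split: "{(k, l). 1 \<le> k \<and> 1 \<le> l \<and> l \<le> h k} = ?D \<union> {?m} \<times> {1..h ?m}"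
  proof -
    have "h k = 0" if "?m < k" for k using h_beyond that by simp
    then have le: "k \<le> ?m" if "1 \<le> l" "l \<le> h k" for k l using that by (cases "?m < k") auto
    show ?thesis
    proof (rule set_eqI)
      fix b :: "nat \<times> nat"
      obtain k l where b: "b = (k, l)" by fastforce
      show "b \<in> {(k, l). 1 \<le> k \<and> 1 \<le> l \<and> l \<le> h k} \<longleftrightarrow> b \<in> ?D \<union> {?m} \<times> {1..h ?m}"
        using le[of l k] by (cases "k = ?m") (auto simp: b)
    qed
  qed
  have "card ?D + h ?m = partition_size X n"
  proof -
    have "(\<Sum>k\<in>{1..?m}. h k) = partition_size X n"
      using H_partition_partition sum_part[OF length_H_partition] part_H_partition
      by (simp add: is_partition_def)
    then show ?thesis unfolding card_rows by simp
  qed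
  moreover have hm: "h ?m \<le> (if X = TypeC then 0 else 1)"
    unfolding h_Suc_length by (cases X) (auto simp: added_box_def kept_box_def even_box_def)
  ultimately have card: "card ?D = partition_size X n \<and> h ?m = 0 \<or>
      X \<noteq> TypeC \<and> card ?D = partition_size X n - 1 \<and> h ?m = 1"
    by (auto split: if_splits)
  \<comment> \<open>If the extra row is nonempty, then by monotonicity so are all rows of
    \<open>p\<close>, and the added box lands in row \<open>Suc (length p)\<close>.\<close>
  have rows: "{k. (k, 1) \<in> ?D} = {1..length p}" if "h ?m = 1"
  proof -
    have "1 \<le> h k" if "1 \<le> k" "k \<le> length p" for k
      using part_antimono[OF H_partition_partition that(1), of ?m] that part_H_partition[of k]
        part_H_partition[of ?m] \<open>h ?m = 1\<close> by simp
    then show ?thesis by auto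
  qed
  show ?thesis
  proof (cases "h ?m = 0")
    case True
    then have "card ?D = partition_size X n" using card by auto
    \<comment> \<open>No box may be added here; in type \<open>D\<close> this uses
      \<open>1 \<le> n\<close>, as \<open>2 * n\<close> and \<open>2 * n - 1\<close> coincide for
      \<open>n = 0\<close>.\<close>
    then have "H_algorithm X n p = ?D"
      using rank unfolding H_algorithm_def Let_def fill_holes_kept_boxes
      by (cases X) (auto simp: add_box_if_def partition_size_def)
    then show ?thesis unfolding diag split using True by simp
  next
    case False
    then have c: "X \<noteq> TypeC" "card ?D = partition_size X n - 1" "h ?m = 1" using card by auto
    then have "H_algorithm X n p = insert (card {k. (k, 1) \<in> ?D} + 1, 1) ?D"
      unfolding H_algorithm_def Let_def fill_holes_kept_boxes
      by (cases X) (auto simp: add_box_if_def partition_size_def)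
    also have "\<dots> = insert (?m, 1) ?D" unfolding rows[OF c(3)] by simp
    finally show ?thesis unfolding diag split using c(3) by auto
  qed
qed

end


section \<open>Symbols\<close>

function interleave :: "'a list \<Rightarrow> 'a list \<Rightarrow> 'a list" where
  "interleave [] ys = ys"
| "interleave (x # xs) ys = x # interleave ys xs"
  by pat_completeness auto
termination by (relation "measure (\<lambda>(xs, ys). length xs + length ys)") auto

lemma mset_interleave: "mset (interleave xs ys) = mset xs + mset ys"
  by (induction xs ys rule: interleave.induct) auto

lemma interlaced_Cons: "interlaced (x # xs) ys \<Longrightarrow> interlaced ys xs"
  unfolding interlaced_def
proof (intro conjI allI impI)
  assume i: "(\<forall>i. i < length (x # xs) \<and> i < length ys \<longrightarrow> (x # xs) ! i \<le> ys ! i) \<and>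
    (\<forall>i. i + 1 < length (x # xs) \<and> i < length ys \<longrightarrow> ys ! i \<le> (x # xs) ! (i + 1))"
  show "ys ! i \<le> xs ! i" if "i < length ys \<and> i < length xs" for i
    using i that by force
  show "xs ! i \<le> ys ! (i + 1)" if "i + 1 < length ys \<and> i < length xs" for i
    using conjunct1[OF i, rule_format, of "Suc i"] that by simp
qed

lemma sorted_interleave:
  "interlaced xs ys \<Longrightarrow> length xs = length ys \<or> length xs = Suc (length ys) \<Longrightarrow> sorted (interleave xs ys)"
proof (induction xs ys rule: interleave.induct)
  case (2 x xs ys)
  have s: "sorted (interleave ys xs)" using 2 interlaced_Cons[OF 2(2)] by auto
  show ?case
  proof (cases ys)
    case Nil
    then show ?thesis using 2(3) by simp
  next
    case (Cons y ys')
    then have "x \<le> y" using 2(2) unfolding interlaced_def by fastforce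
    then show ?thesis using s Cons by auto
  qed
qed auto

lemma interleave_inj:
  "interleave xs ys = interleave xs' ys' \<Longrightarrow> length xs = length xs' \<Longrightarrow> length ys = length ys' \<Longrightarrow>
     xs = xs' \<and> ys = ys'"
proof (induction xs ys arbitrary: xs' ys' rule: interleave.induct)
  case (2 x xs ys)
  then obtain x' xs'' where x': "xs' = x' # xs''" by (cases xs') auto
  then show ?case using 2(1)[of ys' xs''] 2(2-) by simp
qed auto

text \<open>Interlaced rows are precisely read alternately from a sorted list. The multiset
  determines that list, and the list together with the lengths determines the rows.\<close>

lemma interlaced_unique:
  assumes "interlaced L M" "interlaced L' M'" "mset L + mset M = mset L' + mset M'"
    and "length L = length L'" "length M = length M'"
    and "length L = length M \<or> length L = Suc (length M)"
  shows "L = L' \<and> M = M'"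
proof -
  have "interleave L M = interleave L' M'"
    using sorted_interleave[OF assms(1,6)] sorted_interleave[OF assms(2)] assms(3-6) mset_interleave
    by (metis properties_for_sort)
  then show ?thesis using interleave_inj assms(4,5) by blast
qed

lemma symbol_entries_shift:
  "symbol_entries (shift S) = {#0, 0#} + image_mset Suc (symbol_entries S)"
  by (simp add: symbol_entries_def shift_def)

lemma is_symbol_shift: "is_symbol X S \<Longrightarrow> is_symbol X (shift S)"
  by (auto simp: is_symbol_def shift_def sorted_wrt_map split: cartan_type.splits)

lemma interlaced_shift: "interlaced L M \<Longrightarrow> interlaced (0 # map Suc L) (0 # map Suc M)"
  unfolding interlaced_def by (auto simp: nth_Cons split: nat.splits)

lemma special_symbol_shift: "special_symbol X S \<Longrightarrow> special_symbol X (shift S)"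
  using is_symbol_shift[of X S] interlaced_shift[of "fst S" "snd S"] interlaced_shift[of "snd S" "fst S"]
  by (auto simp: special_symbol_def shift_def)

lemma funpow_shift_swap: "(shift ^^ a) (prod.swap S) = prod.swap ((shift ^^ a) S)"
  by (induction a) (simp_all add: shift_def)

lemma funpow_shift_comm: "(shift ^^ a) ((shift ^^ b) S) = (shift ^^ b) ((shift ^^ a) S)"
  by (metis add.commute comp_apply funpow_add)

text \<open>Shifts commute with each other and with the exchange of rows, so a chain of equivalences
  collapses to shifts on both sides and at most one exchange.\<close>

lemma symbol_equiv_normal_form:
  assumes "symbol_equiv X S T"
  obtains a b where "(shift ^^ a) S = (shift ^^ b) T \<or> X = TypeD \<and> (shift ^^ a) S = prod.swap ((shift ^^ b) T)"
  using assms
proof (induction arbitrary: thesis rule: symbol_equiv.induct)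
  case (refl S)
  show ?case by (rule refl[of 0 0]) simp
next
  case (sym S T)
  obtain a b where ab: "(shift ^^ a) S = (shift ^^ b) T \<or> X = TypeD \<and> (shift ^^ a) S = prod.swap ((shift ^^ b) T)"
    using sym.IH by blast
  show ?case
    by (rule sym.prems[of b a]) (use ab in \<open>metis swap_swap\<close>)
next
  case (trans S T U)
  obtain a b where ab: "(shift ^^ a) S = (shift ^^ b) T \<or> X = TypeD \<and> (shift ^^ a) S = prod.swap ((shift ^^ b) T)"
    using trans.IH(1) by blast
  obtain c d where cd: "(shift ^^ c) T = (shift ^^ d) U \<or> X = TypeD \<and> (shift ^^ c) T = prod.swap ((shift ^^ d) U)"
    using trans.IH(2) by blast
  have 1: "(shift ^^ (c + a)) S = (shift ^^ c) ((shift ^^ a) S)" by (simp add: funpow_add)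
  have 2: "(shift ^^ (b + d)) U = (shift ^^ b) ((shift ^^ d) U)" by (simp add: funpow_add)
  have 3: "(shift ^^ c) ((shift ^^ b) T) = (shift ^^ b) ((shift ^^ c) T)" by (rule funpow_shift_comm)
  show ?case
    by (rule trans.prems[of "c + a" "b + d"])
      (use ab cd in \<open>auto simp: 1 2 3 funpow_shift_swap\<close>)
next
  case (shift S)
  show ?case by (rule shift[of 1 0]) simp
next
  case (swap L M)
  show ?case by (rule swap(2)[of 0 0]) (simp add: swap(1))
qed

text \<open>The entries \<open>z_entry p K k\<close> decrease with \<open>k\<close>, so both rows
  start from the bottom: the first takes the \<open>k\<close> of the parity of \<open>K\<close>, the
  second the others. Weak monotonicity gives interlacing, and strictness over two steps gives
  strictly increasing rows.\<close>

definition special_rows :: "nat list \<Rightarrow> nat \<Rightarrow> symbol" where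
  "special_rows p K =
     (map (\<lambda>i. z_entry p K (K - 2 * i)) [0..<Suc K div 2],
      map (\<lambda>i. z_entry p K (K - 1 - 2 * i)) [0..<K div 2])"

lemma mset_alternate:
  "mset (map (\<lambda>i. f (K - 2 * i)) [0..<Suc K div 2]) + mset (map (\<lambda>i. f (K - 1 - 2 * i)) [0..<K div 2]) =
    image_mset f (mset_set {1..K})"
proof (induction K)
  case (Suc K)
  have "map (\<lambda>i. f (Suc K - 2 * i)) [0..<Suc (K div 2)] =
      f (Suc K) # map (\<lambda>i. f (K - 1 - 2 * i)) [0..<K div 2]"
    by (simp add: map_upt_Suc del: upt_Suc)
  moreover have "Suc (Suc K) div 2 = Suc (K div 2)" by simp
  moreover have "{1..Suc K} = insert (Suc K) {1..K}" by auto
  ultimately show ?case using Suc by (simp add: union_commute)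
qed simp

lemma symbol_entries_special_rows:
  "symbol_entries (special_rows p K) = image_mset (z_entry p K) (mset_set {1..K})"
  using mset_alternate[of "z_entry p K" K] by (simp add: symbol_entries_def special_rows_def)

lemma special_rows_shift:
  assumes "length p \<le> K"
  shows "special_rows p (Suc (Suc K)) = shift (special_rows p K)"
proof -
  have z: "z_entry p (Suc (Suc K)) (Suc (Suc K)) = 0" "z_entry p (Suc (Suc K)) (Suc K) = 0"
    using assms by (simp_all add: z_entry_def part_eq_0)
  have s: "z_entry p (Suc (Suc K)) k = Suc (z_entry p K k)" if "k \<le> K" for k
    using that by (simp add: z_entry_def Suc_diff_le)
  have "Suc (Suc (Suc K)) div 2 = Suc (Suc K div 2)" "Suc (Suc K) div 2 = Suc (K div 2)" by simp_all
  then show ?thesis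
    using z s by (simp add: special_rows_def shift_def map_upt_Suc del: upt_Suc)
qed

lemma z_entry_less:
  assumes "is_partition N p" "1 \<le> i" "i + 2 \<le> j" "j \<le> K"
  shows "z_entry p K j < z_entry p K i"
  using z_entry_antimono[OF assms(1), of "Suc (Suc i)" j K] z_entry_Suc_Suc[OF assms(1,2), of K] assms(2-4)
  by simp

lemma is_symbol_special_rows:
  assumes "is_partition N p" "odd K = (X \<noteq> TypeD)"
  shows "is_symbol X (special_rows p K)"
proof -
  have "sorted_wrt (<) (fst (special_rows p K))" "sorted_wrt (<) (snd (special_rows p K))"
    unfolding special_rows_def fst_conv snd_conv sorted_wrt_iff_nth_less
    by (auto intro!: z_entry_less[OF assms(1)])
  moreover have "Suc K div 2 = (case X of TypeD \<Rightarrow> K div 2 | _ \<Rightarrow> K div 2 + 1)"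
    using assms(2) by (cases X) auto
  ultimately show ?thesis by (cases X) (simp_all add: is_symbol_def special_rows_def)
qed

lemma interlaced_special_rows:
  assumes "is_partition N p"
  shows "interlaced (fst (special_rows p K)) (snd (special_rows p K))"
  unfolding interlaced_def special_rows_def
  by (auto intro!: z_entry_antimono[OF assms])

lemma special_symbol_special_rows:
  assumes "is_partition N p" "odd K = (X \<noteq> TypeD)"
  shows "special_symbol X (special_rows p K)"
  using is_symbol_special_rows[OF assms] interlaced_special_rows[OF assms(1)] by (simp add: special_symbol_def)

lemma alternating_parity:
  assumes "alternating \<tau>" "even i = even j"
  shows "\<tau> i = \<tau> j"
proof -
  have "\<tau> i = (if even i then \<tau> 0 else 1 - \<tau> 0)" for i
  proof (induction i)
    case (Suc i)
    then show ?case using alternatingD[OF assms(1), of i] alternating_le[OF assms(1), of 0]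
      by (auto split: if_splits)
  qed simp
  then show ?thesis using assms(2) by metis
qed

text \<open>\<open>\<tau>\<close> is constant on each parity class of \<open>k\<close>, hence on
  each row of the symbol, and becomes the offset by which type symbols distinguish their
  rows.\<close>

lemma special_rows_beta:
  assumes "alternating \<tau>"
  shows "(\<lambda>a. 2 * a + \<tau> K) ` set (fst (special_rows p K)) \<union> (\<lambda>b. 2 * b + (1 - \<tau> K)) ` set (snd (special_rows p K)) =
    (\<lambda>k. 2 * z_entry p K k + \<tau> k) ` {1..K}"
proof (intro set_eqI iffI)
  have t1: "\<tau> k = \<tau> K" if "even k = even K" for k using alternating_parity[OF assms that] .
  have t2: "\<tau> k = 1 - \<tau> K" if "even k \<noteq> even K" for k
    using alternating_parity[OF assms, of "Suc k" K] alternatingD[OF assms, of k] that by auto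
  fix x
  show "x \<in> (\<lambda>k. 2 * z_entry p K k + \<tau> k) ` {1..K}"
    if x: "x \<in> (\<lambda>a. 2 * a + \<tau> K) ` set (fst (special_rows p K)) \<union> (\<lambda>b. 2 * b + (1 - \<tau> K)) ` set (snd (special_rows p K))"
  proof -
    consider i where "i < Suc K div 2" "x = 2 * z_entry p K (K - 2 * i) + \<tau> K"
      | i where "i < K div 2" "x = 2 * z_entry p K (K - 1 - 2 * i) + (1 - \<tau> K)"
      using x by (auto simp: special_rows_def)
    then show ?thesis
    proof cases
      case (1 i)
      then have "2 * i \<le> K" by linarith
      then show ?thesis using 1 t1[of "K - 2 * i"] by (intro image_eqI[of _ _ "K - 2 * i"]) auto
    next
      case (2 i)
      then have "2 * i + 1 \<le> K" by linarith
      then show ?thesis using 2 t2[of "K - 1 - 2 * i"] by (intro image_eqI[of _ _ "K - 1 - 2 * i"]) auto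
    qed
  qed
  assume "x \<in> (\<lambda>k. 2 * z_entry p K k + \<tau> k) ` {1..K}"
  then obtain k where k: "1 \<le> k" "k \<le> K" "x = 2 * z_entry p K k + \<tau> k" by auto
  show "x \<in> (\<lambda>a. 2 * a + \<tau> K) ` set (fst (special_rows p K)) \<union> (\<lambda>b. 2 * b + (1 - \<tau> K)) ` set (snd (special_rows p K))"
  proof (cases "even k = even K")
    case True
    then have "even (K - k)" using k by simp
    then obtain i where i: "K - k = 2 * i" by (rule evenE)
    then have "k = K - 2 * i" "i < Suc K div 2" using k by linarith+
    then show ?thesis using k t1[OF True] by (auto simp: special_rows_def)
  next
    case False
    then have "odd (K - k)" using k by simp
    then obtain i where i: "K - k = 2 * i + 1" by (rule oddE)
    then have "k = K - 1 - 2 * i" "i < K div 2" using k by linarith+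
    then show ?thesis using k t2[OF False] by (auto simp: special_rows_def)
  qed
qed

lemma beta_set_collect: "{part d l + (K - l) | l. 1 \<le> l \<and> l \<le> K} = (\<lambda>l. part d l + (K - l)) ` {1..K}"
  unfolding image_def Bex_def atLeastAtMost_iff by (rule Collect_cong) blast

lemma inj_on_part_beta:
  assumes "is_partition N d"
  shows "inj_on (\<lambda>l. part d l + (K - l)) {1..K}"
proof (rule inj_on_beta(1))
  show "part d (Suc k) \<le> part d k" if "1 \<le> k" for k
    using part_antimono[OF assms that, of "Suc k"] by simp
qed

lemma length_le_iff_part: "is_partition N d \<Longrightarrow> length d \<le> K \<longleftrightarrow> part d (Suc K) = 0"
  using part_pos_iff[of N d "Suc K"] by auto

section \<open>Symbols of the given partition\<close>

text \<open>Halving the numbers \<open>part p k + (K - k)\<close> and rounding down gives the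
  entries of the \<open>B\<close>-symbol. Rounding up instead raises the second row by one, as in
  the \<open>D\<close>-symbol, and amounts to passing from \<open>K\<close> to \<open>Suc K\<close>;
  the additional row then supplies the entry 0.\<close>

lemma B_symbol_entries:
  assumes p: "is_partition N p" and S: "B_symbol_of p S"
  obtains K where "K = 2 * length (snd S) + 1" "length p \<le> K"
    "mset (fst S) + mset (snd S) = image_mset (z_entry p K) (mset_set {1..K})"
    "add_mset 0 (mset (fst S) + image_mset Suc (mset (snd S))) =
      image_mset (z_entry p (Suc K)) (mset_set {1..Suc K})"
proof -
  define m where "m = length (snd S)"
  have m: "part p (2 * m + 2) = 0" "is_symbol TypeB S"
    "(\<lambda>a. 2 * a) ` set (fst S) \<union> (\<lambda>b. 2 * b + 1) ` set (snd S) =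
       {part p k + (2 * m + 1 - k) | k. 1 \<le> k \<and> k \<le> 2 * m + 1}"
    using S unfolding B_symbol_of_def m_def by blast+
  let ?K = "2 * m + 1"
  let ?L = "(\<lambda>a. 2 * a) ` set (fst S)" and ?M = "(\<lambda>b. 2 * b + 1) ` set (snd S)"
  let ?\<beta> = "\<lambda>k. part p k + (?K - k)"
  have K: "?K = 2 * length (snd S) + 1" "length p \<le> ?K"
    using m(1) length_le_iff_part[OF p, of ?K] by (auto simp: m_def)
  have d: "distinct (fst S)" "distinct (snd S)"
    using m(2) by (auto simp: is_symbol_def strict_sorted_iff)
  have LM: "mset_set (?L \<union> ?M) = image_mset (\<lambda>a. 2 * a) (mset (fst S)) + image_mset (\<lambda>b. 2 * b + 1) (mset (snd S))"
  proof -
    have "?L \<inter> ?M = {}" by (auto; presburger)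
    then have "mset_set (?L \<union> ?M) = mset_set ?L + mset_set ?M" by (intro mset_set_Union) auto
    also have "mset_set ?L = image_mset (\<lambda>a. 2 * a) (mset_set (set (fst S)))"
      by (rule image_mset_mset_set[symmetric]) (auto intro: inj_onI)
    also have "mset_set ?M = image_mset (\<lambda>b. 2 * b + 1) (mset_set (set (snd S)))"
      by (rule image_mset_mset_set[symmetric]) (auto intro: inj_onI)
    finally show ?thesis using d by (simp add: mset_set_set)
  qed
  have "mset_set (?L \<union> ?M) = image_mset ?\<beta> (mset_set {1..?K})"
    unfolding m(3) beta_set_collect by (rule image_mset_mset_set[symmetric, OF inj_on_part_beta[OF p]])
  then have \<beta>: "image_mset (\<lambda>a. 2 * a) (mset (fst S)) + image_mset (\<lambda>b. 2 * b + 1) (mset (snd S)) =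
      image_mset ?\<beta> (mset_set {1..?K})"
    unfolding LM .
  have "image_mset (\<lambda>x. x div 2) (image_mset ?\<beta> (mset_set {1..?K})) =
      image_mset (z_entry p ?K) (mset_set {1..?K})"
    unfolding multiset.map_comp by (rule image_mset_cong) (simp add: z_entry_def)
  then have e1: "mset (fst S) + mset (snd S) = image_mset (z_entry p ?K) (mset_set {1..?K})"
    unfolding \<beta>[symmetric] by (simp add: multiset.map_comp comp_def)
  have "image_mset (\<lambda>x. (x + 1) div 2) (image_mset ?\<beta> (mset_set {1..?K})) =
      image_mset (z_entry p (Suc ?K)) (mset_set {1..?K})"
    unfolding multiset.map_comp
    by (rule image_mset_cong) (auto simp: z_entry_def Suc_diff_le)
  then have "mset (fst S) + image_mset Suc (mset (snd S)) = image_mset (z_entry p (Suc ?K)) (mset_set {1..?K})"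
    unfolding \<beta>[symmetric] by (simp add: multiset.map_comp comp_def)
  moreover have "{1..Suc ?K} = insert (Suc ?K) {1..?K}" by auto
  moreover have "z_entry p (Suc ?K) (Suc ?K) = 0" using K(2) by (simp add: z_entry_def part_eq_0)
  ultimately have e2: "add_mset 0 (mset (fst S) + image_mset Suc (mset (snd S))) =
      image_mset (z_entry p (Suc ?K)) (mset_set {1..Suc ?K})"
    by simp
  show ?thesis using that[OF K e1 e2] .
qed

lemma domino_symbol_entries:
  assumes p: "is_partition N p" and S: "domino_symbol_of X p S"
  obtains K where "odd K = (X \<noteq> TypeD)" "length p \<le> K" "symbol_entries S = symbol_entries (special_rows p K)"
proof (cases "X = TypeD")
  case True
  then obtain L M where S': "B_symbol_of p (L, M)" "S = (L, 0 # map Suc M)"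
    using S by (auto simp: domino_symbol_of_def D_symbol_of_def)
  show ?thesis
  proof (rule B_symbol_entries[OF p S'(1)])
    fix K assume K: "K = 2 * length (snd (L, M)) + 1" "length p \<le> K"
      "add_mset 0 (mset (fst (L, M)) + image_mset Suc (mset (snd (L, M)))) =
        image_mset (z_entry p (Suc K)) (mset_set {1..Suc K})"
    show ?thesis
    proof (rule that[of "Suc K"])
      show "symbol_entries S = symbol_entries (special_rows p (Suc K))"
        unfolding symbol_entries_special_rows K(3)[symmetric] by (simp add: S'(2) symbol_entries_def)
    qed (use True K in auto)
  qed
next
  case False
  then have "B_symbol_of p S" using S by (cases X) (auto simp: domino_symbol_of_def)
  then show ?thesis
  proof (rule B_symbol_entries[OF p])
    fix K assume "K = 2 * length (snd S) + 1" "length p \<le> K"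
      "mset (fst S) + mset (snd S) = image_mset (z_entry p K) (mset_set {1..K})"
    then show ?thesis
      using that[of K] False by (simp add: symbol_entries_special_rows symbol_entries_def[of S])
  qed
qed

text \<open>\<open>type_symbol_of\<close> with an arbitrary number \<open>k\<close> of parts, zeros
  included, so that shifting a symbol corresponds to raising \<open>k\<close> by two.\<close>

definition beta_symbol :: "cartan_type \<Rightarrow> nat list \<Rightarrow> nat \<Rightarrow> symbol \<Rightarrow> bool" where
  "beta_symbol X d k U \<longleftrightarrow> length d \<le> k \<and> is_symbol X U \<and>
     (\<lambda>a. 2 * a + (1 - of_bool (X = TypeC))) ` set (fst U) \<union> (\<lambda>b. 2 * b + of_bool (X = TypeC)) ` set (snd U) =
       (\<lambda>l. part d l + (k - l)) ` {1..k}"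

lemma type_symbol_of_iff:
  "type_symbol_of X d U \<longleftrightarrow>
     beta_symbol X d (if X = TypeC \<and> even (length d) then length d + 1 else length d) U"
proof -
  let ?k = "if X = TypeC \<and> even (length d) then length d + 1 else length d"
  have "(\<lambda>a. 2 * a + (1 - of_bool (X = TypeC))) = (case X of TypeC \<Rightarrow> (\<lambda>a. 2 * a) | _ \<Rightarrow> (\<lambda>a :: nat. 2 * a + 1))"
    "(\<lambda>b. 2 * b + of_bool (X = TypeC)) = (case X of TypeC \<Rightarrow> (\<lambda>b. 2 * b + 1) | _ \<Rightarrow> (\<lambda>b :: nat. 2 * b))"
    by (cases X; simp)+
  moreover have "length d \<le> ?k" by simp
  ultimately show ?thesis
    unfolding type_symbol_of_def beta_symbol_def Let_def beta_set_collect
    by (cases X) simp_all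
qed

lemma beta_symbol_shift:
  assumes "beta_symbol X d k U"
  shows "beta_symbol X d (Suc (Suc k)) (shift U)"
proof -
  let ?e = "of_bool (X = TypeC) :: nat"
  have "(\<lambda>l. part d l + (Suc (Suc k) - l)) ` {1..Suc (Suc k)} =
      {0, 1} \<union> (\<lambda>x. x + 2) ` (\<lambda>l. part d l + (k - l)) ` {1..k}"
  proof -
    have "{1..Suc (Suc k)} = {1..k} \<union> {Suc k, Suc (Suc k)}" by auto
    moreover have "(\<lambda>l. part d l + (Suc (Suc k) - l)) ` {1..k} =
        (\<lambda>x. x + 2) ` (\<lambda>l. part d l + (k - l)) ` {1..k}"
      unfolding image_image by (rule image_cong) auto
    moreover have "part d (Suc k) = 0" "part d (Suc (Suc k)) = 0"
      using assms by (simp_all add: beta_symbol_def part_eq_0)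
    ultimately show ?thesis by (simp add: image_Un insert_commute)
  qed
  also have "(\<lambda>l. part d l + (k - l)) ` {1..k} =
      (\<lambda>a. 2 * a + (1 - ?e)) ` set (fst U) \<union> (\<lambda>b. 2 * b + ?e) ` set (snd U)"
    using assms by (simp add: beta_symbol_def)
  finally have eq: "(\<lambda>l. part d l + (Suc (Suc k) - l)) ` {1..Suc (Suc k)} =
      {0, 1} \<union> ((\<lambda>x. x + 2) ` (\<lambda>a. 2 * a + (1 - ?e)) ` set (fst U) \<union>
        (\<lambda>x. x + 2) ` (\<lambda>b. 2 * b + ?e) ` set (snd U))"
    unfolding image_Un .
  have img: "(\<lambda>a. 2 * a + c) ` set (0 # map Suc xs) = insert c ((\<lambda>x. x + 2) ` (\<lambda>a. 2 * a + c) ` set xs)"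
    for c :: nat and xs
    by (simp add: image_image)
  have ins: "insert a A \<union> insert b B = {a, b} \<union> (A \<union> B)" for a b :: nat and A B by blast
  have "{1 - ?e, ?e} = {0, 1}" by (cases "X = TypeC") auto
  then have "(\<lambda>a. 2 * a + (1 - ?e)) ` set (fst (shift U)) \<union> (\<lambda>b. 2 * b + ?e) ` set (snd (shift U)) =
      (\<lambda>l. part d l + (Suc (Suc k) - l)) ` {1..Suc (Suc k)}"
    unfolding shift_def fst_conv snd_conv img ins eq by (rule arg_cong)
  then show ?thesis
    using assms is_symbol_shift[of X U] by (simp add: beta_symbol_def)
qed

lemma beta_symbol_funpow_shift: "beta_symbol X d k U \<Longrightarrow> beta_symbol X d (k + 2 * a) ((shift ^^ a) U)"
proof (induction a)
  case (Suc a)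
  then show ?case using beta_symbol_shift[of X d "k + 2 * a" "(shift ^^ a) U"] by simp
qed simp

lemma beta_symbol_length:
  assumes "is_partition N d" "beta_symbol X d k U"
  shows "length (fst U) + length (snd U) = k"
proof -
  let ?e = "of_bool (X = TypeC) :: nat"
  let ?L = "(\<lambda>a. 2 * a + (1 - ?e)) ` set (fst U)" and ?M = "(\<lambda>b. 2 * b + ?e) ` set (snd U)"
  have d: "distinct (fst U)" "distinct (snd U)"
    using assms(2) by (auto simp: beta_symbol_def is_symbol_def strict_sorted_iff)
  have "card ?L = length (fst U)" "card ?M = length (snd U)"
    using d by (simp_all add: card_image inj_on_def distinct_card)
  moreover have "?L \<inter> ?M = {}" by (cases "X = TypeC"; auto; presburger)
  ultimately have "card (?L \<union> ?M) = length (fst U) + length (snd U)" by (simp add: card_Un_disjoint)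
  moreover have "card ((\<lambda>l. part d l + (k - l)) ` {1..k}) = k"
    using card_image[OF inj_on_part_beta[OF assms(1)]] by simp
  ultimately show ?thesis using assms(2) by (simp add: beta_symbol_def)
qed

lemma strict_decreasing_image_eq:
  fixes f g :: "nat \<Rightarrow> nat"
  assumes "\<And>i j. i \<in> {1..k} \<Longrightarrow> j \<in> {1..k} \<Longrightarrow> i < j \<Longrightarrow> f j < f i"
    "\<And>i j. i \<in> {1..k} \<Longrightarrow> j \<in> {1..k} \<Longrightarrow> i < j \<Longrightarrow> g j < g i"
    "f ` {1..k} = g ` {1..k}" "i \<in> {1..k}"
  shows "f i = g i"
proof -
  have "sorted_wrt (>) (map f [1..<Suc k])" "sorted_wrt (>) (map g [1..<Suc k])"
    using assms(1,2) by (auto simp: sorted_wrt_iff_nth_less simp del: upt_Suc)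
  then have "sorted_wrt (<) (rev (map f [1..<Suc k]))" "sorted_wrt (<) (rev (map g [1..<Suc k]))"
    by (simp_all add: sorted_wrt_rev del: upt_Suc)
  moreover have "set (rev (map f [1..<Suc k])) = set (rev (map g [1..<Suc k]))"
    using assms(3) by (simp add: atLeastLessThanSuc_atLeastAtMost del: upt_Suc)
  ultimately have "rev (map f [1..<Suc k]) = rev (map g [1..<Suc k])"
    by (metis strict_sorted_equal)
  then have "map f [1..<Suc k] = map g [1..<Suc k]" by simp
  then show ?thesis using assms(4) by (auto simp del: upt_Suc)
qed

lemma part_eq_h_part:
  assumes p: "is_partition N p" and d: "is_partition N' d" and \<tau>: "alternating \<tau>"
    and K: "odd K = (X \<noteq> TypeD)" "length p \<le> K"
    and eq: "(\<lambda>k. 2 * z_entry p K k + \<tau> k) ` {1..K} = (\<lambda>l. part d l + (K - l)) ` {1..K}"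
    and k: "1 \<le> k" "k \<le> K"
  shows "part d k = h_part X p \<tau> k"
proof -
  have "part d k + (K - k) = h_part X p \<tau> k + (K - k)"
  proof (rule strict_decreasing_image_eq[of K "\<lambda>k. part d k + (K - k)" "\<lambda>k. h_part X p \<tau> k + (K - k)"])
    show "(\<lambda>k. part d k + (K - k)) ` {1..K} = (\<lambda>k. h_part X p \<tau> k + (K - k)) ` {1..K}"
      unfolding beta_set_h_part[OF p K \<tau>] eq ..
    show "part d j + (K - j) < part d i + (K - i)" if "i \<in> {1..K}" "j \<in> {1..K}" "i < j" for i j
      by (rule inj_on_beta(2)[where g = "part d", OF part_antimono[OF d] that]) auto
    show "h_part X p \<tau> j + (K - j) < h_part X p \<tau> i + (K - i)" if "i \<in> {1..K}" "j \<in> {1..K}" "i < j" for i j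
      by (rule inj_on_beta(2)[where g = "h_part X p \<tau>", OF h_part_antimono[OF p \<tau>] that])
  qed (use k in auto)
  then show ?thesis by simp
qed

text \<open>If the rows of the symbol of a partition of type \<open>D\<close> were interlaced in the wrong order, the
  topmost unpaired row would give the last occurrence of an even part, at an odd position
  preceded by pairs of equal parts.\<close>

lemma no_unpaired_row:
  assumes p: "is_partition N p" and d: "type_partition TypeD n d" and \<tau>: "alternating \<tau>" "\<tau> 1 = 1"
    and K: "even K" "length p \<le> K" "length d \<le> K"
    and part: "\<And>k. 1 \<le> k \<Longrightarrow> k \<le> K \<Longrightarrow> part d k = h_part TypeD p \<tau> k"
    and k: "1 \<le> k" "k \<le> K"
  shows "paired_row TypeD p k"
proof (rule ccontr)
  assume "\<not> paired_row TypeD p k"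
  define j where "j = (LEAST j. 1 \<le> j \<and> \<not> paired_row TypeD p j)"
  have j: "1 \<le> j" "\<not> paired_row TypeD p j"
    using LeastI[of "\<lambda>j. 1 \<le> j \<and> \<not> paired_row TypeD p j" k] k \<open>\<not> paired_row TypeD p k\<close>
    by (auto simp: j_def)
  have below: "paired_row TypeD p i" if "1 \<le> i" "i < j" for i
    using not_less_Least[of i "\<lambda>j. 1 \<le> j \<and> \<not> paired_row TypeD p j"] that by (auto simp: j_def)
  have jK: "j \<le> K"
    using Least_le[of "\<lambda>j. 1 \<le> j \<and> \<not> paired_row TypeD p j" k] k \<open>\<not> paired_row TypeD p k\<close>
    by (simp add: j_def)
  have K': "odd K = (TypeD \<noteq> TypeD)" using K(1) by simp
  have dp: "is_partition (partition_size TypeD n) d" using d by (simp add: type_partition_def)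
  \<comment> \<open>All rows before \<open>j\<close> are paired, so from the top down the pairs can
    only be the rows 1 and 2, 3 and 4, and so on.\<close>
  have first_odd: "(odd i \<longrightarrow> first_row TypeD p i) \<and> (even i \<longrightarrow> \<not> first_row TypeD p i)"
    if "1 \<le> i" "i < j" for i
    using that
  proof (induction i rule: nat_induct_at_least)
    case base
    then show ?case using below[of 1] by (auto simp: paired_row_def first_row_def)
  next
    case (Suc i)
    then have IH: "(odd i \<longrightarrow> first_row TypeD p i) \<and> (even i \<longrightarrow> \<not> first_row TypeD p i)" by simp
    show ?case
    proof (cases "odd i")
      case True
      then show ?thesis using IH first_row_Suc by auto
    next
      case False
      then have "first_row TypeD p (Suc i)" using IH below[of "Suc i"] Suc.prems by (auto simp: paired_row_def)
      then show ?thesis using False by simp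
    qed
  qed
  have "odd j"
  proof (rule ccontr)
    assume "\<not> odd j"
    then have "odd (j - 1)" "1 \<le> j - 1" "j - 1 < j" using j(1) by (auto elim: oddE)
    then have "first_row TypeD p (j - 1)" using first_odd by blast
    then have "paired_row TypeD p j" using j(1) unfolding paired_row_def by (metis Suc_diff_1 less_eq_Suc_le One_nat_def)
    then show False using j(2) by simp
  qed
  then have \<tau>j: "\<tau> j = 1" "\<tau> (Suc j) = 0"
    using alternating_parity[OF \<tau>(1), of j 1] \<tau>(2) alternatingD[OF \<tau>(1), of j] by auto
  define a where "a = part d j"
  have a: "a + (K - j) = 2 * z_entry p K j + 1"
    using h_part_unpaired[OF p K' j(1) jK j(2), of \<tau>] part[OF j(1) jK] \<tau>j by (simp add: a_def)
  have "odd (K - j)" using \<open>odd j\<close> K(1) jK by simp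
  then have "even a" using a by presburger
  have sjK: "Suc j \<le> K" using \<open>odd j\<close> K(1) jK by (metis Suc_leI le_neq_implies_less)
  have ne: "part d (Suc j) \<noteq> a"
  proof
    assume eq: "part d (Suc j) = a"
    show False
    proof (cases "paired_row TypeD p (Suc j)")
      case True
      then have f: "first_row TypeD p (Suc j)" using j(2) by (auto simp: paired_row_def)
      then have "part p (Suc j) = a" using eq part[of "Suc j"] sjK h_part_pair(1)[OF f, of \<tau>] by simp
      then show False using f \<open>odd j\<close> \<open>even a\<close> by (auto simp: first_row_def kept_box_def even_box_def)
    next
      case False
      then have "a + (K - Suc j) = 2 * z_entry p K (Suc j)"
        using h_part_unpaired[OF p K' _ sjK False, of \<tau>] part[of "Suc j"] sjK \<tau>j eq by simp
      then have "z_entry p K (Suc j) = z_entry p K j" using a sjK by linarith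
      then have "first_row TypeD p j" using z_entry_Suc(2)[OF p K' j(1) sjK] by simp
      then show False using j(2) by (simp add: paired_row_def)
    qed
  qed
  have "part d (Suc j) < a" using part_antimono[OF dp j(1), of "Suc j"] ne by (simp add: a_def)
  then have pos: "0 < a" by simp
  let ?F = "{i \<in> {1..<j}. odd i \<and> part d i = a}"
  have pair: "part d (Suc i) = part d i" if "1 \<le> i" "i < j" "odd i" for i
  proof -
    have f: "first_row TypeD p i" using first_odd that by blast
    have "Suc i \<le> j" using that(2) by simp
    then show ?thesis using part[of i] part[of "Suc i"] h_part_pair[OF f, of \<tau>] that jK by simp
  qed
  have lt: "Suc i < j" if "i < j" "odd i" for i using that \<open>odd j\<close> by (metis Suc_lessI even_Suc)
  have "{k \<in> {1..K}. part d k = a} = insert j (?F \<union> Suc ` ?F)"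
  proof (intro set_eqI iffI)
    fix i assume i: "i \<in> {k \<in> {1..K}. part d k = a}"
    then have "i \<le> j" using part_antimono[OF dp, of "Suc j" i] \<open>part d (Suc j) < a\<close> by (cases "i \<le> j") auto
    show "i \<in> insert j (?F \<union> Suc ` ?F)"
    proof (cases "i = j \<or> odd i")
      case True
      then show ?thesis using i \<open>i \<le> j\<close> by auto
    next
      case False
      then obtain l where l: "i = Suc l" "odd l" using i by (cases i) auto
      then have "l \<in> ?F" using i False \<open>i \<le> j\<close> pair[of l] by (auto elim: oddE)
      then show ?thesis using l by blast
    qed
  next
    fix i assume "i \<in> insert j (?F \<union> Suc ` ?F)"
    then consider "i = j" | "i \<in> ?F" | l where "i = Suc l" "l \<in> ?F" by blast
    then show "i \<in> {k \<in> {1..K}. part d k = a}"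
    proof cases
      case 1
      then show ?thesis using j(1) jK by (simp add: a_def)
    next
      case 2
      then show ?thesis using jK by auto
    next
      case (3 l)
      then show ?thesis using pair[of l] jK by auto
    qed
  qed
  moreover have "card (insert j (?F \<union> Suc ` ?F)) = Suc (card (?F \<union> Suc ` ?F))"
    by (rule card_insert_disjoint) (use lt in auto)
  moreover have "card (?F \<union> Suc ` ?F) = card ?F + card (Suc ` ?F)"
    by (rule card_Un_disjoint) auto
  moreover have "card (Suc ` ?F) = card ?F" by (rule card_image) simp
  ultimately have "odd (count_list d a)"
    using count_list_part[OF dp K(3) pos] by simp
  then show False using d \<open>even a\<close> by (simp add: type_partition_def)
qed

section \<open>Existence and uniqueness of the special partition\<close>

context balanced_partition
begin

lemma h_zero_beyond:
  assumes "odd K = (X \<noteq> TypeD)" "length p \<le> K" "K < k"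
  shows "h k = 0"
proof (cases "k = Suc (length p)")
  case True
  then have "K = length p" using assms by simp
  then have "\<not> kept_box X (Suc (length p), 0)"
    using kept_box_iff[OF assms(1), of K 0] kept_box_Suc(1)[of X K 0] by simp
  then show ?thesis using True h_Suc_length by simp
qed (use assms h_beyond in simp)

lemma partition_eq_H_partition:
  assumes d: "is_partition N d" and K: "odd K = (X \<noteq> TypeD)" "length p \<le> K" "length d \<le> K"
    and "\<And>k. 1 \<le> k \<Longrightarrow> k \<le> K \<Longrightarrow> part d k = h k"
  shows "d = H_partition"
proof (rule partition_eqI[OF d H_partition_partition])
  fix k :: nat assume k: "1 \<le> k"
  show "part d k = part H_partition k"
  proof (cases "k \<le> K")
    case True
    then show ?thesis using assms(5) k by (simp add: part_H_partition)
  next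
    case False
    then show ?thesis using h_zero_beyond[OF K(1,2)] K(3) k by (simp add: part_H_partition part_eq_0)
  qed
qed

lemma is_special_of_unique:
  assumes "is_special_of X n p q"
  shows "q = H_partition"
proof -
  obtain S T U where q: "special_partition X n q" and S: "domino_symbol_of X p S" and T: "special_symbol X T"
    "symbol_entries T = symbol_entries S" and U: "type_symbol_of X q U" "symbol_equiv X U T"
    using assms unfolding is_special_of_def by blast
  have qt: "type_partition X n q" using q by (simp add: special_partition_def)
  then have qp: "is_partition (partition_size X n) q" by (simp add: type_partition_def)
  obtain K0 where K0: "odd K0 = (X \<noteq> TypeD)" "length p \<le> K0"
    "symbol_entries S = symbol_entries (special_rows p K0)"
    using domino_symbol_entries[OF partition S] by blast
  obtain k0 where k0: "beta_symbol X q k0 U" using U(1) unfolding type_symbol_of_iff by blast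
  obtain a b where ab: "(shift ^^ a) U = (shift ^^ b) T \<or>
      X = TypeD \<and> (shift ^^ a) U = prod.swap ((shift ^^ b) T)"
    using symbol_equiv_normal_form[OF U(2)] by blast
  \<comment> \<open>Each shift of \<open>T\<close> matches raising the bound in
    \<open>special_rows\<close> by two, so with this \<open>K\<close> the symbol \<open>T\<close>
    shifted \<open>b\<close> times has the entries of \<open>special_rows p K\<close>.\<close>
  define K where "K = K0 + 2 * b"
  have K: "odd K = (X \<noteq> TypeD)" "length p \<le> K" using K0 by (auto simp: K_def)
  have Tb: "special_symbol X ((shift ^^ b) T) \<and>
      symbol_entries ((shift ^^ b) T) = symbol_entries (special_rows p (K0 + 2 * b))"
  proof (induction b)
    case 0
    then show ?case using T K0 by simp
  next
    case (Suc b)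
    then show ?case
      using special_symbol_shift[of X "(shift ^^ b) T"] special_rows_shift[of p "K0 + 2 * b"] K0(2)
      by (simp add: symbol_entries_shift)
  qed
  define V where "V = special_rows p K"
  have V: "interlaced (fst V) (snd V)" "is_symbol X V"
    unfolding V_def by (rule interlaced_special_rows[OF partition], rule is_symbol_special_rows[OF partition K(1)])
  have V_eq: "(shift ^^ b) T = V \<or> X = TypeD \<and> (shift ^^ b) T = prod.swap V"
  proof -
    let ?T = "(shift ^^ b) T"
    have e: "mset (fst ?T) + mset (snd ?T) = mset (fst V) + mset (snd V)" and s: "is_symbol X ?T"
      using Tb by (auto simp: symbol_entries_def V_def K_def special_symbol_def)
    then have l: "length (fst ?T) + length (snd ?T) = length (fst V) + length (snd V)"
      by (metis size_mset size_union)
    then have "length (fst ?T) = length (fst V) \<and> length (snd ?T) = length (snd V) \<and>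
      (length (fst ?T) = length (snd ?T) \<or> length (fst ?T) = Suc (length (snd ?T))) \<and>
      (X = TypeD \<longrightarrow> length (fst ?T) = length (snd ?T))"
      using s V(2) by (cases X) (simp_all add: is_symbol_def)
    then have len: "length (fst ?T) = length (fst V)" "length (snd ?T) = length (snd V)"
      "length (fst ?T) = length (snd ?T) \<or> length (fst ?T) = Suc (length (snd ?T))"
      "X = TypeD \<Longrightarrow> length (fst ?T) = length (snd ?T)"
      by blast+
    consider "interlaced (fst ?T) (snd ?T)" | "X = TypeD" "interlaced (snd ?T) (fst ?T)"
      using Tb by (auto simp: special_symbol_def)
    then show ?thesis
    proof cases
      case 1
      then have "fst ?T = fst V \<and> snd ?T = snd V"
        using interlaced_unique[OF 1 V(1) e len(1-3)] by blast
      then show ?thesis by (simp add: prod_eq_iff)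
    next
      case 2
      then have "snd ?T = fst V \<and> fst ?T = snd V"
        using interlaced_unique[OF 2(2) V(1), unfolded add.commute[of "mset (snd ?T)"], OF e] len by simp
      then show ?thesis using 2(1) by (simp add: prod_eq_iff)
    qed
  qed
  define W where "W = (shift ^^ a) U"
  have W: "W = V \<or> X = TypeD \<and> W = prod.swap V"
    using ab V_eq by (auto simp: W_def)
  have "beta_symbol X q (k0 + 2 * a) W"
    unfolding W_def by (rule beta_symbol_funpow_shift[OF k0])
  moreover have "length (fst W) + length (snd W) = K"
  proof -
    have "length (fst V) + length (snd V) = K"
      unfolding V_def special_rows_def by simp
    then show ?thesis using W by auto
  qed
  ultimately have Wb: "beta_symbol X q K W" using beta_symbol_length[OF qp] by metis
  then have lq: "length q \<le> K" by (simp add: beta_symbol_def)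
  show ?thesis
  proof (cases "W = V")
    case True
    have "added_box X K = 1 - of_bool (X = TypeC)"
      using K(1) by (cases X) (auto simp: added_box_def)
    then have "(\<lambda>k. 2 * z_entry p K k + added_box X k) ` {1..K} = (\<lambda>l. part q l + (K - l)) ` {1..K}"
      using special_rows_beta[OF alternating_added_box, of X K p] Wb True
      by (auto simp: beta_symbol_def V_def)
    then show ?thesis
      using partition_eq_H_partition[OF qp K lq] part_eq_h_part[OF partition qp alternating_added_box K] by blast
  next
    case False
    then have X: "X = TypeD" "W = prod.swap V" using W by auto
    \<comment> \<open>With the rows exchanged, \<open>q\<close> would come from the opposite choice
      of rows to extend. Being of type \<open>D\<close> then forces every row up to \<open>K\<close>
      to be paired, and paired rows do not depend on \<open>\<tau>\<close>.\<close>
    define \<tau> where "\<tau> k = 1 - added_box X k" for k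
    have \<tau>: "alternating \<tau>" "\<tau> 1 = 1" "\<tau> K = 0"
      using K(1) X(1) by (auto simp: alternating_def \<tau>_def added_box_def)
    have "(\<lambda>k. 2 * z_entry p K k + \<tau> k) ` {1..K} = (\<lambda>l. part q l + (K - l)) ` {1..K}"
      using special_rows_beta[OF \<tau>(1), of K p] Wb X \<tau>(3)
      by (simp add: beta_symbol_def V_def Un_commute)
    then have part: "part q k = h_part X p \<tau> k" if "1 \<le> k" "k \<le> K" for k
      using part_eq_h_part[OF partition qp \<tau>(1) K] that by blast
    have paired: "paired_row X p k" if "1 \<le> k" "k \<le> K" for k
      using no_unpaired_row[OF partition _ \<tau>(1,2) _ K(2) lq _ that] qt part K(1) X(1) by simp
    show ?thesis
    proof (rule partition_eq_H_partition[OF qp K lq])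
      fix k assume "1 \<le> k" "k \<le> K"
      then show "part q k = h k" using part paired by (simp add: h_part_def)
    qed
  qed
qed

text \<open>In type \<open>C\<close> an unpaired odd row of length 1 disappears: its single box is
  even and nothing is put in its place. No other row of \<open>p\<close> can vanish.\<close>

lemma h_pos:
  assumes "1 \<le> k" "k \<le> length p" "X \<noteq> TypeC \<or> even k"
  shows "0 < h k"
proof (cases "paired_row X p k")
  case True
  then show ?thesis using part_pos[OF partition assms(1,2)] by (simp add: h_part_def)
next
  case False
  have pos: "0 < part p k" using part_pos[OF partition assms(1,2)] .
  show ?thesis
  proof (cases "part p k = 1 \<and> removed_box X p k = 1")
    case True
    then have "\<not> kept_box X (k, 1)" 
      by (cases "kept_box X (k, part p k)") (simp_all add: removed_box_def)
    then have "added_box X k = 1"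
      using assms(3) by (cases X) (simp_all add: added_box_def kept_box_def even_box_def)
    then show ?thesis using False by (simp add: h_part_def)
  next
    case ne: False
    have "removed_box X p k \<le> 1" by (simp add: removed_box_def)
    then have "removed_box X p k < part p k" using ne pos by arith
    then show ?thesis using False by (simp add: h_part_def)
  qed
qed

lemma le_length_H_partition: "1 \<le> k \<Longrightarrow> 0 < h k \<Longrightarrow> k \<le> length H_partition"
  using part_pos_iff[OF H_partition_partition, of k] by (simp add: part_H_partition)

text \<open>The number of parts used by \<open>type_symbol_of\<close> must be an admissible bound
  for \<open>p\<close>. In type \<open>C\<close> at most the last row of \<open>p\<close> is lost,
  and only if its number is odd; making \<open>k\<close> odd then compensates for it.\<close>

lemma symbol_size_H_partition:
  defines "k \<equiv> (if X = TypeC \<and> even (length H_partition) then length H_partition + 1 else length H_partition)"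
  shows "odd k = (X \<noteq> TypeD)" and "length p \<le> k"
proof -
  have "odd k = (X \<noteq> TypeD) \<and> length p \<le> k"
  proof (cases "X = TypeC")
    case True
    have "length p \<le> k"
    proof (cases "length p \<le> 1")
      case False
      define i where "i = (if even (length p) then length p else length p - 1)"
      have "even i" "1 \<le> i" "i \<le> length p" using False by (auto simp: i_def)
      then have "i \<le> length H_partition" using h_pos le_length_H_partition by blast
      then have "i \<le> k" "odd k" using True by (auto simp: k_def)
      then have "Suc i \<le> k" using \<open>even i\<close> by (metis Suc_leI le_neq_implies_less)
      moreover have "length p \<le> Suc i" by (auto simp: i_def)
      ultimately show ?thesis by simp
    next
      case le: True
      have "odd k" using True by (simp add: k_def)
      then have "1 \<le> k" by (cases k) auto
      then show ?thesis using le by simp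
    qed
    then show ?thesis using True by (auto simp: k_def)
  next
    case False
    then have k: "k = length H_partition" by (simp add: k_def)
    have "length p \<le> length H_partition"
      using h_pos[of "length p"] le_length_H_partition[of "length p"] False by (cases "length p = 0") auto
    moreover have "length H_partition = length p" if "h (Suc (length p)) = 0"
      using calculation length_H_partition part_pos[OF H_partition_partition, of "Suc (length p)"] that
        part_H_partition[of "Suc (length p)"] by (cases "length H_partition = Suc (length p)") auto
    moreover have "length H_partition = Suc (length p)" if "h (Suc (length p)) \<noteq> 0"
      using length_H_partition le_length_H_partition[of "Suc (length p)"] that by simp
    ultimately show ?thesis
      using False h_Suc_length unfolding k
      by (cases X) (auto simp: added_box_def kept_box_def even_box_def split: if_splits)
  qed
  then show "odd k = (X \<noteq> TypeD)" "length p \<le> k" by auto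
qed

text \<open>Sorting the numbers \<open>part p l + (K - l)\<close> by parity always gives two rows;
  the balance is what gives them the lengths required of a \<open>B\<close>-symbol.\<close>

lemma ex_B_symbol:
  assumes K: "odd K" "length p \<le> K"
  obtains S where "B_symbol_of p S" "length (snd S) = K div 2"
proof -
  define \<beta> where "\<beta> l = part p l + (K - l)" for l
  have inj: "inj_on \<beta> {1..K}" unfolding \<beta>_def by (rule inj_on_part_beta[OF partition])
  define B where "B = \<beta> ` {1..K}"
  define L M where "L = {a. 2 * a \<in> B}" and "M = {b. 2 * b + 1 \<in> B}"
  have fin: "finite B" by (simp add: B_def)
  have "(\<lambda>a. 2 * a) ` L \<subseteq> B" "(\<lambda>b. 2 * b + 1) ` M \<subseteq> B" by (auto simp: L_def M_def)
  then have fLM: "finite L" "finite M"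
    using fin by (auto elim!: finite_imageD[OF finite_subset] intro: inj_onI)
  have B: "(\<lambda>a. 2 * a) ` L \<union> (\<lambda>b. 2 * b + 1) ` M = B"
  proof (intro set_eqI iffI)
    fix x assume x: "x \<in> B"
    show "x \<in> (\<lambda>a. 2 * a) ` L \<union> (\<lambda>b. 2 * b + 1) ` M"
    proof (cases "even x")
      case True
      then obtain a where "x = 2 * a" by (rule evenE)
      then show ?thesis using x by (auto simp: L_def)
    next
      case False
      then obtain b where "x = 2 * b + 1" by (rule oddE)
      then show ?thesis using x by (auto simp: M_def)
    qed
  qed (auto simp: L_def M_def)
  have "(\<lambda>b. 2 * b + 1) ` M = {x \<in> B. odd x}"
    by (auto simp: M_def elim!: oddE)
  also have "\<dots> = \<beta> ` {l \<in> {1..K}. odd (\<beta> l)}" by (auto simp: B_def)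
  also have "card \<dots> = card {l \<in> {1..K}. odd (\<beta> l)}"
    by (rule card_image) (rule inj_on_subset[OF inj], auto)
  finally have "card ((\<lambda>b. 2 * b + 1) ` M) = K div 2"
    unfolding \<beta>_def using balance[OF K(2)] by simp
  then have cM: "card M = K div 2" by (simp add: card_image inj_on_def)
  have "(\<lambda>a. 2 * a) ` L \<inter> (\<lambda>b. 2 * b + 1) ` M = {}" by (auto; presburger)
  then have "card B = card L + card M"
    using fLM by (simp add: B[symmetric] card_Un_disjoint card_image inj_on_def)
  moreover have "card B = K" unfolding B_def using card_image[OF inj] by simp
  ultimately have cL: "card L = K div 2 + 1" using cM K(1) by presburger
  let ?S = "(sorted_list_of_set L, sorted_list_of_set M)"
  have m: "2 * (K div 2) + 1 = K" using K(1) by simp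
  have "B_symbol_of p ?S"
    unfolding B_symbol_of_def
  proof (intro exI[of _ "K div 2"] conjI)
    have "2 * (K div 2) + 2 = Suc K" using m by linarith
    then show "part p (2 * (K div 2) + 2) = 0" using K(2) by (simp add: part_eq_0)
    show "is_symbol TypeB ?S" using cL cM by (simp add: is_symbol_def)
    show "(\<lambda>a. 2 * a) ` set (fst ?S) \<union> (\<lambda>b. 2 * b + 1) ` set (snd ?S) =
       {part p k + (2 * (K div 2) + 1 - k) | k. 1 \<le> k \<and> k \<le> 2 * (K div 2) + 1}"
      unfolding m beta_set_collect using B fLM by (simp add: B_def \<beta>_def[abs_def])
  qed (use cM in simp)
  then show ?thesis using that[of ?S] cM by simp
qed

lemma ex_domino_symbol:
  assumes K: "odd K = (X \<noteq> TypeD)" "length p < K \<or> X \<noteq> TypeD \<and> length p \<le> K"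
  obtains S where "domino_symbol_of X p S" "symbol_entries S = symbol_entries (special_rows p K)"
proof (cases "X = TypeD")
  case True
  then obtain K' where K': "K = Suc K'" "odd K'" "length p \<le> K'" using K by (cases K) auto
  obtain S where S: "B_symbol_of p S" "length (snd S) = K' div 2" using ex_B_symbol[OF K'(2,3)] .
  then have l: "2 * length (snd S) + 1 = K'" using K'(2) by simp
  have "domino_symbol_of X p (fst S, 0 # map Suc (snd S))"
    using S(1) True unfolding domino_symbol_of_def D_symbol_of_def by auto
  moreover have "symbol_entries (fst S, 0 # map Suc (snd S)) = symbol_entries (special_rows p K)"
  proof (rule B_symbol_entries[OF partition S(1)])
    fix k assume "k = 2 * length (snd S) + 1"
      "add_mset 0 (mset (fst S) + image_mset Suc (mset (snd S))) = image_mset (z_entry p (Suc k)) (mset_set {1..Suc k})"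
    then show ?thesis
      unfolding symbol_entries_special_rows K'(1) l by (simp add: symbol_entries_def)
  qed
  ultimately show ?thesis using that by blast
next
  case False
  then have K': "odd K" "length p \<le> K" using K by auto
  obtain S where S: "B_symbol_of p S" "length (snd S) = K div 2" using ex_B_symbol[OF K'] .
  then have l: "2 * length (snd S) + 1 = K" using K' by simp
  have "domino_symbol_of X p S" using S(1) False by (cases X) (auto simp: domino_symbol_of_def)
  moreover have "symbol_entries S = symbol_entries (special_rows p K)"
  proof (rule B_symbol_entries[OF partition S(1)])
    fix k assume "k = 2 * length (snd S) + 1"
      "mset (fst S) + mset (snd S) = image_mset (z_entry p k) (mset_set {1..k})"
    then show ?thesis
      unfolding symbol_entries_special_rows l by (simp add: symbol_entries_def)
  qed
  ultimately show ?thesis using that by blast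
qed

lemma is_special_of_H_partition: "is_special_of X n p H_partition"
proof -
  define k where "k = (if X = TypeC \<and> even (length H_partition) then length H_partition + 1 else length H_partition)"
  have k: "odd k = (X \<noteq> TypeD)" "length p \<le> k"
    using symbol_size_H_partition by (simp_all add: k_def)
  \<comment> \<open>A \<open>D\<close>-symbol of \<open>p\<close> with \<open>K\<close> entries in
    all comes from a \<open>B\<close>-symbol with \<open>K - 1\<close> entries, which needs
    \<open>length p < K\<close>. As \<open>k\<close> may equal \<open>length p\<close>, one shift is
    made in type \<open>D\<close>.\<close>
  define K where "K = (if X = TypeD then Suc (Suc k) else k)"
  have K: "odd K = (X \<noteq> TypeD)" "length p < K \<or> X \<noteq> TypeD \<and> length p \<le> K" using k by (auto simp: K_def)
  let ?U = "special_rows p k" and ?T = "special_rows p K"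
  obtain S where S: "domino_symbol_of X p S" "symbol_entries S = symbol_entries ?T"
    using ex_domino_symbol[OF K] .
  have "added_box X k = 1 - of_bool (X = TypeC)" using k(1) by (cases X) (auto simp: added_box_def)
  moreover have "(\<lambda>l. h l + (k - l)) ` {1..k} = (\<lambda>l. part H_partition l + (k - l)) ` {1..k}"
    by (rule image_cong) (auto simp: part_H_partition)
  ultimately have "beta_symbol X H_partition k ?U"
    using special_rows_beta[OF alternating_added_box, of X k p] is_symbol_special_rows[OF partition k(1)]
      beta_set_h_part[OF partition k alternating_added_box]
    by (auto simp: beta_symbol_def k_def)
  then have "type_symbol_of X H_partition ?U" unfolding type_symbol_of_iff k_def[symmetric] .
  moreover have "symbol_equiv X ?U ?T"
    using special_rows_shift[OF k(2)] symbol_equiv.shift symbol_equiv.refl by (auto simp: K_def)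
  ultimately show ?thesis
    unfolding is_special_of_def
    using special_partition_H S special_symbol_special_rows[OF partition K(1)] by metis
qed

end

theorem corollary8p13:
  fixes X :: cartan_type and n :: nat and lam :: "nat \<Rightarrow> complex" and p :: "nat list"
  assumes "simple_rank X n"
    and "integral_weight X n lam"
    and "p = rs_shape (lambda_minus n lam)"
  shows "is_partition (2 * n) p \<and> domino_type n p \<and>
    (\<exists>!q. is_special_of X n p q) \<and>
    (\<exists>q. is_special_of X n p q \<and> special_partition X n q \<and> H_algorithm X n p = diagram q)"
proof -
  have "1 \<le> n" using assms(1) by (cases X) (auto simp: simple_rank_def)
  then interpret balanced_partition X n p
    unfolding assms(3) by (intro balanced_partition.intro lambda_minus_shape(1,3))
  have "\<exists>!q. is_special_of X n p q"
    using is_special_of_H_partition is_special_of_unique by blast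
  then show ?thesis
    using partition lambda_minus_shape(2)[of n lam] assms(3) is_special_of_H_partition
      special_partition_H H_algorithm by blast
qed

end
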